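(* Let $\mu=(\mu_1,\dots,\mu_h)\vdash n-1$ be an isoclinic partition that is symmetric ($\mu=\mu'$) and has an even number of distinct parts. Let $p_\mu:=\max\{i:\mu_i\ge i\}$ and let $\mathbb{F}:=\mathbb{R}$ if $(n-1-p_\mu)/2$ is an even integer and $\mathbb{F}:=\mathbb{C}$ otherwise. For $\delta\in\{0,1\}$ let $L_\delta$ be as below and $d_\delta:=\sum_{\lambda\in L_\delta}d_\lambda$. Then there exists an equi-isoclinic tight fusion frame of $n$ subspaces of dimension $d_\mu/2$ in $\mathbb{F}^{d_\delta/2}$ whose automorphism group contains the alternating group $A_n$.
   Context: Partitions $\lambda\vdash n$: nonincreasing positive integers summing to $n$; Young diagram boxes $(i,j)$ with $j\le\lambda_i$; transpose $\lambda'_i=|\{j:\lambda_j\ge i\}|$; box $(i,j)$ lies on superdiagonal $j-i$; axial distance $D((i,j),(k,l))=(j-i)-(l-k)$. $\operatorname{Tab}(\lambda)$: standard tableaux, $d_\lambda=|\operatorname{Tab}(\lambda)|$; $V_\lambda$ real Hilbert space with orthonormal basis $\{v_T\}$; $\pi_\lambda$ Young's orthogonal form, $\pi_\lambda(s_k)v_T=\frac1{D_T(k+1,k)}v_T+\sqrt{1-\frac1{D_T(k+1,k)^2}}v_{s_kT}$ ($s_k=(k\ k{+}1)$ acting on entries, $D_T(a,b)$ the axial distance from the box of $a$ to that of $b$). For $\mu\vdash n-1$: $\lfloor\mu\rfloor$ is the set of removable boxes, $\mu^\uparrow$ the set of $\lambda\vdash n$ obtained by adding one box ($\lambda-\mu$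 the added box); $R^\lambda$ places $n$ in box $\lambda-\mu$; $\Psi_{\lambda,\mu}v_R=v_{R^\lambda}$. For $L\subseteq\mu^\uparrow$: $V_L=\bigoplus_{\lambda\in L}V_\lambda$, $\pi_L=\bigoplus\pi_\lambda$, $d_L=\sum d_\lambda$, $W_L=\operatorname{im}\Psi_L$, $\Psi_L(v)=\{\sqrt{d_\lambda/d_L}\Psi_{\lambda,\mu}v\}$, $\mathcal{W}_L=\{\pi_L(t_k)W_L\}_{k\in[n]}$ with $t_k\in S_n$, $t_k(n)=k$. $\mu$ is isoclinic if some nonempty proper $L\subset\mu^\uparrow$ makes $\mathcal{W}_L$ equi-isoclinic. If $\mu$ has $m$ distinct parts, enumerate $\mu^\uparrow=\{\lambda_1,\dots,\lambda_{m+1}\}$ so the superdiagonal indices of $\lambda_p-\mu$ strictly decrease in $p$; $L_0=\{\lambda_p:p\text{ even}\}$, $L_1=\{\lambda_p:p\text{ odd}\}$. An ensemble of $r$-dim subspaces $\{W_k\}_{k\in[n]}$ with isometries $\Phi_k$ onto them is a tight fusion frame if the orthogonal projections sum to a multiple of the identity, equi-isoclinic if there is $\alpha$ with $(\Phi_k^*\Phi_\ell)^*(\Phi_k^*\Phi_\ell)=\alpha I$ for $k\ne\ell$; its automorphism group is the set of $\tau\in S_n$ with a unitary $U$ satisfying $UW_k=W_{\tau(k)}$ for all $k$. *)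

theory Defs
  imports
    "HOL-Algebra.Sym_Groups"
    "HOL-Library.Countable_Set"
    "Jordan_Normal_Form.Schur_Decomposition"
begin

section \<open>Partitions and Young diagrams\<close>

definition is_partition :: "nat \<Rightarrow> nat list \<Rightarrow> bool" where
  "is_partition n \<nu> \<longleftrightarrow> sorted_wrt (\<ge>) \<nu> \<and> (\<forall>x\<in>set \<nu>. 0 < x) \<and> sum_list \<nu> = n"

text \<open>Parts, rows and columns are numbered from 1; parts beyond the length are 0.\<close>

definition part :: "nat list \<Rightarrow> nat \<Rightarrow> nat" where
  "part \<nu> i = (if 1 \<le> i \<and> i \<le> length \<nu> then \<nu> ! (i - 1) else 0)"

definition diagram :: "nat list \<Rightarrow> (nat \<times> nat) set" where
  "diagram \<nu> = {(i, j). 1 \<le> i \<and> 1 \<le> j \<and> j \<le> part \<nu> i}"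

definition transpose_partition :: "nat list \<Rightarrow> nat list" where
  "transpose_partition \<nu> = map (\<lambda>i. card {j. 1 \<le> j \<and> i \<le> part \<nu> j}) [1..<Suc (part \<nu> 1)]"

definition durfee :: "nat list \<Rightarrow> nat" where
  "durfee \<mu> = Max {i \<in> {1..length \<mu>}. i \<le> part \<mu> i}"

definition superdiagonal :: "nat \<times> nat \<Rightarrow> int" where
  "superdiagonal b = int (snd b) - int (fst b)"

definition axial_dist :: "nat \<times> nat \<Rightarrow> nat \<times> nat \<Rightarrow> int" where
  "axial_dist b c = superdiagonal b - superdiagonal c"

definition up_set :: "nat list \<Rightarrow> nat list set" where
  "up_set \<mu> = {\<nu>. is_partition (Suc (sum_list \<mu>)) \<nu> \<and>
              (\<exists>b. b \<notin> diagram \<mu> \<and> diagram \<nu> = insert b (diagram \<mu>))}"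

definition added_box :: "nat list \<Rightarrow> nat list \<Rightarrow> nat \<times> nat" where
  "added_box \<nu> \<mu> = the_elem (diagram \<nu> - diagram \<mu>)"

definition up_enum :: "nat list \<Rightarrow> nat list list" where
  "up_enum \<mu> = (THE ls. set ls = up_set \<mu> \<and>
     sorted_wrt (\<lambda>\<kappa> \<nu>. superdiagonal (added_box \<kappa> \<mu>) > superdiagonal (added_box \<nu> \<mu>)) ls)"

definition L_parity :: "nat \<Rightarrow> nat list \<Rightarrow> nat list set" where
  "L_parity \<delta> \<mu> = {up_enum \<mu> ! (p - 1) | p. p \<in> {1..length (up_enum \<mu>)} \<and> p mod 2 = \<delta>}"


section \<open>Standard tableaux and Young's orthogonal form\<close>

text \<open>A tableau assigns entries to boxes and is 0 outside its diagram, so that tableaux of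
  different shapes are different functions.\<close>

type_synonym tableau = "nat \<times> nat \<Rightarrow> nat"

definition Tab :: "nat list \<Rightarrow> tableau set" where
  "Tab \<nu> = {T. bij_betw T (diagram \<nu>) {1..sum_list \<nu>} \<and> (\<forall>b. b \<notin> diagram \<nu> \<longrightarrow> T b = 0) \<and>
     (\<forall>i j. (i, j) \<in> diagram \<nu> \<and> (i, Suc j) \<in> diagram \<nu> \<longrightarrow> T (i, j) < T (i, Suc j)) \<and>
     (\<forall>i j. (i, j) \<in> diagram \<nu> \<and> (Suc i, j) \<in> diagram \<nu> \<longrightarrow> T (i, j) < T (Suc i, j))}"

definition d_tab :: "nat list \<Rightarrow> nat" where
  "d_tab \<nu> = card (Tab \<nu>)"

definition box_of :: "tableau \<Rightarrow> nat \<Rightarrow> nat \<times> nat" where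
  "box_of T a = (THE b. T b = a)"

definition D_tab :: "tableau \<Rightarrow> nat \<Rightarrow> nat \<Rightarrow> int" where
  "D_tab T a b = axial_dist (box_of T a) (box_of T b)"

definition adj_transp :: "nat \<Rightarrow> nat \<Rightarrow> nat" where
  "adj_transp k = Transposition.transpose k (Suc k)"

text \<open>The real Hilbert space with an orthonormal basis indexed by a finite set \<open>A\<close> is realised as
  \<open>\<real>\<^bsup>card A\<^esup>\<close> via the library enumeration \<open>from_nat_into A\<close> of \<open>A\<close>. \<open>mat_on A B K\<close> is the matrix
  of the operator whose coefficient from basis vector \<open>b \<in> B\<close> to basis vector \<open>a \<in> A\<close> is \<open>K a b\<close>;
  \<open>entry_on\<close> recovers these coefficients.\<close>

definition mat_on :: "'i set \<Rightarrow> 'j set \<Rightarrow> ('i \<Rightarrow> 'j \<Rightarrow> real) \<Rightarrow> real mat" where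
  "mat_on A B K = mat (card A) (card B) (\<lambda>(i, j). K (from_nat_into A i) (from_nat_into B j))"

definition entry_on :: "'i set \<Rightarrow> 'j set \<Rightarrow> real mat \<Rightarrow> 'i \<Rightarrow> 'j \<Rightarrow> real" where
  "entry_on A B M a b = M $$ (to_nat_on A a, to_nat_on B b)"

text \<open>If \<open>adj_transp k \<circ> T\<close> is not standard, then the axial distance is \<open>\<plusminus>1\<close> and its coefficient
  vanishes.\<close>

definition young_gen :: "nat list \<Rightarrow> nat \<Rightarrow> real mat" where
  "young_gen \<nu> k = mat_on (Tab \<nu>) (Tab \<nu>) (\<lambda>S T.
     if S = T then 1 / of_int (D_tab T (Suc k) k)
     else if S = adj_transp k \<circ> T then sqrt (1 - 1 / (of_int (D_tab T (Suc k) k))\<^sup>2)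
     else 0)"

text \<open>The representation of the symmetric group on \<open>{1..n}\<close>, \<open>n = sum_list \<nu>\<close>, determined by its
  values on the generators. (The condition at \<open>id\<close> matters only for \<open>n \<le> 1\<close>.)\<close>

definition young_rep :: "nat list \<Rightarrow> (nat \<Rightarrow> nat) \<Rightarrow> real mat" where
  "young_rep \<nu> = (THE \<pi>.
     \<pi> \<in> hom (sym_group (sum_list \<nu>)) (ring_mat TYPE(real) (d_tab \<nu>) ()) \<and>
     \<pi> \<in> extensional (carrier (sym_group (sum_list \<nu>))) \<and>
     \<pi> id = 1\<^sub>m (d_tab \<nu>) \<and>
     (\<forall>k\<in>{1..<sum_list \<nu>}. \<pi> (adj_transp k) = young_gen \<nu> k))"

text \<open>The direct sum over \<open>\<nu> \<in> L\<close> has the orthonormal basis \<open>Tabs L\<close>, the union being disjoint.\<close>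

definition Tabs :: "nat list set \<Rightarrow> tableau set" where
  "Tabs L = (\<Union>\<nu>\<in>L. Tab \<nu>)"

definition d_sum :: "nat list set \<Rightarrow> nat" where
  "d_sum L = (\<Sum>\<nu>\<in>L. d_tab \<nu>)"

definition rep_sum :: "nat list set \<Rightarrow> (nat \<Rightarrow> nat) \<Rightarrow> real mat" where
  "rep_sum L \<sigma> = mat_on (Tabs L) (Tabs L) (\<lambda>S T.
     \<Sum>\<nu>\<in>L. if S \<in> Tab \<nu> \<and> T \<in> Tab \<nu>
            then entry_on (Tab \<nu>) (Tab \<nu>) (young_rep \<nu> \<sigma>) S T else 0)"

definition extend_tab :: "nat list \<Rightarrow> nat list \<Rightarrow> tableau \<Rightarrow> tableau" where
  "extend_tab \<nu> \<mu> R = R(added_box \<nu> \<mu> := sum_list \<nu>)"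

definition Psi_sum :: "nat list set \<Rightarrow> nat list \<Rightarrow> real mat" where
  "Psi_sum L \<mu> = mat_on (Tabs L) (Tab \<mu>) (\<lambda>T R.
     \<Sum>\<nu>\<in>L. if T = extend_tab \<nu> \<mu> R then sqrt (real (d_tab \<nu>) / real (d_sum L)) else 0)"


section \<open>Fusion frames\<close>

text \<open>An ensemble of \<open>n\<close> subspaces of \<open>F\<^bsup>N\<^esup>\<close> is a function \<open>W\<close> on \<open>{1..n}\<close>, where \<open>F\<close> is the scalar
  type (here \<open>real\<close> or \<open>complex\<close>); \<open>conjugate\<close> is the identity on \<open>real\<close>.\<close>

definition mat_image :: "'a::conjugatable_field mat \<Rightarrow> 'a vec set \<Rightarrow> 'a vec set" where
  "mat_image A W = (\<lambda>w. A *\<^sub>v w) ` W"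

definition isometry_onto ::
    "nat \<Rightarrow> nat \<Rightarrow> 'a::conjugatable_field mat \<Rightarrow> 'a vec set \<Rightarrow> bool" where
  "isometry_onto N r \<Phi> W \<longleftrightarrow>
     \<Phi> \<in> carrier_mat N r \<and> mat_adjoint \<Phi> * \<Phi> = 1\<^sub>m r \<and> mat_image \<Phi> (carrier_vec r) = W"

text \<open>The condition on \<open>\<Phi>\<close> does not depend on the choice of the isometries, since \<open>\<Phi> k\<close> is
  determined by \<open>W k\<close> up to right multiplication by a unitary.\<close>

definition equi_isoclinic ::
    "nat \<Rightarrow> nat \<Rightarrow> nat \<Rightarrow> (nat \<Rightarrow> 'a::conjugatable_field vec set) \<Rightarrow> bool" where
  "equi_isoclinic n r N W \<longleftrightarrow>
     (\<exists>\<Phi>. (\<forall>k\<in>{1..n}. isometry_onto N r (\<Phi> k) (W k)) \<and>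
       (\<exists>\<alpha>. \<forall>k\<in>{1..n}. \<forall>l\<in>{1..n}. k \<noteq> l \<longrightarrow>
          mat_adjoint (mat_adjoint (\<Phi> k) * \<Phi> l) * (mat_adjoint (\<Phi> k) * \<Phi> l) = \<alpha> \<cdot>\<^sub>m 1\<^sub>m r))"

definition orthogonal_projection ::
    "nat \<Rightarrow> 'a::conjugatable_field mat \<Rightarrow> 'a vec set \<Rightarrow> bool" where
  "orthogonal_projection N P W \<longleftrightarrow>
     P \<in> carrier_mat N N \<and> P * P = P \<and> mat_adjoint P = P \<and> mat_image P (carrier_vec N) = W"

definition tight_fusion_frame ::
    "nat \<Rightarrow> nat \<Rightarrow> (nat \<Rightarrow> 'a::conjugatable_field vec set) \<Rightarrow> bool" where
  "tight_fusion_frame n N W \<longleftrightarrow>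
     (\<exists>P. (\<forall>k\<in>{1..n}. orthogonal_projection N (P k) (W k)) \<and>
       (\<exists>c. mat N N (\<lambda>(i, j). \<Sum>k\<in>{1..n}. P k $$ (i, j)) = c \<cdot>\<^sub>m 1\<^sub>m N))"

text \<open>\<open>n\<close> subspaces of dimension \<open>r\<close> in \<open>F\<^bsup>N\<^esup>\<close>.\<close>

definition equi_isoclinic_tff ::
    "nat \<Rightarrow> nat \<Rightarrow> nat \<Rightarrow> (nat \<Rightarrow> 'a::conjugatable_field vec set) \<Rightarrow> bool" where
  "equi_isoclinic_tff n r N W \<longleftrightarrow> equi_isoclinic n r N W \<and> tight_fusion_frame n N W"

definition unitary_mat :: "nat \<Rightarrow> 'a::conjugatable_field mat \<Rightarrow> bool" where
  "unitary_mat N U \<longleftrightarrow>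
     U \<in> carrier_mat N N \<and> mat_adjoint U * U = 1\<^sub>m N \<and> U * mat_adjoint U = 1\<^sub>m N"

definition fusion_aut ::
    "nat \<Rightarrow> nat \<Rightarrow> (nat \<Rightarrow> 'a::conjugatable_field vec set) \<Rightarrow> (nat \<Rightarrow> nat) set" where
  "fusion_aut n N W = {\<tau> \<in> carrier (sym_group n).
     \<exists>U. unitary_mat N U \<and> (\<forall>k\<in>{1..n}. mat_image U (W k) = W (\<tau> k))}"


section \<open>Isoclinic partitions\<close>

definition W_sub :: "nat list set \<Rightarrow> nat list \<Rightarrow> real vec set" where
  "W_sub L \<mu> = mat_image (Psi_sum L \<mu>) (carrier_vec (d_tab \<mu>))"

text \<open>The subspaces do not depend on the choice of the \<open>t k\<close>, because \<open>W_sub L \<mu>\<close> is invariant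
  under the stabiliser of \<open>n = Suc (sum_list \<mu>)\<close>.\<close>

definition isoclinic :: "nat list \<Rightarrow> bool" where
  "isoclinic \<mu> \<longleftrightarrow>
     (let n = Suc (sum_list \<mu>) in
      \<exists>L t. L \<noteq> {} \<and> L \<subset> up_set \<mu> \<and>
        (\<forall>k\<in>{1..n}. t k \<in> carrier (sym_group n) \<and> t k n = k) \<and>
        equi_isoclinic n (d_tab \<mu>) (d_sum L) (\<lambda>k. mat_image (rep_sum L (t k)) (W_sub L \<mu>)))"

end

theory Submission
  imports Defs "HOL-Library.Z2"
begin

text \<open>Young's orthogonal form is a representation (the Coxeter relations hold and present the symmetric
  group), and by Schur's lemma the projections onto \<open>\<W>\<^sub>L\<close> always sum to a scalar. Compressing the
  transposition \<open>(n-1 n)\<close> to \<open>W\<^sub>L\<close> gives a diagonal matrix whose entry at a tableau with \<open>n - 1\<close> in the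
  removable box \<open>x\<close> is \<open>h\<^sub>L(x) = \<Sum>\<^bsub>\<lambda>\<in>L\<^esub> (d\<^sub>\<lambda> / d\<^sub>L) / D(\<lambda> - \<mu>, x)\<close>, so \<open>\<W>\<^sub>L\<close> is equi-isoclinic iff
  \<open>\<bar>h\<^sub>L\<bar>\<close> is constant. For \<open>L = \<mu>\<^sup>\<up>\<close> the subspaces are orthogonal, hence the unnormalised sums for \<open>L\<close>
  and its complement are negatives of each other. As the contents of addable and removable boxes
  interlace and \<open>h\<^sub>L\<close> increases between its poles, constancy of \<open>\<bar>h\<^sub>L\<bar>\<close> forces \<open>L\<close> to be one of
  \<open>L\<^sub>0\<close>, \<open>L\<^sub>1\<close>; then both of them are equi-isoclinic.

  If \<open>\<mu> = \<mu>'\<close> has an even number of distinct parts, both \<open>L\<^sub>\<delta>\<close> are closed under transposition. The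
  operator \<open>J v\<^sub>T = \<plusminus>v\<^bsub>T'\<^esub>\<close> with suitable signs commutes with the alternating group, preserves \<open>W\<^bsub>L\<^sub>\<delta>\<^esub>\<close>
  and satisfies \<open>J\<^sup>2 = (-1)\<^bsup>e\<^esup>\<close>, where \<open>e = (n - 1 - p\<^sub>\<mu>) / 2\<close> is the number of boxes of \<open>\<mu>\<close> above the
  diagonal. Restricting to an eigenspace of \<open>J\<close>, which needs \<open>\<i>\<close> exactly if \<open>e\<close> is odd, halves all
  dimensions.\<close>

section \<open>Adjacent transpositions and the Coxeter presentation\<close>

lemma adj_transp_eq_if: "adj_transp k x = (if x = k then Suc k else if x = Suc k then k else x)"
  by (simp add: adj_transp_def Transposition.transpose_def)

lemma adj_transp_simps [simp]:
  "adj_transp k k = Suc k" "adj_transp k (Suc k) = k"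
  "x \<noteq> k \<Longrightarrow> x \<noteq> Suc k \<Longrightarrow> adj_transp k x = x"
  by (simp_all add: adj_transp_eq_if)

lemma adj_transp_involutive [simp]: "adj_transp k (adj_transp k x) = x"
  by (simp add: adj_transp_def)

lemma adj_transp_comp_self: "adj_transp k \<circ> (adj_transp k \<circ> f) = f"
  by (simp add: fun_eq_iff)

lemma adj_transp_comp_eq_iff: "adj_transp k \<circ> f = g \<longleftrightarrow> f = adj_transp k \<circ> g"
  using adj_transp_comp_self by metis

lemma inv_adj_transp: "inv' (adj_transp k) = adj_transp k"
  by (simp add: adj_transp_def)

lemma adj_transp_permutes: "1 \<le> k \<Longrightarrow> k < n \<Longrightarrow> adj_transp k permutes {1..n}"
  unfolding adj_transp_def by (rule permutes_swap_id) auto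

lemma sign_adj_transp_comp: "permutation \<sigma> \<Longrightarrow> sign (adj_transp k \<circ> \<sigma>) = - sign \<sigma>"
  by (simp add: adj_transp_def sign_compose sign_swap_id permutation_swap_id)

lemma inv_adj_transp_comp:
  "\<sigma> permutes {1..n} \<Longrightarrow> inv' (adj_transp k \<circ> \<sigma>) = inv' \<sigma> \<circ> adj_transp k"
  using o_inv_distrib[of "adj_transp k" \<sigma>] inv_adj_transp[of k]
  by (simp add: permutes_bij adj_transp_def)

lemma permutes_fixing_top:
  assumes "\<sigma> permutes {1..Suc n}" "\<sigma> (Suc n) = Suc n"
  shows "\<sigma> permutes {1..n}"
  using assms by (intro permutes_superset[OF assms(1)]) (auto simp: le_Suc_eq)

lemma permutes_Suc: "\<sigma> permutes {1..n} \<Longrightarrow> \<sigma> permutes {1..Suc n}"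
  by (rule permutes_subset) auto

lemma permutes_adj_transp_induct [consumes 1, case_names id step]:
  assumes "\<sigma> permutes {1..n}"
    and "P id"
    and step: "\<And>k \<sigma>. 1 \<le> k \<Longrightarrow> k < n \<Longrightarrow> \<sigma> permutes {1..n} \<Longrightarrow> P \<sigma> \<Longrightarrow> P (adj_transp k \<circ> \<sigma>)"
  shows "P \<sigma>"
  using assms(1) finite_atLeastAtMost
proof (induction rule: permutes_induct)
  case id
  show ?case by (rule assms(2))
next
  case (swap a b \<sigma>)
  have word: "P (apply_adj_transps ks \<circ> \<sigma>) \<and> apply_adj_transps ks \<circ> \<sigma> permutes {1..n}"
    if "set ks \<subseteq> {1..<n}" for ks
    using that
  proof (induction ks)
    case Nil
    show ?case using swap.IH swap.hyps by simp
  next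
    case (Cons k ks)
    hence k: "1 \<le> k" "k < n" and IH: "P (apply_adj_transps ks \<circ> \<sigma>)" "apply_adj_transps ks \<circ> \<sigma> permutes {1..n}"
      by (auto simp del: o_apply)
    have "apply_adj_transps (k # ks) \<circ> \<sigma> = adj_transp k \<circ> (apply_adj_transps ks \<circ> \<sigma>)"
      by (simp add: adj_transp_def comp_assoc)
    thus ?case
      using step[OF k IH(2,1)] permutes_compose[OF IH(2) adj_transp_permutes[OF k]] by (simp only:)
  qed
  define lo hi where "lo = min a b" and "hi = max a b"
  have lo_hi: "lo < hi" "lo \<in> {1..n}" "hi \<in> {1..n}"
    using swap.hyps by (auto simp: lo_def hi_def min_def max_def)
  have "Transposition.transpose a b = Transposition.transpose lo hi"
    by (simp add: lo_def hi_def min_def max_def transpose_commute)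
  also have "\<dots> = apply_adj_transps (adj_transp_seq lo hi)"
    by (rule adj_transp_seq_correct[symmetric, OF lo_hi(1)])
  finally have "Transposition.transpose a b = apply_adj_transps (adj_transp_seq lo hi)" .
  moreover have "set (adj_transp_seq lo hi) \<subseteq> {1..<n}"
    unfolding set_adj_transp_seq[OF lo_hi(1)] using lo_hi by auto
  ultimately show ?case using word by metis
qed

text \<open>The Coxeter relations present the symmetric group: a permutation of \<open>{1..n+1}\<close> is uniquely
  \<open>s\<^sub>k s\<^bsub>k+1\<^esub> \<cdots> s\<^sub>n \<tau>\<close> with \<open>\<tau>\<close> fixing \<open>n + 1\<close>, and a further generator can be pushed through the cycle.\<close>

definition cycle_word :: "(nat \<Rightarrow> 'a \<Rightarrow> 'a) \<Rightarrow> nat \<Rightarrow> nat \<Rightarrow> 'a \<Rightarrow> 'a" where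
  "cycle_word g k n = foldr (\<lambda>i f. g i \<circ> f) [k..<n] id"

lemma cycle_word_self [simp]: "cycle_word g n n = id"
  by (simp add: cycle_word_def)

lemma cycle_word_rec: "k < n \<Longrightarrow> cycle_word g k n = g k \<circ> cycle_word g (Suc k) n"
  by (simp add: cycle_word_def upt_conv_Cons)

primrec coxeter_lift :: "(nat \<Rightarrow> 'a \<Rightarrow> 'a) \<Rightarrow> nat \<Rightarrow> (nat \<Rightarrow> nat) \<Rightarrow> 'a \<Rightarrow> 'a" where
  "coxeter_lift g 0 = (\<lambda>\<sigma>. id)"
| "coxeter_lift g (Suc n) = (\<lambda>\<sigma>. cycle_word g (\<sigma> (Suc n)) (Suc n) \<circ>
     coxeter_lift g n (inv' (cycle_word adj_transp (\<sigma> (Suc n)) (Suc n)) \<circ> \<sigma>))"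

lemma coxeter_lift_id: "coxeter_lift g n id = id"
  by (induction n) auto

lemma adj_cycle_permutes:
  assumes "1 \<le> k" "k \<le> n"
  shows "cycle_word adj_transp k n permutes {1..n}"
  using assms(2,1)
proof (induction rule: inc_induct)
  case (step k)
  thus ?case
    by (simp only: cycle_word_rec[of k]) (intro permutes_compose adj_transp_permutes; simp)
qed (simp add: permutes_id)

lemma adj_cycle_top: "k \<le> n \<Longrightarrow> cycle_word adj_transp k n n = k"
proof (induction rule: inc_induct)
  case (step k)
  thus ?case by (simp add: cycle_word_rec[of k])
qed simp

lemma permutes_Suc_decompose:
  assumes \<sigma>: "\<sigma> permutes {1..Suc n}"
  obtains k \<tau> where "1 \<le> k" "k \<le> Suc n" "\<tau> permutes {1..n}"
    "\<sigma> = cycle_word adj_transp k (Suc n) \<circ> \<tau>"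
proof -
  define k where "k = \<sigma> (Suc n)"
  have k_range: "1 \<le> k" "k \<le> Suc n"
    using permutes_in_image[OF \<sigma>, of "Suc n"] by (auto simp: k_def)
  define c where "c = cycle_word adj_transp k (Suc n)"
  have cycle: "c permutes {1..Suc n}" unfolding c_def by (rule adj_cycle_permutes[OF k_range])
  have "inv' c k = Suc n"
    using adj_cycle_top[OF k_range(2)] permutes_inverses(2)[OF cycle, of "Suc n"] by (simp add: c_def)
  hence "(inv' c \<circ> \<sigma>) (Suc n) = Suc n" by (simp add: k_def)
  hence "inv' c \<circ> \<sigma> permutes {1..n}"
    by (rule permutes_fixing_top[OF permutes_compose[OF \<sigma> permutes_inv[OF cycle]]])
  moreover have "\<sigma> = c \<circ> (inv' c \<circ> \<sigma>)"
    by (simp add: comp_assoc[symmetric] permutes_inv_o(1)[OF cycle])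
  ultimately show ?thesis using that k_range by (simp add: c_def)
qed

lemma coxeter_lift_cycle_comp:
  assumes "1 \<le> k" "k \<le> Suc n" "\<tau> permutes {1..n}"
  shows "coxeter_lift g (Suc n) (cycle_word adj_transp k (Suc n) \<circ> \<tau>) =
    cycle_word g k (Suc n) \<circ> coxeter_lift g n \<tau>"
proof -
  let ?c = "cycle_word adj_transp k (Suc n)"
  have "inv' ?c \<circ> (?c \<circ> \<tau>) = \<tau>"
    by (simp add: comp_assoc[symmetric] permutes_inv_o(2)[OF adj_cycle_permutes[OF assms(1,2)]])
  moreover have "(?c \<circ> \<tau>) (Suc n) = k"
    using adj_cycle_top[OF assms(2)] permutes_not_in[OF assms(3), of "Suc n"] by simp
  ultimately show ?thesis by simp
qed

lemma coxeter_lift_pushed: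
  assumes k: "1 \<le> k" "k \<le> Suc n" and \<tau>: "\<tau> permutes {1..n}" and i: "1 \<le> i" "i < n"
    and adj: "adj_transp j \<circ> cycle_word adj_transp k (Suc n) = cycle_word adj_transp k (Suc n) \<circ> adj_transp i"
    and gen: "g j \<circ> cycle_word g k (Suc n) = cycle_word g k (Suc n) \<circ> g i"
    and lift: "coxeter_lift g n (adj_transp i \<circ> \<tau>) = g i \<circ> coxeter_lift g n \<tau>"
    and \<sigma>: "\<sigma> = cycle_word adj_transp k (Suc n) \<circ> \<tau>"
  shows "coxeter_lift g (Suc n) (adj_transp j \<circ> \<sigma>) = g j \<circ> coxeter_lift g (Suc n) \<sigma>"
proof -
  have "adj_transp j \<circ> \<sigma> = cycle_word adj_transp k (Suc n) \<circ> (adj_transp i \<circ> \<tau>)"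
    by (simp only: \<sigma> comp_assoc[symmetric] adj)
  hence "coxeter_lift g (Suc n) (adj_transp j \<circ> \<sigma>) = cycle_word g k (Suc n) \<circ> coxeter_lift g n (adj_transp i \<circ> \<tau>)"
    using coxeter_lift_cycle_comp[OF k permutes_compose[OF \<tau> adj_transp_permutes[OF i]]] by (simp only:)
  also have "\<dots> = g j \<circ> coxeter_lift g (Suc n) \<sigma>"
    by (simp only: lift \<sigma> coxeter_lift_cycle_comp[OF k \<tau>] comp_assoc[symmetric] gen)
  finally show ?thesis .
qed

lemma coxeter_lift_absorbed:
  assumes k: "1 \<le> k" "k \<le> Suc n" and k': "1 \<le> k'" "k' \<le> Suc n" and \<tau>: "\<tau> permutes {1..n}"
    and adj: "adj_transp j \<circ> cycle_word adj_transp k (Suc n) = cycle_word adj_transp k' (Suc n)"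
    and gen: "g j \<circ> cycle_word g k (Suc n) = cycle_word g k' (Suc n)"
    and \<sigma>: "\<sigma> = cycle_word adj_transp k (Suc n) \<circ> \<tau>"
  shows "coxeter_lift g (Suc n) (adj_transp j \<circ> \<sigma>) = g j \<circ> coxeter_lift g (Suc n) \<sigma>"
proof -
  have "adj_transp j \<circ> \<sigma> = cycle_word adj_transp k' (Suc n) \<circ> \<tau>"
    by (simp only: \<sigma> comp_assoc[symmetric] adj)
  thus ?thesis
    by (simp only: \<sigma> coxeter_lift_cycle_comp[OF k \<tau>] coxeter_lift_cycle_comp[OF k' \<tau>] comp_assoc[symmetric] gen)
qed

locale coxeter_action =
  fixes g :: "nat \<Rightarrow> 'a \<Rightarrow> 'a" and N :: nat
  assumes involutive: "\<And>k x. 1 \<le> k \<Longrightarrow> k < N \<Longrightarrow> g k (g k x) = x"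
    and braid: "\<And>k x. 1 \<le> k \<Longrightarrow> Suc k < N \<Longrightarrow>
      g k (g (Suc k) (g k x)) = g (Suc k) (g k (g (Suc k) x))"
    and commute: "\<And>k l x. 1 \<le> k \<Longrightarrow> Suc k < l \<Longrightarrow> l < N \<Longrightarrow> g k (g l x) = g l (g k x)"
begin

lemma gen_cycle_before: "j < n \<Longrightarrow> g j \<circ> cycle_word g (Suc j) n = cycle_word g j n"
  by (simp add: cycle_word_rec[of j])

lemma gen_cycle_start:
  assumes "1 \<le> k" "k < n" "n \<le> N"
  shows "g k \<circ> cycle_word g k n = cycle_word g (Suc k) n"
  using involutive[of k] assms by (simp add: cycle_word_rec[of k] fun_eq_iff)

lemma gen_cycle_below:
  assumes "1 \<le> j" "k \<le> n" "n \<le> N" "Suc j < k"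
  shows "g j \<circ> cycle_word g k n = cycle_word g k n \<circ> g j"
  using assms(2,4)
proof (induction rule: inc_induct)
  case (step k)
  thus ?case using commute[of j k] assms(1,3) by (simp add: cycle_word_rec[of k] fun_eq_iff)
qed simp

lemma gen_cycle_inside:
  assumes "1 \<le> k" "k \<le> i" "Suc i < n" "n \<le> N"
  shows "g (Suc i) \<circ> cycle_word g k n = cycle_word g k n \<circ> g i"
  using assms(2,1)
proof (induction rule: inc_induct)
  case base
  show ?case
  proof
    fix x
    let ?rest = "cycle_word g (Suc (Suc i)) n"
    have "g (Suc i) (g i (g (Suc i) (?rest x))) = g i (g (Suc i) (g i (?rest x)))"
      using base assms(3,4) by (intro braid[symmetric]) auto
    also have "g i (?rest x) = ?rest (g i x)"
      using gen_cycle_below[of i "Suc (Suc i)" n] base assms(3,4) by (simp add: fun_eq_iff)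
    finally show "(g (Suc i) \<circ> cycle_word g i n) x = (cycle_word g i n \<circ> g i) x"
      using assms(3) by (simp add: cycle_word_rec[of i] cycle_word_rec[of "Suc i"])
  qed
next
  case (step k)
  thus ?case
    using commute[of k "Suc i", symmetric] assms(3,4) by (simp add: cycle_word_rec[of k] fun_eq_iff)
qed

end

lemma coxeter_action_adj_transp: "coxeter_action adj_transp N"
  by unfold_locales (simp_all add: adj_transp_eq_if)

lemma (in coxeter_action) coxeter_lift_step:
  assumes "n \<le> N" "\<sigma> permutes {1..n}" "1 \<le> j" "j < n"
  shows "coxeter_lift g n (adj_transp j \<circ> \<sigma>) = g j \<circ> coxeter_lift g n \<sigma>"
  using assms
proof (induction n arbitrary: \<sigma> j)
  case (Suc n)
  interpret sym: coxeter_action adj_transp "Suc n" by (rule coxeter_action_adj_transp)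
  note n = \<open>Suc n \<le> N\<close> and j = \<open>1 \<le> j\<close> \<open>j < Suc n\<close>
  obtain k \<tau> where k: "1 \<le> k" "k \<le> Suc n" and \<tau>: "\<tau> permutes {1..n}"
    and \<sigma>: "\<sigma> = cycle_word adj_transp k (Suc n) \<circ> \<tau>"
    using permutes_Suc_decompose[OF Suc.prems(2)] by blast
  note lift = Suc.IH[OF Suc_leD[OF n] \<tau>]
  consider (inside) "k < j" | (start) "j = k" | (before) "k = Suc j" | (below) "Suc j < k"
    by linarith
  thus ?case
  proof cases
    case inside
    then obtain i where i: "j = Suc i" "k \<le> i" "Suc i < Suc n" using j by (cases j) auto
    hence i': "1 \<le> i" "i < n" using k by auto
    show ?thesis
      using coxeter_lift_pushed[OF k \<tau> i' _ _ lift[OF i'] \<sigma>, of "Suc i"]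
        gen_cycle_inside[OF k(1) i(2,3) n] sym.gen_cycle_inside[OF k(1) i(2,3) order_refl]
      by (simp only: i(1))
  next
    case start
    show ?thesis
      using coxeter_lift_absorbed[OF k _ _ \<tau> sym.gen_cycle_start[OF k(1)] gen_cycle_start[OF k(1) _ n] \<sigma>] j
      by (simp only: start)
  next
    case before
    show ?thesis
      by (rule coxeter_lift_absorbed[OF k j(1) less_imp_le[OF j(2)] \<tau> _ _ \<sigma>])
        (simp_all only: before sym.gen_cycle_before[OF j(2)] gen_cycle_before[OF j(2)])
  next
    case below
    hence j': "j < n" using k by simp
    show ?thesis
      by (rule coxeter_lift_pushed[OF k \<tau> j(1) j' sym.gen_cycle_below[OF j(1) k(2) order_refl below]
            gen_cycle_below[OF j(1) k(2) n below] lift[OF j(1) j'] \<sigma>])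
  qed
qed simp

section \<open>Young diagrams\<close>

definition young :: "(nat \<times> nat) set \<Rightarrow> bool" where
  "young Y \<longleftrightarrow> finite Y \<and> (\<forall>(i, j)\<in>Y. 1 \<le> i \<and> 1 \<le> j \<and> {1..i} \<times> {1..j} \<subseteq> Y)"

lemma young_finite: "young Y \<Longrightarrow> finite Y"
  by (simp add: young_def)

lemma young_pos: "young Y \<Longrightarrow> (i, j) \<in> Y \<Longrightarrow> 1 \<le> i \<and> 1 \<le> j"
  unfolding young_def by fast

lemma young_down:
  "young Y \<Longrightarrow> (i, j) \<in> Y \<Longrightarrow> 1 \<le> i' \<Longrightarrow> i' \<le> i \<Longrightarrow> 1 \<le> j' \<Longrightarrow> j' \<le> j \<Longrightarrow> (i', j') \<in> Y"
  unfolding young_def by fastforce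

lemma youngI:
  assumes "finite Y" "\<And>i j. (i, j) \<in> Y \<Longrightarrow> 1 \<le> i \<and> 1 \<le> j"
    and up: "\<And>i j. (i, j) \<in> Y \<Longrightarrow> 1 < i \<Longrightarrow> (i - 1, j) \<in> Y"
    and left: "\<And>i j. (i, j) \<in> Y \<Longrightarrow> 1 < j \<Longrightarrow> (i, j - 1) \<in> Y"
  shows "young Y"
proof -
  have up_iterated: "(i - d, j) \<in> Y" if "(i, j) \<in> Y" "d < i" for i j d
    using that(2)
  proof (induction d)
    case (Suc d)
    thus ?case using up[of "i - d" j] by simp
  qed (simp add: that)
  have left_iterated: "(i, j - d) \<in> Y" if "(i, j) \<in> Y" "d < j" for i j d
    using that(2)
  proof (induction d)
    case (Suc d)
    thus ?case using left[of i "j - d"] by simp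
  qed (simp add: that)
  have "(i', j') \<in> Y" if "(i, j) \<in> Y" "i' \<in> {1..i}" "j' \<in> {1..j}" for i j i' j'
    using up_iterated[OF that(1), of "i - i'"] left_iterated[of i' j "j - j'"] that by auto
  thus ?thesis using assms(1,2) unfolding young_def by fast
qed

lemma young_Un: "young X \<Longrightarrow> young Y \<Longrightarrow> young (X \<union> Y)"
  unfolding young_def by fast

lemma young_Int: "young X \<Longrightarrow> young Y \<Longrightarrow> young (X \<inter> Y)"
  unfolding young_def by fast

lemma mem_swap_image: "b \<in> prod.swap ` Y \<longleftrightarrow> prod.swap b \<in> Y"
  by (metis image_eqI imageE swap_swap)

lemma swap_swap_image [simp]: "prod.swap ` prod.swap ` Y = Y"
  by (simp add: image_image)

lemma young_swap: "young Y \<Longrightarrow> young (prod.swap ` Y)"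
  by (rule youngI) (auto simp: mem_swap_image young_finite dest: young_pos intro: young_down)

lemma initial_segment:
  fixes S :: "nat set"
  assumes "finite S" "0 \<notin> S" and down: "\<And>x y. x \<in> S \<Longrightarrow> 1 \<le> y \<Longrightarrow> y \<le> x \<Longrightarrow> y \<in> S"
  shows "S = {1..card S}"
proof (cases "S = {}")
  case False
  have "S = {1..Max S}"
  proof
    show "S \<subseteq> {1..Max S}" using assms(1,2) by (auto simp: Suc_le_eq intro: Nat.gr0I)
    show "{1..Max S} \<subseteq> S" using down[OF Max_in[OF assms(1) False]] by auto
  qed
  thus ?thesis by (metis card_atLeastAtMost diff_Suc_1)
qed simp

definition row_length :: "(nat \<times> nat) set \<Rightarrow> nat \<Rightarrow> nat" where
  "row_length Y i = card {j. (i, j) \<in> Y}"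

lemma row_eq:
  assumes "young Y"
  shows "{j. (i, j) \<in> Y} = {1..row_length Y i}"
  unfolding row_length_def
proof (rule initial_segment)
  show "finite {j. (i, j) \<in> Y}"
    using young_finite[OF assms] by (rule finite_subset[rotated, OF finite_imageI[of Y snd]]) force
  show "0 \<notin> {j. (i, j) \<in> Y}" using young_pos[OF assms, of i 0] by auto
  show "y \<in> {j. (i, j) \<in> Y}" if "x \<in> {j. (i, j) \<in> Y}" "1 \<le> y" "y \<le> x" for x y
    using that young_down[OF assms, of i x i y] young_pos[OF assms, of i x] by simp
qed

lemma mem_young: "young Y \<Longrightarrow> (i, j) \<in> Y \<longleftrightarrow> 1 \<le> j \<and> j \<le> row_length Y i"
  using row_eq[of Y i] by auto

lemma row_length_antimono:
  assumes "young Y" "1 \<le> i" "i \<le> i'"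
  shows "row_length Y i' \<le> row_length Y i"
proof (cases "row_length Y i' = 0")
  case False
  hence "(i', row_length Y i') \<in> Y" using mem_young[OF assms(1)] by simp
  hence "(i, row_length Y i') \<in> Y" using young_down[OF assms(1)] assms(2,3) False by simp
  thus ?thesis using mem_young[OF assms(1)] by simp
qed simp

subsection \<open>Diagrams of partitions\<close>

lemma mem_diagram: "(i, j) \<in> diagram \<nu> \<longleftrightarrow> 1 \<le> i \<and> 1 \<le> j \<and> j \<le> part \<nu> i"
  by (simp add: diagram_def)

lemma part_antimono:
  assumes "is_partition n \<nu>" "1 \<le> i" "i \<le> i'"
  shows "part \<nu> i' \<le> part \<nu> i"
proof (cases "i' \<le> length \<nu> \<and> i < i'")
  case True
  have "\<nu> ! (i' - 1) \<le> \<nu> ! (i - 1)"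
    using assms True by (intro sorted_wrt_nth_less[of "(\<ge>)"]) (auto simp: is_partition_def)
  thus ?thesis using assms True by (simp add: part_def)
next
  case False
  thus ?thesis using assms by (cases "i = i'") (auto simp: part_def)
qed

lemma part_pos: "is_partition n \<nu> \<Longrightarrow> 1 \<le> i \<Longrightarrow> i \<le> length \<nu> \<Longrightarrow> 0 < part \<nu> i"
  by (auto simp: part_def is_partition_def)

lemma diagram_Sigma: "diagram \<nu> = Sigma {1..length \<nu>} (\<lambda>i. {1..part \<nu> i})"
  by (auto simp: diagram_def part_def split: if_splits)

lemma finite_diagram: "finite (diagram \<nu>)"
  unfolding diagram_Sigma by auto

lemma card_diagram: "card (diagram \<nu>) = sum_list \<nu>"
proof -
  have "card (diagram \<nu>) = (\<Sum>i\<in>{1..length \<nu>}. part \<nu> i)"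
    unfolding diagram_Sigma by (subst card_SigmaI) auto
  also have "\<dots> = (\<Sum>i\<in>{0..<length \<nu>}. \<nu> ! i)"
    by (rule sum.reindex_bij_witness[of _ Suc "\<lambda>i. i - 1"]) (auto simp: part_def)
  finally show ?thesis by (simp add: sum_list_sum_nth)
qed

lemma young_diagram:
  assumes "is_partition n \<nu>"
  shows "young (diagram \<nu>)"
  using part_antimono[OF assms]
  by (intro youngI) (auto simp: mem_diagram finite_diagram intro: le_trans)

lemma row_length_diagram: "1 \<le> i \<Longrightarrow> row_length (diagram \<nu>) i = part \<nu> i"
proof -
  assume "1 \<le> i"
  hence "{j. (i, j) \<in> diagram \<nu>} = {1..part \<nu> i}" by (auto simp: mem_diagram)
  thus ?thesis by (simp add: row_length_def)
qed

lemma diagram_inj: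
  assumes "is_partition n \<nu>" "is_partition m \<kappa>" and eq: "diagram \<nu> = diagram \<kappa>"
  shows "\<nu> = \<kappa>"
proof -
  have part_eq: "part \<nu> i = part \<kappa> i" if "1 \<le> i" for i
    using eq that row_length_diagram by metis
  have length_le: "length \<nu> \<le> length \<kappa>"
    if "is_partition k \<nu>" "\<And>i. 1 \<le> i \<Longrightarrow> part \<nu> i = part \<kappa> i" for k \<nu> \<kappa>
  proof (rule ccontr)
    assume "\<not> ?thesis"
    thus False using part_pos[OF that(1), of "Suc (length \<kappa>)"] that(2)[of "Suc (length \<kappa>)"]
      by (simp add: part_def)
  qed
  have "length \<nu> = length \<kappa>"
    using length_le[OF assms(1)] length_le[OF assms(2)] part_eq by (metis le_antisym)
  moreover have "\<nu> ! i = \<kappa> ! i" if "i < length \<nu>" "length \<nu> = length \<kappa>" for i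
    using part_eq[of "Suc i"] that by (simp add: part_def)
  ultimately show ?thesis by (intro nth_equalityI)
qed

lemma partition_of_young:
  assumes Y: "young Y"
  obtains \<nu> where "is_partition (card Y) \<nu>" "diagram \<nu> = Y"
proof -
  define height where "height = row_length (prod.swap ` Y) 1"
  have nonempty_row: "0 < row_length Y i \<longleftrightarrow> i \<in> {1..height}" for i
  proof -
    have "i \<in> {1..height} \<longleftrightarrow> (i, 1) \<in> Y"
      using mem_young[OF young_swap[OF Y], of 1 i] by (simp add: height_def mem_swap_image)
    thus ?thesis using mem_young[OF Y, of i 1] by auto
  qed
  define \<nu> where "\<nu> = map (row_length Y) [1..<Suc height]"
  have part: "part \<nu> i = (if 1 \<le> i then row_length Y i else 0)" for i
    using nonempty_row[of i] by (auto simp: part_def \<nu>_def simp del: upt_Suc)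
  have "(i, j) \<in> diagram \<nu> \<longleftrightarrow> (i, j) \<in> Y" for i j
    using mem_young[OF Y, of i j] young_pos[OF Y, of i j] by (auto simp: mem_diagram part)
  hence D: "diagram \<nu> = Y" by (intro Set.set_eqI) (simp only: split_paired_all)
  have "is_partition (card Y) \<nu>" unfolding is_partition_def
  proof (intro conjI)
    show "sorted_wrt (\<ge>) \<nu>"
      using row_length_antimono[OF Y] by (auto simp: \<nu>_def sorted_wrt_iff_nth_less simp del: upt_Suc)
    show "\<forall>r\<in>set \<nu>. 0 < r"
    proof
      fix r assume "r \<in> set \<nu>"
      then obtain i where "i \<in> {1..height}" "r = row_length Y i"
        by (auto simp: \<nu>_def less_Suc_eq_le simp del: upt_Suc)
      thus "0 < r" using nonempty_row[of i] by simp
    qed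
    show "sum_list \<nu> = card Y" using card_diagram[of \<nu>] D by simp
  qed
  thus ?thesis using D that by blast
qed

lemma diagram_transpose:
  assumes p: "is_partition n \<nu>"
  shows "diagram (transpose_partition \<nu>) = prod.swap ` diagram \<nu>"
proof -
  have column: "{i. 1 \<le> i \<and> j \<le> part \<nu> i} = {i. (j, i) \<in> prod.swap ` diagram \<nu>}" if "1 \<le> j" for j
    using that by (auto simp: mem_swap_image mem_diagram)
  have "part (transpose_partition \<nu>) j = row_length (prod.swap ` diagram \<nu>) j" if j: "1 \<le> j" for j
  proof (cases "j \<le> part \<nu> 1")
    case True
    hence "[1..<Suc (part \<nu> 1)] ! (j - 1) = j" using j by (subst nth_upt) auto
    thus ?thesis
      using j True column[OF j] unfolding part_def[of "transpose_partition \<nu>"]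
      by (simp add: transpose_partition_def row_length_def del: upt_Suc)
  next
    case False
    have "(j, i) \<notin> prod.swap ` diagram \<nu>" for i
      using False part_antimono[OF p, of 1 i] by (auto simp: mem_swap_image mem_diagram)
    thus ?thesis using False
      unfolding part_def[of "transpose_partition \<nu>"] by (simp add: transpose_partition_def row_length_def)
  qed
  moreover note Y = young_swap[OF young_diagram[OF p]]
  ultimately have "(j, i) \<in> diagram (transpose_partition \<nu>) \<longleftrightarrow> (j, i) \<in> prod.swap ` diagram \<nu>" for j i
    using mem_young[OF Y, of j i] young_pos[OF Y, of j i] by (cases "1 \<le> j") (simp_all add: mem_diagram)
  thus ?thesis by (intro Set.set_eqI) (simp only: split_paired_all)
qed

subsection \<open>Addable and removable boxes\<close>

definition addable :: "(nat \<times> nat) set \<Rightarrow> (nat \<times> nat) set" where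
  "addable Y = {b. b \<notin> Y \<and> young (insert b Y)}"

definition removable :: "(nat \<times> nat) set \<Rightarrow> (nat \<times> nat) set" where
  "removable Y = {b \<in> Y. young (Y - {b})}"

lemma addable_young: "b \<in> addable Y \<Longrightarrow> young (insert b Y)" "b \<in> addable Y \<Longrightarrow> b \<notin> Y"
  by (simp_all add: addable_def)

lemma removable_young: "b \<in> removable Y \<Longrightarrow> young (Y - {b})" "b \<in> removable Y \<Longrightarrow> b \<in> Y"
  by (simp_all add: removable_def)

lemma removable_subset: "removable Y \<subseteq> Y"
  by (auto simp: removable_def)

lemma removable_iff_maximal:
  assumes Y: "young Y"
  shows "b \<in> removable Y \<longleftrightarrow> b \<in> Y \<and> (\<forall>c\<in>Y. fst b \<le> fst c \<longrightarrow> snd b \<le> snd c \<longrightarrow> c = b)"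
proof
  assume b: "b \<in> removable Y"
  have "c = b" if "c \<in> Y" "fst b \<le> fst c" "snd b \<le> snd c" for c
  proof (rule ccontr)
    assume "c \<noteq> b"
    hence "b \<in> Y - {b}"
      using young_down[OF removable_young(1)[OF b], of "fst c" "snd c" "fst b" "snd b"]
        young_pos[OF Y, of "fst b" "snd b"] removable_young(2)[OF b] that by auto
    thus False by simp
  qed
  thus "b \<in> Y \<and> (\<forall>c\<in>Y. fst b \<le> fst c \<longrightarrow> snd b \<le> snd c \<longrightarrow> c = b)"
    using removable_young(2)[OF b] by blast
next
  assume b: "b \<in> Y \<and> (\<forall>c\<in>Y. fst b \<le> fst c \<longrightarrow> snd b \<le> snd c \<longrightarrow> c = b)"
  have "young (Y - {b})"
  proof (rule youngI)
    show "(i - 1, j) \<in> Y - {b}" if "(i, j) \<in> Y - {b}" "1 < i" for i j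
      using that b young_down[OF Y, of i j "i - 1" j] young_pos[OF Y, of i j] by fastforce
    show "(i, j - 1) \<in> Y - {b}" if "(i, j) \<in> Y - {b}" "1 < j" for i j
      using that b young_down[OF Y, of i j i "j - 1"] young_pos[OF Y, of i j] by fastforce
  qed (use young_finite[OF Y] young_pos[OF Y] in auto)
  thus "b \<in> removable Y" using b by (simp add: removable_def)
qed

lemma removable_nonempty:
  assumes "young Y" "Y \<noteq> {}"
  obtains b where "b \<in> removable Y"
proof -
  have "\<exists>b\<in>Y. \<forall>c\<in>Y. fst c + snd c \<le> fst b + snd b"
    using Max_in[of "(\<lambda>c. fst c + snd c) ` Y"] Max_ge[of "(\<lambda>c. fst c + snd c) ` Y"]
      assms(2) young_finite[OF assms(1)]
    by (metis (no_types, lifting) finite_imageI image_iff image_is_empty)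
  then obtain b where "b \<in> Y" "\<And>c. c \<in> Y \<Longrightarrow> fst c + snd c \<le> fst b + snd b" by blast
  hence "b \<in> removable Y" unfolding removable_iff_maximal[OF assms(1)] by (fastforce simp: prod_eq_iff)
  thus ?thesis by (rule that)
qed

lemma addable_superdiagonal_inj: "inj_on superdiagonal (addable Y)"
proof (rule inj_onI)
  have not_above: "\<not> fst b < fst c"
    if "b \<in> addable Y" "c \<in> addable Y" "superdiagonal b = superdiagonal c" for b c
  proof
    assume "fst b < fst c"
    moreover from this have "snd b < snd c" using that(3) by (simp add: superdiagonal_def)
    ultimately have "b \<in> insert c Y"
      using young_down[OF addable_young(1)[OF that(2)], of "fst c" "snd c" "fst b" "snd b"]
        young_pos[OF addable_young(1)[OF that(1)], of "fst b" "snd b"] by simp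
    thus False using addable_young(2)[OF that(1)] \<open>fst b < fst c\<close> by auto
  qed
  fix b c assume "b \<in> addable Y" "c \<in> addable Y" "superdiagonal b = superdiagonal c"
  moreover from this have "fst b = fst c" using not_above[of b c] not_above[of c b] by simp
  ultimately show "b = c" by (simp add: superdiagonal_def prod_eq_iff)
qed

definition descent_rows :: "nat list \<Rightarrow> nat set" where
  "descent_rows \<mu> = {i. 1 \<le> i \<and> part \<mu> (Suc i) < part \<mu> i}"

lemma finite_descent_rows: "finite (descent_rows \<mu>)"
  by (rule finite_subset[of _ "{1..length \<mu>}"]) (auto simp: descent_rows_def part_def split: if_splits)

lemma card_descent_rows:
  assumes p: "is_partition n \<mu>"
  shows "card (descent_rows \<mu>) = card (set \<mu>)"
proof (rule bij_betw_same_card[of "part \<mu>"], rule bij_betw_imageI)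
  show "inj_on (part \<mu>) (descent_rows \<mu>)"
  proof (rule linorder_inj_onI)
    fix i k assume "i < k" "i \<in> descent_rows \<mu>"
    hence "part \<mu> k < part \<mu> i"
      using part_antimono[OF p, of "Suc i" k] by (auto simp: descent_rows_def)
    thus "part \<mu> i \<noteq> part \<mu> k" by simp
  qed auto
  show "part \<mu> ` descent_rows \<mu> = set \<mu>"
  proof
    show "part \<mu> ` descent_rows \<mu> \<subseteq> set \<mu>" by (auto simp: descent_rows_def part_def)
    show "set \<mu> \<subseteq> part \<mu> ` descent_rows \<mu>"
    proof
      fix v assume v: "v \<in> set \<mu>"
      define rows where "rows = {i \<in> {1..length \<mu>}. part \<mu> i = v}"
      have "finite rows" by (simp add: rows_def)
      moreover obtain i where "i < length \<mu>" "\<mu> ! i = v" using v by (auto simp: in_set_conv_nth)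
      hence "Suc i \<in> rows" by (simp add: rows_def part_def)
      hence "rows \<noteq> {}" by blast
      ultimately have last: "Max rows \<in> rows" "Suc (Max rows) \<notin> rows"
        by (auto dest: Max_ge)
      have "0 < v" using v p by (simp add: is_partition_def)
      hence "part \<mu> (Suc (Max rows)) \<noteq> v" using last by (auto simp: rows_def part_def split: if_splits)
      moreover have Max_row: "1 \<le> Max rows" "part \<mu> (Max rows) = v"
        using last(1) by (simp_all only: rows_def mem_Collect_eq atLeastAtMost_iff)
      ultimately have "Max rows \<in> descent_rows \<mu>"
        using part_antimono[OF p, of "Max rows" "Suc (Max rows)"] by (simp add: descent_rows_def)
      thus "v \<in> part \<mu> ` descent_rows \<mu>" using Max_row(2) by blast
    qed
  qed
qed

lemma removable_diagram:
  assumes p: "is_partition n \<mu>"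
  shows "removable (diagram \<mu>) = (\<lambda>i. (i, part \<mu> i)) ` descent_rows \<mu>"
proof (intro Set.set_eqI iffI)
  note maximal = removable_iff_maximal[OF young_diagram[OF p]]
  fix b
  show "b \<in> (\<lambda>i. (i, part \<mu> i)) ` descent_rows \<mu>" if "b \<in> removable (diagram \<mu>)"
  proof -
    obtain i j where b: "b = (i, j)" by force
    have "(i, j) \<in> diagram \<mu>" using that unfolding b by (rule removable_young(2))
    hence ij: "1 \<le> i" "1 \<le> j" "j \<le> part \<mu> i" by (simp_all add: mem_diagram)
    have "c = (i, j)" if "c \<in> diagram \<mu>" "i \<le> fst c" "j \<le> snd c" for c
      using that \<open>b \<in> removable (diagram \<mu>)\<close> unfolding b maximal by simp
    from this[of "(i, Suc j)"] this[of "(Suc i, j)"]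
    have "\<not> Suc j \<le> part \<mu> i" "\<not> j \<le> part \<mu> (Suc i)" using ij by (auto simp: mem_diagram)
    thus ?thesis using ij by (auto simp: b descent_rows_def)
  qed
  show "b \<in> removable (diagram \<mu>)" if "b \<in> (\<lambda>i. (i, part \<mu> i)) ` descent_rows \<mu>"
  proof -
    from that obtain i where b: "b = (i, part \<mu> i)" and i: "1 \<le> i" "part \<mu> (Suc i) < part \<mu> i"
      by (auto simp: descent_rows_def)
    have "k = i \<and> l = part \<mu> i" if "(k, l) \<in> diagram \<mu>" "i \<le> k" "part \<mu> i \<le> l" for k l
      using that i part_antimono[OF p, of "Suc i" k] by (cases "k = i") (auto simp: mem_diagram)
    thus ?thesis using i unfolding b maximal by (auto simp: mem_diagram)
  qed
qed

lemma addable_diagram: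
  assumes p: "is_partition n \<mu>"
  shows "addable (diagram \<mu>) = (\<lambda>i. (i, Suc (part \<mu> i))) ` insert 1 (Suc ` descent_rows \<mu>)"
proof (intro Set.set_eqI iffI)
  fix b
  show "b \<in> (\<lambda>i. (i, Suc (part \<mu> i))) ` insert 1 (Suc ` descent_rows \<mu>)" if "b \<in> addable (diagram \<mu>)"
  proof -
    obtain i j where b: "b = (i, j)" by force
    note Y = addable_young[OF that, unfolded b]
    have ij: "1 \<le> i" "1 \<le> j" using young_pos[OF Y(1), of i j] by auto
    have "part \<mu> i < j" using Y(2) ij by (simp add: mem_diagram)
    moreover have "j \<le> Suc (part \<mu> i)"
    proof (cases "j = 1")
      case False
      hence "1 \<le> j - 1" "j - 1 < j" using ij(2) by auto
      thus ?thesis using young_down[OF Y(1), of i j i "j - 1"] ij(1) by (auto simp: mem_diagram)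
    qed simp
    ultimately have j: "j = Suc (part \<mu> i)" by simp
    have "i - 1 \<in> descent_rows \<mu>" if "i \<noteq> 1"
    proof -
      have "1 \<le> i - 1" "i - 1 < i" using ij(1) that by auto
      thus ?thesis
        using young_down[OF Y(1), of i j "i - 1" j] ij j by (auto simp: mem_diagram descent_rows_def)
    qed
    hence "i \<in> insert 1 (Suc ` descent_rows \<mu>)"
      using ij(1) by (cases "i = 1") (auto intro: image_eqI[of _ _ "i - 1"])
    thus ?thesis unfolding b j by (rule imageI)
  qed
  show "b \<in> addable (diagram \<mu>)" if "b \<in> (\<lambda>i. (i, Suc (part \<mu> i))) ` insert 1 (Suc ` descent_rows \<mu>)"
  proof -
    from that obtain i where b: "b = (i, Suc (part \<mu> i))"
      and i: "i = 1 \<or> 1 \<le> i - 1 \<and> part \<mu> i < part \<mu> (i - 1)" "1 \<le> i"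
      by (auto simp: descent_rows_def)
    note Y = young_diagram[OF p]
    have "young (insert b (diagram \<mu>))"
    proof (rule youngI)
      show "(k - 1, l) \<in> insert b (diagram \<mu>)" if "(k, l) \<in> insert b (diagram \<mu>)" "1 < k" for k l
        using that i young_down[OF Y, of k l "k - 1" l] young_pos[OF Y, of k l]
        by (auto simp: b mem_diagram)
      show "(k, l - 1) \<in> insert b (diagram \<mu>)" if "(k, l) \<in> insert b (diagram \<mu>)" "1 < l" for k l
        using that i young_down[OF Y, of k l k "l - 1"] young_pos[OF Y, of k l]
        by (auto simp: b mem_diagram)
    qed (use i young_pos[OF Y] young_finite[OF Y] in \<open>auto simp: b\<close>)
    thus ?thesis by (auto simp: addable_def b mem_diagram)
  qed
qed

lemma card_removable:
  assumes "is_partition n \<mu>"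
  shows "card (removable (diagram \<mu>)) = card (set \<mu>)"
  unfolding removable_diagram[OF assms] card_descent_rows[OF assms, symmetric]
  by (rule card_image) (simp add: inj_on_def)

lemma finite_addable:
  assumes "young Y"
  shows "finite (addable Y)"
proof -
  obtain \<mu> where "is_partition (card Y) \<mu>" "diagram \<mu> = Y" by (rule partition_of_young[OF assms])
  thus ?thesis using addable_diagram finite_descent_rows by auto
qed

lemma card_addable:
  assumes "young Y"
  shows "card (addable Y) = Suc (card (removable Y))"
proof -
  obtain \<mu> where \<mu>: "is_partition (card Y) \<mu>" "diagram \<mu> = Y" by (rule partition_of_young[OF assms])
  have "card (addable Y) = card (insert 1 (Suc ` descent_rows \<mu>))"
    unfolding \<mu>(2)[symmetric] addable_diagram[OF \<mu>(1)] by (rule card_image) (simp add: inj_on_def)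
  also have "\<dots> = Suc (card (descent_rows \<mu>))"
    using finite_descent_rows by (subst card_insert_disjoint) (auto simp: card_image descent_rows_def)
  also have "card (descent_rows \<mu>) = card (removable Y)"
    using card_removable[OF \<mu>(1)] card_descent_rows[OF \<mu>(1)] \<mu>(2) by simp
  finally show ?thesis .
qed

lemma removable_between_addable:
  assumes p: "is_partition n \<mu>" and b_addable: "b \<in> addable (diagram \<mu>)" and c_addable: "c \<in> addable (diagram \<mu>)"
    and below: "superdiagonal c < superdiagonal b"
  obtains x where "x \<in> removable (diagram \<mu>)"
    "superdiagonal c < superdiagonal x" "superdiagonal x < superdiagonal b"
proof -
  obtain i where i: "b = (i, Suc (part \<mu> i))" "1 \<le> i"
    using b_addable unfolding addable_diagram[OF p] by auto
  obtain k where k: "c = (k, Suc (part \<mu> k))" "k = 1 \<or> k - 1 \<in> descent_rows \<mu>" "1 \<le> k"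
    using c_addable unfolding addable_diagram[OF p] by auto
  have "i < k"
  proof (rule ccontr)
    assume "\<not> i < k"
    hence "part \<mu> i \<le> part \<mu> k" using part_antimono[OF p, of k i] k(3) by simp
    thus False using below \<open>\<not> i < k\<close> by (simp add: i k superdiagonal_def)
  qed
  hence descent: "k - 1 \<in> descent_rows \<mu>" using k(2) i(2) by auto
  let ?x = "(k - 1, part \<mu> (k - 1))"
  have "?x \<in> removable (diagram \<mu>)" unfolding removable_diagram[OF p] using descent by blast
  moreover have "superdiagonal c < superdiagonal ?x"
    using descent by (auto simp: k superdiagonal_def descent_rows_def)
  moreover have "part \<mu> (k - 1) \<le> part \<mu> i"
    using \<open>i < k\<close> by (intro part_antimono[OF p i(2)]) simp
  hence "superdiagonal ?x < superdiagonal b"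
    using \<open>i < k\<close> i by (simp add: superdiagonal_def of_nat_diff)
  ultimately show ?thesis by (rule that)
qed

subsection \<open>Partitions obtained by adding a box\<close>

lemma up_setD:
  assumes "is_partition m \<mu>" "\<nu> \<in> up_set \<mu>"
  shows "is_partition (Suc m) \<nu>" "added_box \<nu> \<mu> \<notin> diagram \<mu>"
    "diagram \<nu> = insert (added_box \<nu> \<mu>) (diagram \<mu>)"
proof -
  show "is_partition (Suc m) \<nu>" using assms by (simp add: up_set_def is_partition_def)
  obtain b where b: "b \<notin> diagram \<mu>" "diagram \<nu> = insert b (diagram \<mu>)"
    using assms(2) by (auto simp: up_set_def)
  hence "diagram \<nu> - diagram \<mu> = {b}" by auto
  hence "added_box \<nu> \<mu> = b" by (simp add: added_box_def)
  thus "added_box \<nu> \<mu> \<notin> diagram \<mu>" "diagram \<nu> = insert (added_box \<nu> \<mu>) (diagram \<mu>)" using b by auto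
qed

lemma added_box_bij:
  assumes p: "is_partition m \<mu>"
  shows "bij_betw (\<lambda>\<nu>. added_box \<nu> \<mu>) (up_set \<mu>) (addable (diagram \<mu>))"
proof (rule bij_betwI')
  show "added_box \<nu> \<mu> = added_box \<kappa> \<mu> \<longleftrightarrow> \<nu> = \<kappa>" if "\<nu> \<in> up_set \<mu>" "\<kappa> \<in> up_set \<mu>" for \<nu> \<kappa>
    using diagram_inj up_setD[OF p that(1)] up_setD[OF p that(2)] by metis
  show "added_box \<nu> \<mu> \<in> addable (diagram \<mu>)" if "\<nu> \<in> up_set \<mu>" for \<nu>
    using up_setD[OF p that] young_diagram by (metis (mono_tags) addable_def mem_Collect_eq)
  fix b assume "b \<in> addable (diagram \<mu>)"
  note b = addable_young[OF this]
  have size: "card (insert b (diagram \<mu>)) = Suc (sum_list \<mu>)"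
    using b(2) by (simp add: finite_diagram card_diagram)
  obtain \<nu> where \<nu>: "is_partition (Suc (sum_list \<mu>)) \<nu>" "diagram \<nu> = insert b (diagram \<mu>)"
    using partition_of_young[OF b(1)] unfolding size by blast
  have "\<nu> \<in> up_set \<mu>" unfolding up_set_def using \<nu> b(2) by blast
  moreover from up_setD(2,3)[OF p this] have "b = added_box \<nu> \<mu>" using \<nu>(2) b(2) by auto
  ultimately show "\<exists>\<nu>\<in>up_set \<mu>. b = added_box \<nu> \<mu>" by blast
qed

lemma added_box_addable: "is_partition m \<mu> \<Longrightarrow> \<nu> \<in> up_set \<mu> \<Longrightarrow> added_box \<nu> \<mu> \<in> addable (diagram \<mu>)"
  using added_box_bij bij_betwE by fast

lemma finite_up_set: "is_partition m \<mu> \<Longrightarrow> finite (up_set \<mu>)"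
  using bij_betw_finite[OF added_box_bij] finite_addable[OF young_diagram] by blast

lemma card_up_set: "is_partition m \<mu> \<Longrightarrow> card (up_set \<mu>) = Suc (card (set \<mu>))"
  using bij_betw_same_card[OF added_box_bij] card_addable[OF young_diagram] card_removable by metis

section \<open>Standard tableaux\<close>

definition shape :: "tableau \<Rightarrow> (nat \<times> nat) set" where
  "shape T = {b. T b \<noteq> 0}"

definition SYT :: "nat \<Rightarrow> tableau set" where
  "SYT n = {T. young (shape T) \<and> bij_betw T (shape T) {1..n} \<and>
     (\<forall>b\<in>shape T. \<forall>c\<in>shape T. fst b \<le> fst c \<longrightarrow> snd b \<le> snd c \<longrightarrow> b \<noteq> c \<longrightarrow> T b < T c)}"

definition SYT_shape :: "nat \<Rightarrow> (nat \<times> nat) set \<Rightarrow> tableau set" where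
  "SYT_shape n Y = {T \<in> SYT n. shape T = Y}"

definition content :: "tableau \<Rightarrow> nat \<Rightarrow> int" where
  "content T a = superdiagonal (box_of T a)"

definition axial_step :: "tableau \<Rightarrow> nat \<Rightarrow> int" where
  "axial_step T k = content T (Suc k) - content T k"

lemma D_tab_Suc: "D_tab T (Suc k) k = axial_step T k"
  by (simp add: D_tab_def axial_dist_def content_def axial_step_def)

lemma not_in_shape: "b \<notin> shape T \<longleftrightarrow> T b = 0"
  by (simp add: shape_def)

lemma SYT_young: "T \<in> SYT n \<Longrightarrow> young (shape T)"
  by (simp add: SYT_def)

lemma SYT_bij: "T \<in> SYT n \<Longrightarrow> bij_betw T (shape T) {1..n}"
  by (simp add: SYT_def)

lemma SYT_strict_mono:
  "T \<in> SYT n \<Longrightarrow> b \<in> shape T \<Longrightarrow> c \<in> shape T \<Longrightarrow> fst b \<le> fst c \<Longrightarrow> snd b \<le> snd c \<Longrightarrow>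
     b \<noteq> c \<Longrightarrow> T b < T c"
  by (simp add: SYT_def)

lemma SYT_inj: "T \<in> SYT n \<Longrightarrow> b \<in> shape T \<Longrightarrow> T b = T c \<Longrightarrow> b = c"
  using SYT_bij[of T n] unfolding bij_betw_def inj_on_def by (metis (mono_tags) not_in_shape)

lemma SYT_range: "T \<in> SYT n \<Longrightarrow> b \<in> shape T \<Longrightarrow> 1 \<le> T b \<and> T b \<le> n"
  using SYT_bij[of T n] by (force simp: bij_betw_def)

lemma SYT_le: "T \<in> SYT n \<Longrightarrow> T b \<le> n"
  using SYT_range[of T n b] not_in_shape[of b T] by fastforce

lemma SYT_0: "T \<in> SYT 0 \<Longrightarrow> T = (\<lambda>_. 0)"
  using SYT_le by (intro ext) fastforce

lemma SYT_shapeD: "T \<in> SYT_shape n Y \<Longrightarrow> T \<in> SYT n" "T \<in> SYT_shape n Y \<Longrightarrow> shape T = Y"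
  by (simp_all add: SYT_shape_def)

lemma SYT_shapeI: "T \<in> SYT n \<Longrightarrow> T \<in> SYT_shape n (shape T)"
  by (simp add: SYT_shape_def)

lemma SYT_shape_card: "T \<in> SYT_shape n Y \<Longrightarrow> card Y = n"
  using bij_betw_same_card[OF SYT_bij, of T n] by (simp add: SYT_shape_def)

lemma finite_SYT_shape: "finite (SYT_shape n Y)"
proof (cases "finite Y")
  case True
  have "T b \<in> {..n} \<and> (b \<notin> Y \<longrightarrow> T b = 0)" if "T \<in> SYT_shape n Y" for T b
    using SYT_le[of T n b] not_in_shape[of b T] that by (simp add: SYT_shape_def)
  hence "SYT_shape n Y \<subseteq> {T. \<forall>b. (b \<in> Y \<longrightarrow> T b \<in> {..n}) \<and> (b \<notin> Y \<longrightarrow> T b = 0)}" by blast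
  thus ?thesis by (rule finite_subset[OF _ finite_set_of_finite_funs[OF True]]) simp
next
  case False
  hence "SYT_shape n Y = {}" using young_finite[OF SYT_young] by (auto simp: SYT_shape_def)
  thus ?thesis by simp
qed

lemma young_strict_mono:
  fixes f :: "nat \<times> nat \<Rightarrow> nat"
  assumes Y: "young Y"
    and row: "\<And>i j. (i, j) \<in> Y \<Longrightarrow> (i, Suc j) \<in> Y \<Longrightarrow> f (i, j) < f (i, Suc j)"
    and column: "\<And>i j. (i, j) \<in> Y \<Longrightarrow> (Suc i, j) \<in> Y \<Longrightarrow> f (i, j) < f (Suc i, j)"
    and start: "1 \<le> i" "1 \<le> j"
  shows "(i', j') \<in> Y \<Longrightarrow> i \<le> i' \<Longrightarrow> j \<le> j' \<Longrightarrow> (i, j) \<noteq> (i', j') \<Longrightarrow> f (i, j) < f (i', j')"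
proof (induction "i' + j'" arbitrary: i' j' rule: less_induct)
  case less
  have step: "f (i, j) < f (i', j')"
    if "(k, l) \<in> Y" "k + l < i' + j'" "i \<le> k" "j \<le> l" "f (k, l) < f (i', j')" for k l
    using less.hyps[OF that(2,1,3,4)] that(5) by (cases "(i, j) = (k, l)") auto
  show ?case
  proof (cases "i < i'")
    case True
    then obtain k where k: "i' = Suc k" "i \<le> k" by (cases i') auto
    hence "(k, j') \<in> Y" using young_down[OF Y less.prems(1)] start less.prems by simp
    thus ?thesis using step[of k j'] column[of k j'] k less.prems by simp
  next
    case False
    then obtain l where l: "i' = i" "j' = Suc l" "j \<le> l" using less.prems by (cases j') auto
    hence "(i, l) \<in> Y" using young_down[OF Y less.prems(1)] start less.prems by simp
    thus ?thesis using step[of i l] row[of i l] l less.prems by simp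
  qed
qed

lemma Tab_eq_SYT_shape:
  assumes p: "is_partition n \<nu>"
  shows "Tab \<nu> = SYT_shape n (diagram \<nu>)"
proof (intro Set.set_eqI iffI)
  have n: "sum_list \<nu> = n" using p by (simp add: is_partition_def)
  have Y: "young (diagram \<nu>)" by (rule young_diagram[OF p])
  fix T
  show "T \<in> SYT_shape n (diagram \<nu>)" if T: "T \<in> Tab \<nu>"
  proof -
    have bij: "bij_betw T (diagram \<nu>) {1..n}" using T by (simp add: Tab_def n)
    have "T b \<noteq> 0 \<longleftrightarrow> b \<in> diagram \<nu>" for b
      using bij_betwE[OF bij] T by (cases "b \<in> diagram \<nu>") (auto simp: Tab_def simp del: split_paired_All)
    hence "shape T = diagram \<nu>" by (simp add: shape_def)
    moreover have "T b < T c"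
      if "b \<in> diagram \<nu>" "c \<in> diagram \<nu>" "fst b \<le> fst c" "snd b \<le> snd c" "b \<noteq> c" for b c
    proof -
      have "T (fst b, snd b) < T (fst c, snd c)"
      proof (rule young_strict_mono[OF Y])
        show "1 \<le> fst b" "1 \<le> snd b" using young_pos[OF Y, of "fst b" "snd b"] that(1) by simp_all
      qed (use T that(2-5) in \<open>simp_all add: Tab_def prod_eq_iff\<close>)
      thus ?thesis by simp
    qed
    ultimately show ?thesis using bij Y by (simp add: SYT_shape_def SYT_def)
  qed
  show "T \<in> Tab \<nu>" if "T \<in> SYT_shape n (diagram \<nu>)"
  proof -
    have T: "T \<in> SYT n" and sh: "shape T = diagram \<nu>" using that by (simp_all add: SYT_shape_def)
    have "T b = 0" if "b \<notin> diagram \<nu>" for b using that unfolding sh[symmetric] not_in_shape .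
    thus ?thesis using SYT_bij[OF T] SYT_strict_mono[OF T] by (simp add: Tab_def n sh)
  qed
qed

lemma box_of_SYT:
  assumes T: "T \<in> SYT n" and a: "1 \<le> a" "a \<le> n"
  shows "T (box_of T a) = a" "box_of T a \<in> shape T"
proof -
  have "a \<in> T ` shape T" using SYT_bij[OF T] a by (simp add: bij_betw_def)
  then obtain b where b: "b \<in> shape T" "T b = a" by auto
  have "box_of T a = b" unfolding box_of_def
    by (rule the_equality) (use b SYT_inj[OF T] in metis)+
  thus "T (box_of T a) = a" "box_of T a \<in> shape T" using b by auto
qed

lemma box_of_entry: "T \<in> SYT n \<Longrightarrow> b \<in> shape T \<Longrightarrow> box_of T (T b) = b"
  unfolding box_of_def by (rule the_equality) (metis SYT_inj)+

lemma box_of_one: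
  assumes T: "T \<in> SYT n" and n: "1 \<le> n"
  shows "box_of T 1 = (1, 1)"
proof (rule ccontr)
  obtain i j where ij: "box_of T 1 = (i, j)" by force
  assume "box_of T 1 \<noteq> (1, 1)"
  hence not_corner: "(1, 1) \<noteq> (i, j)" using ij by metis
  have in_shape: "(i, j) \<in> shape T" "T (i, j) = 1" using box_of_SYT[OF T, of 1] n ij by auto
  hence "1 \<le> i" "1 \<le> j" using young_pos[OF SYT_young[OF T]] by auto
  moreover from this have corner: "(1, 1) \<in> shape T"
    using young_down[OF SYT_young[OF T] in_shape(1), of 1 1] by simp
  ultimately have "T (1, 1) < 1" using SYT_strict_mono[OF T corner in_shape(1)] in_shape(2) not_corner by simp
  thus False using SYT_range[OF T corner] by simp
qed

lemma content_one: "T \<in> SYT n \<Longrightarrow> 1 \<le> n \<Longrightarrow> content T 1 = 0"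
  by (simp add: content_def box_of_one[unfolded One_nat_def] superdiagonal_def)

subsection \<open>Swapping consecutive entries\<close>

lemma box_of_adj_transp: "box_of (adj_transp k \<circ> T) a = box_of T (adj_transp k a)"
proof -
  have "(adj_transp k \<circ> T) b = a \<longleftrightarrow> T b = adj_transp k a" for b
    by (metis adj_transp_involutive comp_apply)
  thus ?thesis by (simp add: box_of_def)
qed

lemma content_adj_transp [simp]: "content (adj_transp k \<circ> T) a = content T (adj_transp k a)"
  by (simp add: content_def box_of_adj_transp)

lemma axial_step_adj_transp [simp]: "axial_step (adj_transp k \<circ> T) k = - axial_step T k"
  by (simp add: axial_step_def)

lemma shape_adj_transp: "1 \<le> k \<Longrightarrow> shape (adj_transp k \<circ> T) = shape T"
  by (auto simp: shape_def adj_transp_eq_if split: if_splits)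

lemma SYT_shape_adj_transp:
  "S \<in> SYT_shape n Y \<Longrightarrow> 1 \<le> k \<Longrightarrow> adj_transp k \<circ> S \<in> SYT n \<Longrightarrow> adj_transp k \<circ> S \<in> SYT_shape n Y"
  by (simp add: SYT_shape_def shape_adj_transp)

lemma adj_transp_comp_neq: "T \<in> SYT n \<Longrightarrow> 1 \<le> k \<Longrightarrow> k < n \<Longrightarrow> adj_transp k \<circ> T \<noteq> T"
  using box_of_SYT(1)[of T n k] by (auto dest: fun_cong[of _ _ "box_of T k"])

lemma superdiagonal_incomparable:
  assumes "\<not> (fst b \<le> fst c \<and> snd b \<le> snd c)" "\<not> (fst c \<le> fst b \<and> snd c \<le> snd b)"
  shows "2 \<le> \<bar>superdiagonal b - superdiagonal c\<bar>"
  using assms by (auto simp: superdiagonal_def)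

lemma SYT_consecutive_comparable:
  assumes T: "T \<in> SYT n" and k: "1 \<le> k" "k < n"
    and weakly_before: "fst (box_of T k) \<le> fst (box_of T (Suc k))" "snd (box_of T k) \<le> snd (box_of T (Suc k))"
  shows "\<bar>axial_step T k\<bar> = 1"
proof -
  obtain i j where b: "box_of T k = (i, j)" by force
  obtain i' j' where c: "box_of T (Suc k) = (i', j')" by force
  have bT: "(i, j) \<in> shape T" "T (i, j) = k" using box_of_SYT[OF T, of k] k b by auto
  have cT: "(i', j') \<in> shape T" "T (i', j') = Suc k" using box_of_SYT[OF T, of "Suc k"] k c by auto
  have between: "x = (i, j) \<or> x = (i', j')"
    if x: "i \<le> fst x" "fst x \<le> i'" "j \<le> snd x" "snd x \<le> j'" for x
  proof (rule ccontr)
    assume other_box: "\<not> ?thesis"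
    have xT: "x \<in> shape T"
      using young_down[OF SYT_young[OF T] cT(1), of "fst x" "snd x"]
        young_pos[OF SYT_young[OF T] bT(1)] x by simp
    have "T (i, j) < T x" "T x < T (i', j')"
      using SYT_strict_mono[OF T bT(1) xT] SYT_strict_mono[OF T xT cT(1)] x other_box by auto
    thus False using bT(2) cT(2) by simp
  qed
  have "(i, j) \<noteq> (i', j')" using bT(2) cT(2) by auto
  hence "i = i' \<and> j' = Suc j \<or> i' = Suc i \<and> j = j'"
    using between[of "(i, Suc j)"] between[of "(Suc i, j)"] weakly_before b c by auto
  thus ?thesis by (auto simp: axial_step_def content_def b c superdiagonal_def)
qed

lemma adj_transp_SYT:
  assumes T: "T \<in> SYT n" and k: "1 \<le> k" "k < n"
    and incomparable: "\<not> (fst (box_of T k) \<le> fst (box_of T (Suc k)) \<and> snd (box_of T k) \<le> snd (box_of T (Suc k)))"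
  shows "adj_transp k \<circ> T \<in> SYT n"
proof -
  have sh: "shape (adj_transp k \<circ> T) = shape T" by (rule shape_adj_transp[OF k(1)])
  have "bij_betw (adj_transp k \<circ> T) (shape T) {1..n}"
    using SYT_bij[OF T] permutes_imp_bij[OF adj_transp_permutes[OF k]] by (rule bij_betw_trans)
  moreover have "(adj_transp k \<circ> T) b < (adj_transp k \<circ> T) c"
    if bc: "b \<in> shape T" "c \<in> shape T" "fst b \<le> fst c" "snd b \<le> snd c" "b \<noteq> c" for b c
  proof -
    have "T b < T c" by (rule SYT_strict_mono[OF T bc])
    moreover have "\<not> (T b = k \<and> T c = Suc k)"
      using box_of_entry[OF T bc(1)] box_of_entry[OF T bc(2)] incomparable bc(3,4) by auto
    ultimately show ?thesis by (auto simp: adj_transp_eq_if)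
  qed
  ultimately show ?thesis using SYT_young[OF T] by (simp add: SYT_def sh)
qed

lemma SYT_swap_cases:
  assumes T: "T \<in> SYT n" and k: "1 \<le> k" "k < n"
  obtains (adjacent) "\<bar>axial_step T k\<bar> = 1"
  | (swappable) "2 \<le> \<bar>axial_step T k\<bar>" "adj_transp k \<circ> T \<in> SYT n"
proof (cases "fst (box_of T k) \<le> fst (box_of T (Suc k)) \<and> snd (box_of T k) \<le> snd (box_of T (Suc k))")
  case True
  thus ?thesis using adjacent SYT_consecutive_comparable[OF T k] by blast
next
  case False
  note b = box_of_SYT[OF T k(1) less_imp_le[OF k(2)]] and c = box_of_SYT[OF T, of "Suc k"]
  have "\<not> (fst (box_of T (Suc k)) \<le> fst (box_of T k) \<and> snd (box_of T (Suc k)) \<le> snd (box_of T k))"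
    using SYT_strict_mono[OF T c(2) b(2)] b(1) c(1) k by fastforce
  thus ?thesis
    using swappable adj_transp_SYT[OF T k False] superdiagonal_incomparable False
    by (metis axial_step_def content_def)
qed

lemma axial_step_nonzero: "T \<in> SYT n \<Longrightarrow> 1 \<le> k \<Longrightarrow> k < n \<Longrightarrow> axial_step T k \<noteq> 0"
  by (rule SYT_swap_cases[of T n k]) auto

lemma content_Suc_Suc_neq:
  assumes T: "T \<in> SYT n" and k: "1 \<le> k" "Suc k < n"
  shows "content T (Suc (Suc k)) \<noteq> content T k"
proof
  assume eq: "content T (Suc (Suc k)) = content T k"
  obtain i j where b: "box_of T k = (i, j)" by force
  obtain i' j' where c: "box_of T (Suc (Suc k)) = (i', j')" by force
  have bT: "(i, j) \<in> shape T" "T (i, j) = k" using box_of_SYT[OF T, of k] k b by auto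
  have cT: "(i', j') \<in> shape T" "T (i', j') = Suc (Suc k)"
    using box_of_SYT[OF T, of "Suc (Suc k)"] k c by auto
  have "\<not> (i' \<le> i \<and> j' \<le> j)"
    using SYT_strict_mono[OF T cT(1) bT(1)] bT(2) cT(2) by fastforce
  moreover have "int j' - int i' = int j - int i"
    using eq by (simp add: content_def b c superdiagonal_def)
  ultimately have south_east: "i < i'" "j < j'" by auto
  have squeezed: "x = (i, j) \<or> x = (i', j') \<or> T x = Suc k"
    if x: "i \<le> fst x" "fst x \<le> i'" "j \<le> snd x" "snd x \<le> j'" "x \<in> shape T" for x
    using SYT_strict_mono[OF T bT(1) x(5)] SYT_strict_mono[OF T x(5) cT(1)] x bT(2) cT(2) by fastforce
  have in_shape: "(i, Suc j) \<in> shape T" "(Suc i, j) \<in> shape T"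
    using young_down[OF SYT_young[OF T] cT(1)] young_pos[OF SYT_young[OF T] bT(1)] south_east by auto
  have "T (i, Suc j) = Suc k" "T (Suc i, j) = Suc k"
    using squeezed[of "(i, Suc j)"] squeezed[of "(Suc i, j)"] in_shape south_east by auto
  thus False using SYT_inj[OF T in_shape(1), of "(Suc i, j)"] by simp
qed

subsection \<open>Adding and removing the largest entry\<close>

lemma removable_addable: "young Y \<Longrightarrow> b \<in> removable Y \<Longrightarrow> b \<in> addable (Y - {b})"
  by (simp add: removable_def addable_def insert_absorb)

lemma SYT_shape_extend:
  assumes R: "R \<in> SYT_shape m Y" and b: "b \<in> addable Y"
  shows "R(b := Suc m) \<in> SYT_shape (Suc m) (insert b Y)"
proof -
  let ?T = "R(b := Suc m)"
  have RS: "R \<in> SYT m" and sh: "shape R = Y" by (rule SYT_shapeD[OF R])+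
  note b_young = addable_young(1)[OF b] and b_new = addable_young(2)[OF b]
  have "bij_betw ?T Y {1..m}"
    using SYT_bij[OF RS] b_new sh by (subst bij_betw_cong[of _ _ R]) auto
  hence "bij_betw ?T (Y \<union> {b}) ({1..m} \<union> {?T b})"
    using b_new by (intro notIn_Un_bij_betw) auto
  moreover have "{1..m} \<union> {?T b} = {1..Suc m}" by auto
  ultimately have bij: "bij_betw ?T (insert b Y) {1..Suc m}" by simp
  have "?T c < ?T d"
    if cd: "c \<in> insert b Y" "d \<in> insert b Y" "fst c \<le> fst d" "snd c \<le> snd d" "c \<noteq> d" for c d
  proof (cases "c = b")
    case True
    hence "d \<in> Y" using cd by auto
    hence "b \<in> Y"
      using young_down[OF SYT_young[OF RS], of "fst d" "snd d" "fst b" "snd b"]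
        young_pos[OF b_young, of "fst b" "snd b"] cd True sh by simp
    thus ?thesis using b_new by simp
  next
    case False
    thus ?thesis
      using SYT_strict_mono[OF RS, of c d] SYT_le[OF RS, of c] cd sh by (auto simp: less_Suc_eq_le)
  qed
  moreover have "shape ?T = insert b Y" using sh by (auto simp: shape_def)
  ultimately show ?thesis using bij b_young by (simp add: SYT_shape_def SYT_def)
qed

lemma SYT_shape_restrict:
  assumes T: "T \<in> SYT_shape (Suc m) Y"
  defines "b \<equiv> box_of T (Suc m)"
  shows "T(b := 0) \<in> SYT_shape m (Y - {b})" "b \<in> removable Y" "T b = Suc m"
proof -
  have TS: "T \<in> SYT (Suc m)" and sh: "shape T = Y" by (rule SYT_shapeD[OF T])+
  show top: "T b = Suc m" using box_of_SYT[OF TS, of "Suc m"] by (simp add: b_def)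
  have bY: "b \<in> Y" using box_of_SYT[OF TS, of "Suc m"] sh by (simp add: b_def)
  have "c = b" if "c \<in> Y" "fst b \<le> fst c" "snd b \<le> snd c" for c
    using SYT_strict_mono[OF TS, of b c] SYT_le[OF TS, of c] that bY sh top by fastforce
  thus b: "b \<in> removable Y"
    using bY removable_iff_maximal[OF SYT_young[OF TS]] sh by simp
  have "bij_betw T (Y - {b}) ({1..Suc m} - {Suc m})"
    using SYT_bij[OF TS] bY top sh by (intro bij_betw_DiffI) auto
  moreover have "{1..Suc m} - {Suc m} = {1..m}" by auto
  ultimately have "bij_betw (T(b := 0)) (Y - {b}) {1..m}"
    by (subst bij_betw_cong[of _ _ T]) auto
  moreover have "shape (T(b := 0)) = Y - {b}" using sh by (auto simp: shape_def)
  ultimately show "T(b := 0) \<in> SYT_shape m (Y - {b})"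
    using SYT_strict_mono[OF TS] sh removable_young(1)[OF b] by (simp add: SYT_shape_def SYT_def)
qed

lemma box_of_extend:
  assumes R: "R \<in> SYT_shape m Y" and b: "b \<in> addable Y"
  shows "box_of (R(b := Suc m)) (Suc m) = b"
    and "1 \<le> a \<Longrightarrow> a \<le> m \<Longrightarrow> box_of (R(b := Suc m)) a = box_of R a"
proof -
  note T = SYT_shape_extend[OF R b]
  show "box_of (R(b := Suc m)) (Suc m) = b"
    using box_of_entry[OF SYT_shapeD(1)[OF T], of b] SYT_shapeD(2)[OF T] by simp
  assume a: "1 \<le> a" "a \<le> m"
  have entry: "R (box_of R a) = a" "box_of R a \<in> Y"
    using box_of_SYT[OF SYT_shapeD(1)[OF R] a] SYT_shapeD(2)[OF R] by auto
  hence "(R(b := Suc m)) (box_of R a) = a" using addable_young(2)[OF b] by auto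
  thus "box_of (R(b := Suc m)) a = box_of R a"
    using box_of_entry[OF SYT_shapeD(1)[OF T], of "box_of R a"] SYT_shapeD(2)[OF T] entry(2) by simp
qed

lemma content_extend:
  assumes "R \<in> SYT_shape m Y" "b \<in> addable Y"
  shows "content (R(b := Suc m)) (Suc m) = superdiagonal b"
    and "1 \<le> a \<Longrightarrow> a \<le> m \<Longrightarrow> content (R(b := Suc m)) a = content R a"
  using box_of_extend[OF assms] by (simp_all add: content_def)

lemma axial_step_extend:
  "R \<in> SYT_shape m Y \<Longrightarrow> b \<in> addable Y \<Longrightarrow> 1 \<le> k \<Longrightarrow> k < m \<Longrightarrow>
    axial_step (R(b := Suc m)) k = axial_step R k"
  by (simp add: axial_step_def content_extend)

lemma extend_restrict: "R \<in> SYT_shape m Y \<Longrightarrow> b \<in> addable Y \<Longrightarrow> (R(b := Suc m))(b := 0) = R"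
  using not_in_shape[of b R] by (auto simp: SYT_shape_def addable_def)

lemma adj_transp_extend: "k < m \<Longrightarrow> adj_transp k \<circ> R(b := Suc m) = (adj_transp k \<circ> R)(b := Suc m)"
  by (auto simp: fun_eq_iff)

lemma SYT_shape_nonempty:
  assumes "young Y"
  shows "SYT_shape (card Y) Y \<noteq> {}"
  using assms
proof (induction "card Y" arbitrary: Y)
  case 0
  hence "Y = {}" using young_finite by fastforce
  hence "(\<lambda>_. 0) \<in> SYT_shape (card Y) Y"
    by (auto simp: SYT_shape_def SYT_def shape_def young_def bij_betw_def)
  thus ?case by blast
next
  case (Suc m)
  hence "Y \<noteq> {}" by auto
  then obtain b where b: "b \<in> removable Y" using removable_nonempty Suc.prems by blast
  note bY = removable_young[OF b]
  have size: "card (Y - {b}) = m" using Suc.hyps(2) bY(2) by simp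
  hence "SYT_shape m (Y - {b}) \<noteq> {}" using Suc.hyps(1)[of "Y - {b}"] bY(1) by simp
  then obtain R where "R \<in> SYT_shape m (Y - {b})" by blast
  from SYT_shape_extend[OF this removable_addable[OF Suc.prems b]] show ?case
    using Suc.hyps(2) bY(2) by (auto simp: insert_absorb)
qed

lemma d_tab_pos: "is_partition n \<nu> \<Longrightarrow> 0 < d_tab \<nu>"
  using SYT_shape_nonempty[OF young_diagram, of n \<nu>] card_diagram[of \<nu>]
    finite_SYT_shape[of n "diagram \<nu>"]
  by (simp add: d_tab_def Tab_eq_SYT_shape is_partition_def card_gt_0_iff)

text \<open>Removing \<open>n\<close> from both tableaux leaves equal tableaux, and a diagram has at most one addable box
  on each superdiagonal.\<close>

lemma SYT_content_inj:
  assumes "S \<in> SYT n" "T \<in> SYT n" "\<And>k. 1 \<le> k \<Longrightarrow> k \<le> n \<Longrightarrow> content S k = content T k"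
  shows "S = T"
  using assms
proof (induction n arbitrary: S T)
  case 0
  thus ?case using SYT_0 by metis
next
  case (Suc n)
  define b c where "b = box_of S (Suc n)" and "c = box_of T (Suc n)"
  note S = SYT_shape_restrict[OF SYT_shapeI[OF Suc.prems(1)], folded b_def]
    and T = SYT_shape_restrict[OF SYT_shapeI[OF Suc.prems(2)], folded c_def]
  note b = removable_addable[OF SYT_young[OF Suc.prems(1)] S(2)]
    and c = removable_addable[OF SYT_young[OF Suc.prems(2)] T(2)]
  have S_eq: "S = (S(b := 0))(b := Suc n)" and T_eq: "T = (T(c := 0))(c := Suc n)"
    using S(3) T(3) by auto
  have "S(b := 0) = T(c := 0)"
  proof (rule Suc.IH[OF SYT_shapeD(1)[OF S(1)] SYT_shapeD(1)[OF T(1)]])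
    fix k assume k: "1 \<le> k" "k \<le> n"
    show "content (S(b := 0)) k = content (T(c := 0)) k"
      using content_extend(2)[OF S(1) b k, folded S_eq] content_extend(2)[OF T(1) c k, folded T_eq]
        Suc.prems(3)[of k] k by simp
  qed
  moreover have "superdiagonal b = superdiagonal c"
    using Suc.prems(3)[of "Suc n"] by (simp add: content_def b_def c_def)
  moreover have "shape S - {b} = shape T - {c}"
    using SYT_shapeD(2)[OF S(1)] SYT_shapeD(2)[OF T(1)] calculation(1) by simp
  ultimately show ?case
    using inj_onD[OF addable_superdiagonal_inj] b c S_eq T_eq by metis
qed

lemma SYT_shape_top_two:
  assumes Y: "young Y" and size: "card Y = Suc n"
    and bc: "b \<in> removable Y" "c \<in> removable Y" "b \<noteq> c"
  obtains U where "U \<in> SYT_shape (Suc n) Y" "adj_transp n \<circ> U \<in> SYT_shape (Suc n) Y"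
    "box_of U (Suc n) = b" "box_of U n = c" "1 \<le> n"
proof -
  define Z where "Z = Y - {b, c}"
  have "Z = (Y - {b}) \<inter> (Y - {c})" by (auto simp: Z_def)
  hence Z: "young Z" using young_Int bc(1,2)[THEN removable_young(1)] by simp
  have "{b, c} \<subseteq> Y" using bc(1,2)[THEN removable_young(2)] by blast
  hence n: "n = Suc (card Z)"
    using size bc(3) card_Diff_subset[of "{b, c}" Y] card_mono[OF young_finite[OF Y], of "{b, c}"]
    by (simp add: Z_def)
  obtain R where R: "R \<in> SYT_shape (card Z) Z" using SYT_shape_nonempty[OF Z] by blast
  have extend_twice: "(R(c := n))(b := Suc n) \<in> SYT_shape (Suc n) Y"
      "box_of ((R(c := n))(b := Suc n)) (Suc n) = b" "box_of ((R(c := n))(b := Suc n)) n = c"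
    if bc: "b \<in> removable Y" "c \<in> removable Y" "b \<noteq> c" and Z_eq: "Z = Y - {b, c}" for b c
  proof -
    have Yb: "insert c Z = Y - {b}" using removable_young(2)[OF bc(2)] bc(3) Z_eq by auto
    hence c: "c \<in> addable Z" using removable_young(1)[OF bc(1)] Z_eq by (simp add: addable_def)
    have Rc: "R(c := n) \<in> SYT_shape n (Y - {b})"
      using SYT_shape_extend[OF R c] by (simp add: Yb flip: n)
    have b: "b \<in> addable (Y - {b})" by (rule removable_addable[OF Y bc(1)])
    show "(R(c := n))(b := Suc n) \<in> SYT_shape (Suc n) Y"
      using SYT_shape_extend[OF Rc b] removable_young(2)[OF bc(1)] by (simp add: insert_absorb)
    show "box_of ((R(c := n))(b := Suc n)) (Suc n) = b" by (rule box_of_extend(1)[OF Rc b])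
    show "box_of ((R(c := n))(b := Suc n)) n = c"
      using box_of_extend(2)[OF Rc b, of n] box_of_extend(1)[OF R c] n by simp
  qed
  have "adj_transp n \<circ> (R(c := n))(b := Suc n) = (R(b := n))(c := Suc n)"
  proof
    fix x
    have "R x < n" using SYT_le[OF SYT_shapeD(1)[OF R], of x] n by simp
    thus "(adj_transp n \<circ> (R(c := n))(b := Suc n)) x = ((R(b := n))(c := Suc n)) x"
      using bc(3) by simp
  qed
  thus ?thesis
    using that extend_twice[OF bc Z_def] extend_twice(1)[OF bc(2,1) bc(3)[symmetric]] n
    by (simp add: Z_def insert_commute)
qed

lemma swap_invariant_extend:
  assumes swap: "\<And>U k. U \<in> SYT_shape (Suc n) Y \<Longrightarrow> 1 \<le> k \<Longrightarrow> k < Suc n \<Longrightarrow>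
      2 \<le> \<bar>axial_step U k\<bar> \<Longrightarrow> adj_transp k \<circ> U \<in> SYT_shape (Suc n) Y \<Longrightarrow> \<phi> (adj_transp k \<circ> U) = \<phi> U"
    and Y: "young Y" and b: "b \<in> removable Y" and k: "1 \<le> k" "k < n"
    and R: "R \<in> SYT_shape n (Y - {b})" "adj_transp k \<circ> R \<in> SYT_shape n (Y - {b})"
    and far: "2 \<le> \<bar>axial_step R k\<bar>"
  shows "\<phi> ((adj_transp k \<circ> R)(b := Suc n)) = \<phi> (R(b := Suc n))"
proof -
  note addable = removable_addable[OF Y b]
  have shape: "insert b (Y - {b}) = Y" using removable_young(2)[OF b] by blast
  have "R(b := Suc n) \<in> SYT_shape (Suc n) Y"
    using SYT_shape_extend[OF R(1) addable] by (simp only: shape)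
  moreover have "2 \<le> \<bar>axial_step (R(b := Suc n)) k\<bar>"
    using far k by (simp add: axial_step_extend[OF R(1) addable])
  moreover have "adj_transp k \<circ> R(b := Suc n) \<in> SYT_shape (Suc n) Y"
    using SYT_shape_extend[OF R(2) addable] by (simp only: shape adj_transp_extend[OF k(2)])
  ultimately show ?thesis
    unfolding adj_transp_extend[OF k(2), symmetric] by (rule swap[OF _ k(1) less_SucI[OF k(2)]])
qed

text \<open>Any two tableaux of one shape are connected by admissible swaps: if \<open>n\<close> lies in different boxes
  \<open>b\<close> and \<open>c\<close>, pass through a tableau with \<open>n\<close> in \<open>b\<close> and \<open>n - 1\<close> in \<open>c\<close>.\<close>

lemma SYT_shape_connected:
  assumes "\<And>U k. U \<in> SYT_shape n Y \<Longrightarrow> 1 \<le> k \<Longrightarrow> k < n \<Longrightarrow>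
      2 \<le> \<bar>axial_step U k\<bar> \<Longrightarrow> adj_transp k \<circ> U \<in> SYT_shape n Y \<Longrightarrow>
      \<phi> (adj_transp k \<circ> U) = \<phi> U"
    and "S \<in> SYT_shape n Y" "T \<in> SYT_shape n Y"
  shows "\<phi> S = \<phi> T"
  using assms
proof (induction n arbitrary: Y \<phi> S T)
  case 0
  thus ?case using SYT_0[OF SYT_shapeD(1)] by metis
next
  case (Suc n)
  note swap = Suc.prems(1)
  have young: "young Y" using SYT_young[OF SYT_shapeD(1)[OF Suc.prems(2)]] SYT_shapeD(2)[OF Suc.prems(2)] by simp
  have same_top: "\<phi> S = \<phi> T"
    if S: "S \<in> SYT_shape (Suc n) Y" and T: "T \<in> SYT_shape (Suc n) Y"
      and tops: "box_of S (Suc n) = b" "box_of T (Suc n) = b" for S T b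
  proof -
    note S' = SYT_shape_restrict[OF S, unfolded tops(1)] and T' = SYT_shape_restrict[OF T, unfolded tops(2)]
    have "\<phi> ((S(b := 0))(b := Suc n)) = \<phi> ((T(b := 0))(b := Suc n))"
      by (rule Suc.IH[OF _ S'(1) T'(1)]) (rule swap_invariant_extend[OF swap young S'(2)])
    thus ?thesis using S'(3) T'(3) by (simp add: fun_upd_idem)
  qed
  define b c where "b = box_of S (Suc n)" and "c = box_of T (Suc n)"
  show ?case
  proof (cases "b = c")
    case True
    thus ?thesis using same_top[OF Suc.prems(2,3)] by (simp add: b_def c_def)
  next
    case False
    have bc: "b \<in> removable Y" "c \<in> removable Y"
      using SYT_shape_restrict(2) Suc.prems(2,3) by (auto simp: b_def c_def)
    then obtain U where U: "U \<in> SYT_shape (Suc n) Y" and U': "adj_transp n \<circ> U \<in> SYT_shape (Suc n) Y"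
      and boxes: "box_of U (Suc n) = b" "box_of U n = c" and n: "1 \<le> n"
      using SYT_shape_top_two[OF young SYT_shape_card[OF Suc.prems(2)]] False by blast
    have "2 \<le> \<bar>superdiagonal b - superdiagonal c\<bar>"
      using bc False removable_iff_maximal[OF young] by (intro superdiagonal_incomparable) auto
    hence "\<phi> (adj_transp n \<circ> U) = \<phi> U"
      by (intro swap[OF U n _ _ U']) (simp_all add: axial_step_def content_def boxes)
    moreover have "\<phi> S = \<phi> U"
      by (rule same_top[OF Suc.prems(2) U b_def[symmetric] boxes(1)])
    moreover have "box_of (adj_transp n \<circ> U) (Suc n) = c" by (simp add: box_of_adj_transp boxes)
    hence "\<phi> (adj_transp n \<circ> U) = \<phi> T"
      by (intro same_top[OF U' Suc.prems(3) _ c_def[symmetric]])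
    ultimately show ?thesis by simp
  qed
qed

section \<open>Counting standard tableaux\<close>

definition num_SYT :: "(nat \<times> nat) set \<Rightarrow> nat" where
  "num_SYT Y = card (SYT_shape (card Y) Y)"

lemma d_tab_num_SYT: "is_partition n \<nu> \<Longrightarrow> d_tab \<nu> = num_SYT (diagram \<nu>)"
  using card_diagram[of \<nu>] by (simp add: d_tab_def num_SYT_def Tab_eq_SYT_shape is_partition_def)

lemma num_SYT_rec:
  assumes Y: "young Y" "Y \<noteq> {}"
  shows "num_SYT Y = (\<Sum>c\<in>removable Y. num_SYT (Y - {c}))"
proof -
  obtain m where m: "card Y = Suc m" using Y young_finite by (metis card_0_eq not0_implies_Suc)
  have smaller: "c \<in> addable (Y - {c})" "insert c (Y - {c}) = Y" "card (Y - {c}) = m"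
    if "c \<in> removable Y" for c
    using that Y(1) m removable_young(2)[OF that] by (auto intro: removable_addable)
  have "bij_betw (\<lambda>T. (box_of T (Suc m), T(box_of T (Suc m) := 0))) (SYT_shape (Suc m) Y)
      (SIGMA c:removable Y. SYT_shape m (Y - {c}))"
  proof (rule bij_betwI[where g = "\<lambda>(c, R). R(c := Suc m)"])
    show "(\<lambda>T. (box_of T (Suc m), T(box_of T (Suc m) := 0)))
        \<in> SYT_shape (Suc m) Y \<rightarrow> (SIGMA c:removable Y. SYT_shape m (Y - {c}))"
      using SYT_shape_restrict by blast
    show "(\<lambda>(c, R). R(c := Suc m)) \<in> (SIGMA c:removable Y. SYT_shape m (Y - {c})) \<rightarrow> SYT_shape (Suc m) Y"
      using SYT_shape_extend smaller by fastforce
  next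
    fix T assume "T \<in> SYT_shape (Suc m) Y"
    thus "(case (box_of T (Suc m), T(box_of T (Suc m) := 0)) of (c, R) \<Rightarrow> R(c := Suc m)) = T"
      using SYT_shape_restrict(3) by (simp add: fun_upd_idem)
  next
    fix x assume "x \<in> (SIGMA c:removable Y. SYT_shape m (Y - {c}))"
    then obtain c R where x: "x = (c, R)" and c_removable: "c \<in> removable Y"
      and R: "R \<in> SYT_shape m (Y - {c})" by blast
    show "(box_of (case x of (c, R) \<Rightarrow> R(c := Suc m)) (Suc m),
        (case x of (c, R) \<Rightarrow> R(c := Suc m))(box_of (case x of (c, R) \<Rightarrow> R(c := Suc m)) (Suc m) := 0)) = x"
      using box_of_extend(1)[OF R smaller(1)[OF c_removable]] extend_restrict[OF R smaller(1)[OF c_removable]]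
      by (simp add: x)
  qed
  hence "card (SYT_shape (Suc m) Y) = card (SIGMA c:removable Y. SYT_shape m (Y - {c}))"
    by (rule bij_betw_same_card)
  also have "\<dots> = (\<Sum>c\<in>removable Y. card (SYT_shape m (Y - {c})))"
    using finite_subset[OF removable_subset young_finite[OF Y(1)]]
    by (simp add: card_SigmaI finite_SYT_shape)
  also have "\<dots> = (\<Sum>c\<in>removable Y. num_SYT (Y - {c}))"
    using smaller(3) by (intro sum.cong) (simp_all add: num_SYT_def)
  finally show ?thesis by (simp add: num_SYT_def m)
qed

lemma addable_removable_exchange:
  assumes Y: "young Y"
  shows "b \<in> addable Y \<and> c \<in> removable (insert b Y) \<and> b \<noteq> c \<longleftrightarrow>
    c \<in> removable Y \<and> b \<in> addable (Y - {c}) \<and> b \<noteq> c"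
proof
  assume bc: "b \<in> addable Y \<and> c \<in> removable (insert b Y) \<and> b \<noteq> c"
  hence new: "b \<notin> Y" and old: "c \<in> Y" "young (insert b Y - {c})" by (auto simp: addable_def removable_def)
  have "(insert b Y - {c}) \<inter> Y = Y - {c}" "insert b Y - {c} = insert b (Y - {c})" using bc by auto
  thus "c \<in> removable Y \<and> b \<in> addable (Y - {c}) \<and> b \<noteq> c"
    using young_Int[OF old(2) Y] old new bc by (simp add: removable_def addable_def)
next
  assume bc: "c \<in> removable Y \<and> b \<in> addable (Y - {c}) \<and> b \<noteq> c"
  hence old: "c \<in> Y" and new: "b \<notin> Y" "young (insert b (Y - {c}))" by (auto simp: removable_def addable_def)
  have "Y \<union> insert b (Y - {c}) = insert b Y" "insert b Y - {c} = insert b (Y - {c})" using bc by auto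
  thus "b \<in> addable Y \<and> c \<in> removable (insert b Y) \<and> b \<noteq> c"
    using young_Un[OF Y new(2)] new old bc by (simp add: addable_def removable_def)
qed

lemma num_SYT_insert:
  assumes Y: "young Y" and b: "b \<in> addable Y"
  shows "num_SYT (insert b Y) = num_SYT Y +
    (\<Sum>c | c \<in> removable Y \<and> c \<in> removable (insert b Y) \<and> b \<noteq> c. num_SYT (insert b Y - {c}))"
proof -
  have young: "young (insert b Y)" and "b \<in> removable (insert b Y)" "insert b Y - {b} = Y"
    using addable_young[OF b] Y by (auto simp: removable_def)
  moreover have "removable (insert b Y) - {b} = {c. c \<in> removable Y \<and> c \<in> removable (insert b Y) \<and> b \<noteq> c}"
    using addable_removable_exchange[OF Y, of b] b by auto
  moreover have "finite (removable (insert b Y))"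
    by (rule finite_subset[OF removable_subset young_finite[OF young]])
  ultimately show ?thesis by (simp add: num_SYT_rec[OF young] sum.remove[of _ b])
qed

lemma sum_num_SYT_addable:
  assumes "young Y"
  shows "(\<Sum>b\<in>addable Y. num_SYT (insert b Y)) = Suc (card Y) * num_SYT Y"
  using assms
proof (induction "card Y" arbitrary: Y rule: less_induct)
  case less
  note Y = \<open>young Y\<close>
  have fin: "finite (removable Y)" "finite (addable Y)"
    using finite_subset[OF removable_subset young_finite[OF Y]] finite_addable[OF Y] by auto
  define linked where "linked b c \<longleftrightarrow> c \<in> removable (insert b Y) \<and> b \<noteq> c" for b c
  have up_down: "num_SYT (insert b Y) =
      num_SYT Y + (\<Sum>c | c \<in> removable Y \<and> linked b c. num_SYT (insert b Y - {c}))"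
    if "b \<in> addable Y" for b
    using num_SYT_insert[OF Y that] by (simp only: linked_def)
  have down_up: "num_SYT Y + (\<Sum>b | b \<in> addable Y \<and> linked b c. num_SYT (insert b Y - {c})) =
      card Y * num_SYT (Y - {c})" if c: "c \<in> removable Y" for c
  proof -
    note Yc = removable_young[OF c]
    have size: "Suc (card (Y - {c})) = card Y"
      using card_Suc_Diff1[OF young_finite[OF Y] Yc(2)] .
    have neighbours: "addable (Y - {c}) - {c} = {b. b \<in> addable Y \<and> linked b c}"
      using addable_removable_exchange[OF Y, of _ c] c by (auto simp: linked_def)
    have "card Y * num_SYT (Y - {c}) = (\<Sum>b\<in>addable (Y - {c}). num_SYT (insert b (Y - {c})))"
      using less.hyps[OF _ Yc(1)] size by simp
    also have "\<dots> = num_SYT Y + (\<Sum>b\<in>addable (Y - {c}) - {c}. num_SYT (insert b (Y - {c})))"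
      using sum.remove[OF finite_addable[OF Yc(1)] removable_addable[OF Y c],
          of "\<lambda>b. num_SYT (insert b (Y - {c}))"] Yc(2)
      by (simp add: insert_absorb)
    also have "(\<Sum>b\<in>addable (Y - {c}) - {c}. num_SYT (insert b (Y - {c}))) =
        (\<Sum>b | b \<in> addable Y \<and> linked b c. num_SYT (insert b Y - {c}))"
      unfolding neighbours by (intro sum.cong) (auto simp: linked_def insert_Diff_if)
    finally show ?thesis by simp
  qed
  define crossing where "crossing =
    (\<Sum>c\<in>removable Y. \<Sum>b | b \<in> addable Y \<and> linked b c. num_SYT (insert b Y - {c}))"
  have "(\<Sum>c\<in>removable Y. card Y * num_SYT (Y - {c})) = card Y * num_SYT Y"
    using num_SYT_rec[OF Y] by (cases "Y = {}") (simp_all flip: sum_distrib_left)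
  hence total_down: "card (removable Y) * num_SYT Y + crossing = card Y * num_SYT Y"
    by (simp add: down_up[symmetric] sum.distrib crossing_def)
  have "(\<Sum>b\<in>addable Y. num_SYT (insert b Y)) = card (addable Y) * num_SYT Y + crossing"
    unfolding crossing_def sum.swap_restrict[OF fin]
    by (simp add: up_down sum.distrib)
  also have "\<dots> = Suc (card Y) * num_SYT Y"
    using total_down by (simp add: card_addable[OF Y])
  finally show ?case .
qed

lemma d_sum_up_set:
  assumes p: "is_partition m \<mu>"
  shows "d_sum (up_set \<mu>) = Suc m * d_tab \<mu>"
proof -
  have "d_sum (up_set \<mu>) = (\<Sum>\<nu>\<in>up_set \<mu>. num_SYT (insert (added_box \<nu> \<mu>) (diagram \<mu>)))"
    unfolding d_sum_def using d_tab_num_SYT up_setD[OF p] by (intro sum.cong) (simp, metis)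
  also have "\<dots> = (\<Sum>b\<in>addable (diagram \<mu>). num_SYT (insert b (diagram \<mu>)))"
    by (rule sum.reindex_bij_betw[OF added_box_bij[OF p]])
  also have "\<dots> = Suc m * d_tab \<mu>"
    using p by (simp only: sum_num_SYT_addable[OF young_diagram[OF p]] card_diagram d_tab_num_SYT[OF p]
        is_partition_def)
  finally show ?thesis .
qed

section \<open>Transposition of tableaux\<close>

definition transpose_tab :: "tableau \<Rightarrow> tableau" where
  "transpose_tab T = T \<circ> prod.swap"

lemma transpose_tab_apply: "transpose_tab T b = T (prod.swap b)"
  by (simp add: transpose_tab_def)

lemma transpose_tab_involutive [simp]: "transpose_tab (transpose_tab T) = T"
  by (simp add: transpose_tab_def fun_eq_iff)

lemma transpose_tab_eq_iff: "transpose_tab S = T \<longleftrightarrow> S = transpose_tab T"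
  by (metis transpose_tab_involutive)

lemma adj_transp_transpose_tab: "adj_transp k \<circ> transpose_tab T = transpose_tab (adj_transp k \<circ> T)"
  by (simp add: transpose_tab_def comp_assoc)

lemma shape_transpose_tab: "shape (transpose_tab T) = prod.swap ` shape T"
  by (intro Set.set_eqI) (simp add: mem_swap_image shape_def transpose_tab_apply)

lemma transpose_tab_SYT:
  assumes T: "T \<in> SYT n"
  shows "transpose_tab T \<in> SYT n"
proof -
  have "bij_betw prod.swap (prod.swap ` shape T) (shape T)"
    by (rule bij_betwI[where g = prod.swap]) auto
  hence "bij_betw (transpose_tab T) (prod.swap ` shape T) {1..n}"
    unfolding transpose_tab_def by (rule bij_betw_trans) (rule SYT_bij[OF T])
  moreover have "transpose_tab T b < transpose_tab T c"
    if "b \<in> prod.swap ` shape T" "c \<in> prod.swap ` shape T" "fst b \<le> fst c" "snd b \<le> snd c" "b \<noteq> c" for b c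
    unfolding transpose_tab_apply using that
    by (intro SYT_strict_mono[OF T]) (auto simp: mem_swap_image prod_eq_iff)
  ultimately show ?thesis
    using young_swap[OF SYT_young[OF T]] by (simp add: SYT_def shape_transpose_tab)
qed

lemma transpose_tab_SYT_shape:
  "T \<in> SYT_shape n Y \<Longrightarrow> transpose_tab T \<in> SYT_shape n (prod.swap ` Y)"
  by (simp add: SYT_shape_def transpose_tab_SYT shape_transpose_tab)

lemma content_transpose_tab:
  assumes T: "T \<in> SYT n" and a: "1 \<le> a" "a \<le> n"
  shows "content (transpose_tab T) a = - content T a"
proof -
  have "prod.swap (box_of T a) \<in> shape (transpose_tab T)"
    using box_of_SYT(2)[OF T a] by (simp add: shape_transpose_tab)
  from box_of_entry[OF transpose_tab_SYT[OF T] this]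
  have "box_of (transpose_tab T) a = prod.swap (box_of T a)"
    using box_of_SYT(1)[OF T a] by (simp add: transpose_tab_apply)
  thus ?thesis by (simp add: content_def superdiagonal_def)
qed

lemma axial_step_transpose_tab:
  "T \<in> SYT n \<Longrightarrow> 1 \<le> k \<Longrightarrow> k < n \<Longrightarrow> axial_step (transpose_tab T) k = - axial_step T k"
  by (simp add: axial_step_def content_transpose_tab)

lemma num_SYT_swap: "num_SYT (prod.swap ` Y) = num_SYT Y"
proof -
  have "bij_betw transpose_tab (SYT_shape (card Y) Y) (SYT_shape (card Y) (prod.swap ` Y))"
    by (rule bij_betwI[where g = transpose_tab]) (auto dest: transpose_tab_SYT_shape)
  thus ?thesis unfolding num_SYT_def by (simp add: bij_betw_same_card card_image)
qed

lemma SYT_second_entry: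
  assumes T: "T \<in> SYT n" and n: "2 \<le> n"
  shows "T (1, 2) = 2 \<longleftrightarrow> T (2, 1) \<noteq> 2"
proof -
  note two = box_of_SYT[OF T _ n, simplified]
  have predecessor: "b = (1, 1)"
    if "b \<in> shape T" "b \<noteq> box_of T 2" "fst b \<le> fst (box_of T 2)" "snd b \<le> snd (box_of T 2)" for b
  proof -
    have "T b = 1"
      using SYT_strict_mono[OF T that(1) two(2) that(3,4,2)] two(1) SYT_range[OF T that(1)] by simp
    thus ?thesis using box_of_entry[OF T that(1)] box_of_one[OF T] n by simp
  qed
  obtain i j where ij: "box_of T 2 = (i, j)" by force
  have pos: "1 \<le> i" "1 \<le> j" using young_pos[OF SYT_young[OF T]] two(2) ij by auto
  have "(i, j) \<noteq> (1, 1)" using box_of_one[OF T] box_of_SYT(1)[OF T, of 1] two(1) ij n by auto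
  hence "1 < i \<or> 1 < j" using pos by auto
  hence "box_of T 2 = (1, 2) \<or> box_of T 2 = (2, 1)"
  proof
    assume i: "1 < i"
    hence "(i - 1, j) \<in> shape T"
      using young_down[OF SYT_young[OF T], of i j "i - 1" j] two(2) ij pos by simp
    thus ?thesis using predecessor[of "(i - 1, j)"] i ij by (cases i) auto
  next
    assume j: "1 < j"
    hence "(i, j - 1) \<in> shape T"
      using young_down[OF SYT_young[OF T], of i j i "j - 1"] two(2) ij pos by simp
    thus ?thesis using predecessor[of "(i, j - 1)"] j ij by (cases j) auto
  qed
  moreover have unique: "b = box_of T 2" if "T b = 2" for b
    using SYT_inj[OF T two(2), of b] two(1) that by simp
  ultimately show ?thesis
  proof (elim disjE)
    assume "box_of T 2 = (1, 2)"
    thus ?thesis using two(1) unique[of "(2, 1)"] by auto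
  next
    assume "box_of T 2 = (2, 1)"
    thus ?thesis using two(1) unique[of "(1, 2)"] by auto
  qed
qed

section \<open>The sign of a tableau\<close>

lemma even_card_involution:
  assumes "\<And>x. x \<in> A \<Longrightarrow> f x \<in> A" "\<And>x. x \<in> A \<Longrightarrow> f (f x) = x" "\<And>x. x \<in> A \<Longrightarrow> f x \<noteq> x"
  shows "even (card A)"
proof -
  have "(\<Sum>x\<in>A. 1 :: bit) = 0" by (rule sum_involution_eq_0[of A _ f]) (use assms in simp_all)
  hence "of_nat (card A) = (0 :: bit)" by simp
  thus ?thesis by (metis dvd_0_right even_of_nat)
qed

lemma prod_mult_prod_of_signs:
  fixes f :: "'b \<Rightarrow> 'a::comm_monoid_mult"
  assumes "finite A" "finite B" and sign: "\<And>x. f x * f x = 1"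
  shows "prod f A * prod f B = prod f (A - B) * prod f (B - A)"
proof -
  have "prod f A * prod f B = (prod f (A - B) * prod f (A \<inter> B)) * (prod f (B - A) * prod f (A \<inter> B))"
    using prod.Int_Diff[OF assms(1), of f B] prod.Int_Diff[OF assms(2), of f A]
    by (simp add: mult.commute Int_commute)
  also have "\<dots> = prod f (A - B) * prod f (B - A) * (\<Prod>x\<in>A \<inter> B. f x * f x)"
    by (simp add: prod.distrib ac_simps)
  finally show ?thesis by (simp add: sign)
qed

definition row_before :: "nat \<times> nat \<Rightarrow> nat \<times> nat \<Rightarrow> bool" where
  "row_before b c \<longleftrightarrow> fst b < fst c \<or> fst b = fst c \<and> snd b < snd c"

lemma row_before_total: "b \<noteq> c \<Longrightarrow> row_before b c \<longleftrightarrow> \<not> row_before c b"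
  by (auto simp: row_before_def prod_eq_iff)

text \<open>Inversion sign with respect to the order of boxes in which those of \<open>Y\<close> come first, row by row.
  Boxes outside \<open>Y\<close> are last: adding the largest entry to a tableau of shape \<open>Y\<close> creates no inversion.\<close>

definition ordered_pairs :: "(nat \<times> nat) set \<Rightarrow> (nat \<times> nat) set \<Rightarrow> ((nat \<times> nat) \<times> nat \<times> nat) set" where
  "ordered_pairs Y Z = {(b, c). b \<in> Y \<and> c \<in> Z \<and> (c \<notin> Y \<or> row_before b c)}"

definition pair_sign :: "tableau \<Rightarrow> (nat \<times> nat) \<times> nat \<times> nat \<Rightarrow> real" where
  "pair_sign T p = (if T (fst p) < T (snd p) then 1 else - 1)"

definition tab_sign :: "(nat \<times> nat) set \<Rightarrow> tableau \<Rightarrow> real" where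
  "tab_sign Y T = (\<Prod>p\<in>ordered_pairs Y (shape T). pair_sign T p)"

lemma finite_ordered_pairs: "finite Y \<Longrightarrow> finite Z \<Longrightarrow> finite (ordered_pairs Y Z)"
  by (rule finite_subset[of _ "Y \<times> Z"]) (auto simp: ordered_pairs_def)

lemma pair_sign_square: "pair_sign T p * pair_sign T p = 1"
  by (simp add: pair_sign_def)

lemma tab_sign_square: "tab_sign Y T * tab_sign Y T = 1"
  by (simp add: tab_sign_def pair_sign_square flip: prod.distrib)

lemma pair_sign_adj_transp:
  assumes "T (fst p) \<noteq> T (snd p)"
  shows "pair_sign (adj_transp k \<circ> T) p =
    (if {T (fst p), T (snd p)} = {k, Suc k} then - 1 else 1) * pair_sign T p"
  using assms by (auto simp: pair_sign_def adj_transp_eq_if doubleton_eq_iff)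

lemma tab_sign_adj_transp:
  assumes T: "T \<in> SYT n" and Y: "Y \<subseteq> shape T" "shape T - Y \<subseteq> {b0}" and k: "1 \<le> k" "k < n"
  shows "tab_sign Y (adj_transp k \<circ> T) = - tab_sign Y T"
proof -
  define P where "P = ordered_pairs Y (shape T)"
  have fin: "finite P"
    using finite_ordered_pairs young_finite[OF SYT_young[OF T]] finite_subset[OF Y(1)] by (simp add: P_def)
  have in_shape: "b \<in> shape T" "c \<in> shape T" "b \<noteq> c" if "(b, c) \<in> P" for b c
    using that Y(1) by (auto simp: P_def ordered_pairs_def row_before_def)
  have tournament: "(b, c) \<in> P \<longleftrightarrow> (c, b) \<notin> P" if "b \<in> shape T" "c \<in> shape T" "b \<noteq> c" for b c
    using that Y row_before_total[OF that(3)] by (auto simp: P_def ordered_pairs_def)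
  define x y where "x = box_of T k" and "y = box_of T (Suc k)"
  have x: "x \<in> shape T" "T x = k" and y: "y \<in> shape T" "T y = Suc k"
    using box_of_SYT[OF T, of k] box_of_SYT[OF T, of "Suc k"] k by (auto simp: x_def y_def)
  define p0 where "p0 = (if (x, y) \<in> P then (x, y) else (y, x))"
  have "x \<noteq> y" using x(2) y(2) by auto
  hence p0: "p0 \<in> P" using tournament[OF x(1) y(1)] by (auto simp: p0_def)
  have swapped_iff: "{T (fst p), T (snd p)} = {k, Suc k} \<longleftrightarrow> p = p0" if "p \<in> P" for p
  proof
    obtain b c where bc: "p = (b, c)" by (cases p)
    assume "{T (fst p), T (snd p)} = {k, Suc k}"
    hence "T b = T x \<and> T c = T y \<or> T b = T y \<and> T c = T x"
      by (simp add: bc x(2) y(2) doubleton_eq_iff)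
    hence "p = (x, y) \<or> p = (y, x)"
      using SYT_inj[OF T, of b x] SYT_inj[OF T, of b y] SYT_inj[OF T, of c x] SYT_inj[OF T, of c y]
        in_shape[of b c] that by (auto simp: bc)
    thus "p = p0" using that tournament[OF x(1) y(1) \<open>x \<noteq> y\<close>] by (auto simp: p0_def)
  next
    assume "p = p0"
    thus "{T (fst p), T (snd p)} = {k, Suc k}" using x(2) y(2) by (auto simp: p0_def)
  qed
  have "pair_sign (adj_transp k \<circ> T) p = (if p = p0 then - 1 else 1) * pair_sign T p" if "p \<in> P" for p
  proof -
    have "T (fst p) \<noteq> T (snd p)"
      using SYT_inj[OF T, of "fst p" "snd p"] in_shape[of "fst p" "snd p"] that by auto
    thus ?thesis using pair_sign_adj_transp swapped_iff[OF that] by simp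
  qed
  hence "prod (pair_sign (adj_transp k \<circ> T)) P = (\<Prod>p\<in>P. (if p = p0 then - 1 else 1) * pair_sign T p)"
    by (rule prod.cong[OF refl])
  also have "\<dots> = (\<Prod>p\<in>P. if p = p0 then - 1 else 1) * prod (pair_sign T) P"
    by (rule prod.distrib)
  also have "(\<Prod>p\<in>P. if p = p0 then - 1 else 1 :: real) = - 1" using fin p0 by simp
  finally show ?thesis
    by (simp only: tab_sign_def shape_adj_transp[OF k(1)] P_def mult_minus1)
qed

lemma tab_sign_extend:
  assumes R: "R \<in> SYT_shape m Y" and b: "b \<in> addable Y"
  shows "tab_sign Y (R(b := Suc m)) = tab_sign Y R"
proof -
  let ?T = "R(b := Suc m)"
  have new: "b \<notin> Y" by (rule addable_young(2)[OF b])
  have fin: "finite Y" using young_finite[OF SYT_young] SYT_shapeD[OF R] by metis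
  have "ordered_pairs Y (insert b Y) = ordered_pairs Y Y \<union> Y \<times> {b}" "ordered_pairs Y Y \<inter> Y \<times> {b} = {}"
    using new by (auto simp: ordered_pairs_def)
  hence "tab_sign Y ?T = prod (pair_sign ?T) (ordered_pairs Y Y) * prod (pair_sign ?T) (Y \<times> {b})"
    using finite_ordered_pairs[OF fin fin] fin SYT_shapeD(2)[OF SYT_shape_extend[OF R b]]
    by (simp add: tab_sign_def prod.union_disjoint)
  also have "prod (pair_sign ?T) (Y \<times> {b}) = 1"
    using SYT_le[OF SYT_shapeD(1)[OF R]] new by (intro prod.neutral) (auto simp: pair_sign_def less_Suc_eq_le)
  also have "prod (pair_sign ?T) (ordered_pairs Y Y) = tab_sign Y R"
    unfolding tab_sign_def SYT_shapeD(2)[OF R]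
    using new by (intro prod.cong) (auto simp: pair_sign_def ordered_pairs_def)
  finally show ?thesis by (simp only: mult_1_right)
qed

definition ne_sw_pairs :: "(nat \<times> nat) set \<Rightarrow> ((nat \<times> nat) \<times> nat \<times> nat) set" where
  "ne_sw_pairs Y = {(b, c). b \<in> Y \<and> c \<in> Y \<and> fst b < fst c \<and> snd c < snd b}"

lemma finite_ne_sw_pairs: "finite Y \<Longrightarrow> finite (ne_sw_pairs Y)"
  by (rule finite_subset[of _ "Y \<times> Y"]) (auto simp: ne_sw_pairs_def)

text \<open>Reflection in the main diagonal is an involution on the pairs; only the pairs of mirror boxes
  are fixed.\<close>

lemma even_card_ne_sw_pairs_iff:
  assumes fin: "finite Y" and sym: "prod.swap ` Y = Y"
  shows "even (card (ne_sw_pairs Y)) \<longleftrightarrow> even (card {b \<in> Y. fst b < snd b})"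
proof -
  have swap_Y: "prod.swap b \<in> Y \<longleftrightarrow> b \<in> Y" for b using mem_swap_image[of b Y] sym by simp
  have mirror: "(j, i) \<in> Y" if "(i, j) \<in> Y" for i j using swap_Y[of "(i, j)"] that by simp
  define reflect where "reflect p = (prod.swap (snd p), prod.swap (fst p))" for p :: "(nat \<times> nat) \<times> nat \<times> nat"
  define fixed where "fixed = {p \<in> ne_sw_pairs Y. reflect p = p}"
  have "even (card (ne_sw_pairs Y - fixed))"
    by (rule even_card_involution[where f = reflect])
      (auto simp: fixed_def ne_sw_pairs_def reflect_def swap_Y dest: mirror)
  moreover have "card (ne_sw_pairs Y) = card (ne_sw_pairs Y - fixed) + card fixed"
  proof -
    have "fixed \<subseteq> ne_sw_pairs Y" by (auto simp: fixed_def)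
    thus ?thesis
      using card_mono[OF finite_ne_sw_pairs[OF fin]] finite_subset[OF _ finite_ne_sw_pairs[OF fin]]
      by (simp add: card_Diff_subset)
  qed
  moreover have "fixed = (\<lambda>b. (b, prod.swap b)) ` {b \<in> Y. fst b < snd b}"
    by (auto simp: fixed_def ne_sw_pairs_def reflect_def swap_Y dest: mirror)
  hence "card fixed = card {b \<in> Y. fst b < snd b}" by (simp add: card_image inj_on_def)
  ultimately show ?thesis by simp
qed

lemma tab_sign_transpose_tab:
  assumes Y: "finite Y" "prod.swap ` Y = Y" and T: "T \<in> SYT n" "Y \<subseteq> shape T"
  shows "tab_sign Y T * tab_sign Y (transpose_tab T) = (- 1) ^ card {b \<in> Y. fst b < snd b}"
proof -
  have swap_Y: "prod.swap b \<in> Y \<longleftrightarrow> b \<in> Y" for b using mem_swap_image[of b Y] Y(2) by simp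
  have mirror: "(j, i) \<in> Y" if "(i, j) \<in> Y" for i j using swap_Y[of "(i, j)"] that by simp
  have finZ: "finite (shape T)" by (rule young_finite[OF SYT_young[OF T(1)]])
  define P where "P = ordered_pairs Y (shape T)"
  define P' where "P' = {(b, c). b \<in> Y \<and> c \<in> shape T \<and> (c \<notin> Y \<or> row_before (prod.swap b) (prod.swap c))}"
  have fin: "finite P" "finite P'"
    by (rule finite_subset[of _ "Y \<times> shape T"]; use Y(1) finZ in \<open>auto simp: P_def P'_def ordered_pairs_def\<close>)+
  have "tab_sign Y (transpose_tab T) = prod (pair_sign T) P'"
    unfolding tab_sign_def shape_transpose_tab
    by (rule prod.reindex_bij_witness[of _ "map_prod prod.swap prod.swap" "map_prod prod.swap prod.swap"])
      (auto simp: P'_def ordered_pairs_def pair_sign_def transpose_tab_apply mem_swap_image swap_Y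
        dest: mirror)
  hence "tab_sign Y T * tab_sign Y (transpose_tab T) =
      prod (pair_sign T) (P - P') * prod (pair_sign T) (P' - P)"
    by (simp add: tab_sign_def prod_mult_prod_of_signs[OF fin pair_sign_square] flip: P_def)
  also have "P - P' = ne_sw_pairs Y"
    using T(2) by (auto simp: P_def ordered_pairs_def P'_def ne_sw_pairs_def row_before_def)
  also have "prod (pair_sign T) (P' - P) = (\<Prod>p\<in>ne_sw_pairs Y. pair_sign T (prod.swap p))"
    by (rule prod.reindex_bij_witness[of _ prod.swap prod.swap])
      (use T(2) in \<open>auto simp: P_def ordered_pairs_def P'_def ne_sw_pairs_def row_before_def\<close>)
  also have "prod (pair_sign T) (ne_sw_pairs Y) * \<dots> = (\<Prod>p\<in>ne_sw_pairs Y. - 1)"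
    unfolding prod.distrib[symmetric]
  proof (rule prod.cong[OF refl])
    fix p assume "p \<in> ne_sw_pairs Y"
    hence "fst p \<in> shape T" "fst p \<noteq> snd p" using T(2) by (auto simp: ne_sw_pairs_def)
    hence "T (fst p) \<noteq> T (snd p)" using SYT_inj[OF T(1)] by blast
    thus "pair_sign T p * pair_sign T (prod.swap p) = - 1" by (auto simp: pair_sign_def)
  qed
  also have "\<dots> = (- 1) ^ card {b \<in> Y. fst b < snd b}"
    using even_card_ne_sw_pairs_iff[OF Y] by (simp add: minus_one_power_iff)
  finally show ?thesis .
qed

section \<open>Young's orthogonal form\<close>

definition swap_weight :: "int \<Rightarrow> real" where
  "swap_weight d = sqrt (1 - 1 / (of_int d)\<^sup>2)"

lemma swap_weight_minus [simp]: "swap_weight (- d) = swap_weight d"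
  by (simp add: swap_weight_def)

lemma swap_weight_diff_commute: "swap_weight (a - b) = swap_weight (b - a)"
  using swap_weight_minus[of "b - a"] by simp

lemma swap_weight_eq_0: "\<bar>d\<bar> = 1 \<Longrightarrow> swap_weight d = 0"
  by (auto simp: swap_weight_def abs_if split: if_splits)

lemma swap_weight_square:
  assumes "d \<noteq> 0"
  shows "(swap_weight d)\<^sup>2 = 1 - 1 / (of_int d)\<^sup>2"
proof -
  have "1 \<le> \<bar>real_of_int d\<bar>" using assms by linarith
  hence "1 \<le> (real_of_int d)\<^sup>2" by (simp add: abs_le_square_iff[of 1, simplified])
  thus ?thesis by (simp add: swap_weight_def divide_le_eq)
qed

lemma swap_weight_nonzero:
  assumes "2 \<le> \<bar>d\<bar>"
  shows "swap_weight d \<noteq> 0"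
proof -
  have "1 < \<bar>real_of_int d\<bar>" using assms by linarith
  hence "1 < (real_of_int d)\<^sup>2" by (metis abs_le_square_iff abs_one linorder_not_le one_power2)
  thus ?thesis by (simp add: swap_weight_def)
qed

text \<open>Young's orthogonal form acts on functions on standard tableaux of all shapes of size \<open>n\<close>
  simultaneously. The formal operator \<open>young_op\<close> ignores standardness; it agrees with \<open>young_op_on\<close>
  on \<open>SYT n\<close> because \<open>swap_weight\<close> vanishes whenever the swapped tableau is not standard.\<close>

definition young_op :: "nat \<Rightarrow> (tableau \<Rightarrow> real) \<Rightarrow> tableau \<Rightarrow> real" where
  "young_op k f T = f T / of_int (axial_step T k) + swap_weight (axial_step T k) * f (adj_transp k \<circ> T)"

definition young_op_on :: "nat \<Rightarrow> nat \<Rightarrow> (tableau \<Rightarrow> real) \<Rightarrow> tableau \<Rightarrow> real" where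
  "young_op_on n k f T = (if T \<in> SYT n then young_op k f T else f T)"

lemma swap_SYT_or_weight_0:
  assumes "T \<in> SYT n" "1 \<le> k" "k < n"
  shows "adj_transp k \<circ> T \<in> SYT n \<or> swap_weight (axial_step T k) = 0"
  by (rule SYT_swap_cases[OF assms]) (simp_all add: swap_weight_eq_0)

lemma young_op_cong:
  assumes "T \<in> SYT n" "1 \<le> k" "k < n"
    and "\<And>S. S \<in> SYT_shape n (shape T) \<Longrightarrow> f S = g S"
  shows "young_op k f T = young_op k g T"
  using swap_SYT_or_weight_0[OF assms(1-3)] assms(4)[of T] assms(4)[of "adj_transp k \<circ> T"] assms(1,2)
  by (auto simp: young_op_def SYT_shape_def shape_adj_transp)

lemma young_op_involutive:
  assumes "T \<in> SYT n" "1 \<le> k" "k < n"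
  shows "young_op k (young_op k f) T = f T"
proof -
  define d where "d = axial_step T k"
  have "d \<noteq> 0" using axial_step_nonzero[OF assms] by (simp add: d_def)
  have "young_op k (young_op k f) T = f T * (1 / (of_int d)\<^sup>2 + (swap_weight d)\<^sup>2)"
    by (simp add: young_op_def adj_transp_comp_self flip: d_def)
       (simp add: field_simps power2_eq_square add_divide_distrib)
  thus ?thesis using swap_weight_square[OF \<open>d \<noteq> 0\<close>] by simp
qed

lemma adj_transp_comp_commute:
  "1 \<le> k \<Longrightarrow> Suc k < l \<Longrightarrow> adj_transp k \<circ> (adj_transp l \<circ> T) = adj_transp l \<circ> (adj_transp k \<circ> T)"
  using coxeter_action.commute[OF coxeter_action_adj_transp, of k l "Suc l"] by (simp add: fun_eq_iff)

lemma adj_transp_comp_braid: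
  "1 \<le> k \<Longrightarrow> adj_transp k \<circ> (adj_transp (Suc k) \<circ> (adj_transp k \<circ> T)) =
   adj_transp (Suc k) \<circ> (adj_transp k \<circ> (adj_transp (Suc k) \<circ> T))"
  using coxeter_action.braid[OF coxeter_action_adj_transp, of k "Suc (Suc k)"] by (simp add: fun_eq_iff)

lemma young_op_commute:
  assumes "1 \<le> k" "Suc k < l"
  shows "young_op k (young_op l f) T = young_op l (young_op k f) T"
  using assms adj_transp_comp_commute[OF assms, of T]
  by (simp add: young_op_def axial_step_def divide_inverse algebra_simps)

lemma braid_identity:
  fixes x y z wx wy wz :: real
  assumes "x * y = z * (x + y)" "wx\<^sup>2 = 1 - x\<^sup>2" "wy\<^sup>2 = 1 - y\<^sup>2"
  shows "x * (y * (x * f0 + wx * f1) + wy * (z * f2 + wz * f12)) +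
      wx * (z * (- x * f1 + wx * f0) + wz * (y * f21 + wy * f121)) =
    y * (x * (y * f0 + wy * f2) + wx * (z * f1 + wz * f21)) +
      wy * (z * (- y * f2 + wy * f0) + wz * (x * f12 + wx * f121))"
    (is "?L = ?R")
proof -
  have "?L - ?R = f0 * (x * (x * y) + wx\<^sup>2 * z - y * (x * y) - wy\<^sup>2 * z) +
      f1 * wx * (x * y - z * (x + y)) - f2 * wy * (x * y - z * (x + y))"
    by (simp add: algebra_simps power2_eq_square)
  also have "\<dots> = 0" unfolding assms by (simp add: algebra_simps power2_eq_square)
  finally show ?thesis by simp
qed

lemma young_op_braid:
  assumes T: "T \<in> SYT n" and k: "1 \<le> k" "Suc k < n"
  shows "young_op k (young_op (Suc k) (young_op k f)) T = young_op (Suc k) (young_op k (young_op (Suc k) f)) T"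
proof -
  define a b c where "a = content T k" and "b = content T (Suc k)" and "c = content T (Suc (Suc k))"
  have distinct: "a \<noteq> b" "b \<noteq> c" "a \<noteq> c"
    using axial_step_nonzero[of T n k] axial_step_nonzero[of T n "Suc k"] content_Suc_Suc_neq[of T n k] T k
    by (auto simp: a_def b_def c_def axial_step_def)
  define x y z where "x = 1 / real_of_int (b - a)" and "y = 1 / real_of_int (c - b)"
    and "z = 1 / real_of_int (c - a)"
  have "b - a \<noteq> 0" "c - b \<noteq> 0" "c - a \<noteq> 0" using distinct by auto
  hence inverses: "x * y = z * (x + y)"
    unfolding x_def y_def z_def by (simp add: divide_simps)
  have weights: "(swap_weight (b - a))\<^sup>2 = 1 - x\<^sup>2" "(swap_weight (c - b))\<^sup>2 = 1 - y\<^sup>2"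
    using swap_weight_square[of "b - a"] swap_weight_square[of "c - b"] distinct
    by (auto simp: x_def y_def power_divide)
  have divisions: "t / real_of_int (b - a) = x * t" "t / real_of_int (c - b) = y * t"
    "t / real_of_int (c - a) = z * t"
    "t / real_of_int (a - b) = - x * t" "t / real_of_int (b - c) = - y * t" for t
    using minus_divide_right[of t "real_of_int (b - a)"] minus_divide_right[of t "real_of_int (c - b)"]
    by (simp_all add: x_def y_def z_def)
  show ?thesis
    using braid_identity[OF inverses weights, of "f T" "f (adj_transp k \<circ> T)" "f (adj_transp (Suc k) \<circ> T)"
      "swap_weight (c - a)" "f (adj_transp k \<circ> (adj_transp (Suc k) \<circ> T))"
      "f (adj_transp (Suc k) \<circ> (adj_transp k \<circ> T))"
      "f (adj_transp k \<circ> (adj_transp (Suc k) \<circ> (adj_transp k \<circ> T)))"]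
    by (simp add: young_op_def axial_step_def adj_transp_comp_self divisions
        swap_weight_diff_commute[of a b] swap_weight_diff_commute[of b c]
        flip: a_def b_def c_def adj_transp_comp_braid[OF k(1)] del: of_int_diff)
qed

text \<open>Multiplication by the content of \<open>k\<close> is the action of the \<open>k\<close>-th Jucys-Murphy element; this
  is its recursion \<open>X\<^bsub>k+1\<^esub> = s\<^sub>k X\<^sub>k s\<^sub>k + s\<^sub>k\<close>.\<close>

lemma young_op_content:
  assumes "T \<in> SYT n" "1 \<le> k" "k < n"
  shows "young_op k (\<lambda>T. of_int (content T k) * young_op k f T) T + young_op k f T =
    of_int (content T (Suc k)) * f T"
proof -
  define a b where "a = real_of_int (content T k)" and "b = real_of_int (content T (Suc k))"
  define w where "w = swap_weight (axial_step T k)"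
  define r where "r = 1 / real_of_int (axial_step T k)"
  have r: "(b - a) * r = 1" and w: "w\<^sup>2 = 1 - r\<^sup>2"
    using axial_step_nonzero[OF assms] swap_weight_square[of "axial_step T k"]
    by (simp_all add: a_def b_def r_def w_def axial_step_def power_divide)
  have op: "young_op k g T = r * g T + w * g (adj_transp k \<circ> T)"
    "young_op k g (adj_transp k \<circ> T) = - r * g (adj_transp k \<circ> T) + w * g T" for g
    by (simp_all add: young_op_def r_def w_def adj_transp_comp_self)
  have "young_op k (\<lambda>T. of_int (content T k) * young_op k f T) T + young_op k f T =
      f T * (a * r\<^sup>2 + b * w\<^sup>2 + r) + w * f (adj_transp k \<circ> T) * (1 - (b - a) * r)"
    unfolding op(1)[of "\<lambda>T. of_int (content T k) * young_op k f T"]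
    by (simp add: op a_def b_def power2_eq_square algebra_simps)
  also have "a * r\<^sup>2 + b * w\<^sup>2 + r = b - (b - a) * r * r + r"
    unfolding w by (simp add: algebra_simps power2_eq_square)
  also have "f T * \<dots> + w * f (adj_transp k \<circ> T) * (1 - (b - a) * r) = b * f T"
    unfolding r by simp
  finally show ?thesis unfolding b_def .
qed

lemma young_op_transpose_tab:
  assumes "T \<in> SYT n" "1 \<le> k" "k < n"
  shows "young_op k f (transpose_tab T) = - f (transpose_tab T) / of_int (axial_step T k) +
    swap_weight (axial_step T k) * f (transpose_tab (adj_transp k \<circ> T))"
  by (simp add: young_op_def axial_step_transpose_tab[OF assms] adj_transp_transpose_tab)

lemma young_op_on_SYT: "T \<in> SYT n \<Longrightarrow> young_op_on n k f T = young_op k f T"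
  by (simp add: young_op_on_def)

lemma young_op_on_comp:
  assumes "T \<in> SYT n" "1 \<le> k" "k < n" "\<And>S. S \<in> SYT n \<Longrightarrow> f S = g S"
  shows "young_op_on n k f T = young_op k g T"
  using young_op_cong[OF assms(1-3), of f g] assms(1,4) by (simp add: young_op_on_SYT SYT_shape_def)

lemma coxeter_action_young_op_on: "coxeter_action (young_op_on n) n"
proof
  fix k f assume k: "1 \<le> k" "k < n"
  show "young_op_on n k (young_op_on n k f) = f"
  proof
    fix T show "young_op_on n k (young_op_on n k f) T = f T"
    proof (cases "T \<in> SYT n")
      case True
      thus ?thesis
        using young_op_on_comp[OF True k young_op_on_SYT] young_op_involutive[OF True k] by simp
    qed (simp add: young_op_on_def)
  qed
next
  fix k f assume k: "1 \<le> k" "Suc k < n"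
  have triple: "young_op_on n i (young_op_on n j (young_op_on n l f)) T =
      young_op i (young_op j (young_op l f)) T"
    if "T \<in> SYT n" "i \<in> {k, Suc k}" "j \<in> {k, Suc k}" for i j l T
    using that k by (intro young_op_on_comp young_op_on_SYT) auto
  show "young_op_on n k (young_op_on n (Suc k) (young_op_on n k f)) =
      young_op_on n (Suc k) (young_op_on n k (young_op_on n (Suc k) f))"
  proof
    fix T show "young_op_on n k (young_op_on n (Suc k) (young_op_on n k f)) T =
        young_op_on n (Suc k) (young_op_on n k (young_op_on n (Suc k) f)) T"
    proof (cases "T \<in> SYT n")
      case True
      thus ?thesis using young_op_braid[OF True k] by (simp add: triple)
    qed (simp add: young_op_on_def)
  qed
next
  fix k l f assume kl: "1 \<le> k" "Suc k < l" "l < n"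
  show "young_op_on n k (young_op_on n l f) = young_op_on n l (young_op_on n k f)"
  proof
    fix T show "young_op_on n k (young_op_on n l f) T = young_op_on n l (young_op_on n k f) T"
    proof (cases "T \<in> SYT n")
      case True
      thus ?thesis
        using kl young_op_on_comp[OF True _ _ young_op_on_SYT] young_op_commute[OF kl(1,2)] by simp
    qed (simp add: young_op_on_def)
  qed
qed

definition young_action :: "nat \<Rightarrow> (nat \<Rightarrow> nat) \<Rightarrow> (tableau \<Rightarrow> real) \<Rightarrow> tableau \<Rightarrow> real" where
  "young_action n = coxeter_lift (young_op_on n) n"

lemma young_action_id: "young_action n id = id"
  by (simp add: young_action_def coxeter_lift_id)

lemma young_action_step:
  "\<sigma> permutes {1..n} \<Longrightarrow> 1 \<le> k \<Longrightarrow> k < n \<Longrightarrow>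
    young_action n (adj_transp k \<circ> \<sigma>) f = young_op_on n k (young_action n \<sigma> f)"
  using coxeter_action.coxeter_lift_step[OF coxeter_action_young_op_on, of n n \<sigma> k]
  by (simp add: young_action_def)

lemma young_action_adj_transp: "1 \<le> k \<Longrightarrow> k < n \<Longrightarrow> young_action n (adj_transp k) f = young_op_on n k f"
  using young_action_step[of id n k f] by (simp add: permutes_id young_action_id)

lemma young_action_comp:
  assumes "\<sigma> permutes {1..n}" "\<tau> permutes {1..n}"
  shows "young_action n (\<sigma> \<circ> \<tau>) f = young_action n \<sigma> (young_action n \<tau> f)"
  using assms(1)
proof (induction rule: permutes_adj_transp_induct)
  case id
  show ?case unfolding id_comp young_action_id by simp
next
  case (step k \<sigma>)
  have "young_action n (adj_transp k \<circ> (\<sigma> \<circ> \<tau>)) f = young_action n (adj_transp k \<circ> \<sigma>) (young_action n \<tau> f)"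
    using step(4) by (simp only: young_action_step[OF permutes_compose[OF assms(2) step(3)] step(1,2)]
        young_action_step[OF step(3) step(1,2)])
  thus ?case unfolding comp_assoc .
qed

lemma young_action_extend:
  assumes h: "h permutes {1..m}" and b: "b \<in> addable Y" and "R \<in> SYT_shape m Y"
  shows "young_action (Suc m) h f (R(b := Suc m)) = young_action m h (\<lambda>R. f (R(b := Suc m))) R"
  using h assms(3)
proof (induction arbitrary: R rule: permutes_adj_transp_induct)
  case id
  show ?case unfolding young_action_id by simp
next
  case (step k h)
  let ?up = "\<lambda>R. R(b := Suc m)"
  note R = \<open>R \<in> SYT_shape m Y\<close>
  note RS = SYT_shapeD(1)[OF R] and upS = SYT_shapeD(1)[OF SYT_shape_extend[OF R b]]
  have "young_action (Suc m) (adj_transp k \<circ> h) f (?up R) = young_op k (young_action (Suc m) h f) (?up R)"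
    using step(1,2) upS by (simp add: young_action_step[OF permutes_Suc[OF step(3)]] young_op_on_SYT)
  also have "\<dots> = young_op k (\<lambda>R. young_action (Suc m) h f (?up R)) R"
    by (simp only: young_op_def axial_step_extend[OF R b step(1,2)] adj_transp_extend[OF step(2)])
  also have "\<dots> = young_op k (young_action m h (\<lambda>R. f (?up R))) R"
    by (rule young_op_cong[OF RS step(1,2)], rule step.IH) (use R in \<open>simp add: SYT_shape_def\<close>)
  also have "\<dots> = young_action m (adj_transp k \<circ> h) (\<lambda>R. f (?up R)) R"
    using step(1,2) RS by (simp add: young_action_step[OF step(3)] young_op_on_SYT)
  finally show ?case .
qed

subsection \<open>Matrix coefficients\<close>

definition delta :: "tableau \<Rightarrow> tableau \<Rightarrow> real" where
  "delta T = (\<lambda>S. if S = T then 1 else 0)"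

definition young_coeff :: "nat \<Rightarrow> (nat \<Rightarrow> nat) \<Rightarrow> tableau \<Rightarrow> tableau \<Rightarrow> real" where
  "young_coeff n \<sigma> S T = young_action n \<sigma> (delta T) S"

lemma young_coeff_id: "young_coeff n id S T = (if S = T then 1 else 0)"
  by (simp add: young_coeff_def young_action_id delta_def)

lemma young_coeff_step:
  "\<sigma> permutes {1..n} \<Longrightarrow> 1 \<le> k \<Longrightarrow> k < n \<Longrightarrow> S \<in> SYT n \<Longrightarrow>
    young_coeff n (adj_transp k \<circ> \<sigma>) S T = young_op k (\<lambda>S. young_coeff n \<sigma> S T) S"
  by (simp add: young_coeff_def[abs_def] young_action_step young_op_on_SYT)

lemma young_coeff_adj_transp:
  assumes "1 \<le> k" "k < n" "S \<in> SYT n"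
  shows "young_coeff n (adj_transp k) S T = (if S = T then 1 / of_int (axial_step T k) else 0) +
    (if S = adj_transp k \<circ> T then swap_weight (axial_step T k) else 0)"
  using adj_transp_comp_neq[OF assms(3,1,2)] adj_transp_comp_eq_iff[of k S T] assms
  by (auto simp: young_coeff_def young_action_adj_transp young_op_on_SYT young_op_def
    delta_def adj_transp_comp_self)

lemma young_coeff_adj_transp_sym:
  assumes "1 \<le> k" "k < n" "S \<in> SYT n" "T \<in> SYT n"
  shows "young_coeff n (adj_transp k) S T = young_coeff n (adj_transp k) T S"
  using adj_transp_comp_eq_iff[of k S T] assms by (auto simp: young_coeff_adj_transp)

locale tableau_family =
  fixes n :: nat and \<T> :: "tableau set"
  assumes finite_family: "finite \<T>"
    and family_SYT: "T \<in> \<T> \<Longrightarrow> T \<in> SYT n"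
    and family_shape_closed: "T \<in> \<T> \<Longrightarrow> SYT_shape n (shape T) \<subseteq> \<T>"

lemma tableau_family_SYT_shape: "tableau_family n (SYT_shape n Y)"
  by unfold_locales (rule finite_SYT_shape, auto simp: SYT_shape_def)

context tableau_family
begin

lemma family_swap: "S \<in> \<T> \<Longrightarrow> 1 \<le> k \<Longrightarrow> adj_transp k \<circ> S \<in> SYT n \<Longrightarrow> adj_transp k \<circ> S \<in> \<T>"
  using family_shape_closed[of S] SYT_shape_adj_transp[OF SYT_shapeI[OF family_SYT], of S k] by blast

lemma young_op_sum:
  assumes S: "S \<in> \<T>" and k: "1 \<le> k" "k < n"
  shows "young_op k (\<lambda>S. \<Sum>U\<in>\<T>. K S U * f U) S = (\<Sum>U\<in>\<T>. young_op k (\<lambda>S. K S U) S * f U)"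
  by (simp add: young_op_def sum_divide_distrib sum_distrib_left sum.distrib distrib_right mult.assoc)

lemma young_action_expand:
  assumes "\<sigma> permutes {1..n}" "S \<in> \<T>"
  shows "young_action n \<sigma> f S = (\<Sum>U\<in>\<T>. young_coeff n \<sigma> S U * f U)"
  using assms
proof (induction arbitrary: S rule: permutes_adj_transp_induct)
  case id
  have "(\<Sum>U\<in>\<T>. (if S = U then 1 else 0) * f U) = (\<Sum>U\<in>\<T>. if S = U then f U else 0)"
    by (intro sum.cong) auto
  thus ?case unfolding young_action_id young_coeff_id using id finite_family by simp
next
  case (step k \<sigma>)
  note S = family_SYT[OF \<open>S \<in> \<T>\<close>]
  have "young_action n (adj_transp k \<circ> \<sigma>) f S = young_op k (young_action n \<sigma> f) S"
    by (simp only: young_action_step[OF step(3,1,2)] young_op_on_SYT[OF S])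
  also have "\<dots> = young_op k (\<lambda>S. \<Sum>U\<in>\<T>. young_coeff n \<sigma> S U * f U) S"
    using family_shape_closed[OF step.prems] by (intro young_op_cong[OF S step(1,2)] step.IH) blast
  also have "\<dots> = (\<Sum>U\<in>\<T>. young_coeff n (adj_transp k \<circ> \<sigma>) S U * f U)"
    unfolding young_op_sum[OF step.prems step(1,2)] young_coeff_step[OF step(3,1,2) S] ..
  finally show ?case .
qed

lemma young_coeff_comp:
  assumes "\<sigma> permutes {1..n}" "\<tau> permutes {1..n}" "S \<in> \<T>"
  shows "young_coeff n (\<sigma> \<circ> \<tau>) S T = (\<Sum>U\<in>\<T>. young_coeff n \<sigma> S U * young_coeff n \<tau> U T)"
  using young_action_expand[OF assms(1,3), of "young_action n \<tau> (delta T)"]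
  unfolding young_coeff_def[of n "\<sigma> \<circ> \<tau>"] young_action_comp[OF assms(1,2)] young_coeff_def[of n \<tau>] .

lemma young_coeff_inv:
  assumes "\<sigma> permutes {1..n}" "S \<in> \<T>" "T \<in> \<T>"
  shows "young_coeff n (inv' \<sigma>) S T = young_coeff n \<sigma> T S"
  using assms
proof (induction arbitrary: S T rule: permutes_adj_transp_induct)
  case id
  show ?case unfolding inv_id by (simp only: young_coeff_id eq_commute)
next
  case (step k \<sigma>)
  note k = adj_transp_permutes[OF step(1,2)]
  have "young_coeff n (inv' (adj_transp k \<circ> \<sigma>)) S T =
      (\<Sum>U\<in>\<T>. young_coeff n (inv' \<sigma>) S U * young_coeff n (adj_transp k) U T)"
    unfolding inv_adj_transp_comp[OF step(3)]
    by (rule young_coeff_comp[OF permutes_inv[OF step(3)] k step(5)])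
  also have "\<dots> = (\<Sum>U\<in>\<T>. young_coeff n (adj_transp k) T U * young_coeff n \<sigma> U S)"
    using step young_coeff_adj_transp_sym[OF step(1,2) family_SYT family_SYT, of _ T]
    by (intro sum.cong) simp_all
  also have "\<dots> = young_coeff n (adj_transp k \<circ> \<sigma>) T S"
    by (rule young_coeff_comp[symmetric, OF k step(3) step(6)])
  finally show ?case .
qed

end

lemma young_coeff_shape_neq:
  assumes "\<sigma> permutes {1..n}" "S \<in> SYT n" "shape S \<noteq> shape T"
  shows "young_coeff n \<sigma> S T = 0"
proof -
  have "young_coeff n \<sigma> S T = (\<Sum>U\<in>SYT_shape n (shape S). young_coeff n \<sigma> S U * delta T U)"
    unfolding young_coeff_def[of n \<sigma> S T]
    by (rule tableau_family.young_action_expand[OF tableau_family_SYT_shape assms(1) SYT_shapeI[OF assms(2)]])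
  also have "\<dots> = 0" using assms(3) by (intro sum.neutral) (auto simp: delta_def SYT_shape_def)
  finally show ?thesis .
qed

lemma young_coeff_extend:
  assumes h: "h permutes {1..m}" and b: "b \<in> addable Y" and R: "R \<in> SYT_shape m Y"
  shows "young_coeff (Suc m) h (R(b := Suc m)) T =
    (\<Sum>R'\<in>SYT_shape m Y. young_coeff m h R R' * (if T = R'(b := Suc m) then 1 else 0))"
  unfolding young_coeff_def[of "Suc m"] young_action_extend[OF h b R]
    tableau_family.young_action_expand[OF tableau_family_SYT_shape h R]
  by (intro sum.cong) (auto simp: delta_def)

section \<open>Schur's lemma for Young's orthogonal form\<close>

text \<open>A kernel commuting with the generators commutes with the Jucys-Murphy elements, that is, with
  multiplication by contents. As contents separate tableaux, it is diagonal; and as tableaux of one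
  shape are connected by admissible swaps, its diagonal is constant on shapes.\<close>

locale commuting_kernel = tableau_family +
  fixes q :: "tableau \<Rightarrow> tableau \<Rightarrow> real"
  assumes commutes: "\<And>k S T. 1 \<le> k \<Longrightarrow> k < n \<Longrightarrow> S \<in> \<T> \<Longrightarrow> T \<in> \<T> \<Longrightarrow>
    (\<Sum>U\<in>\<T>. young_coeff n (adj_transp k) S U * q U T) = (\<Sum>U\<in>\<T>. q S U * young_coeff n (adj_transp k) U T)"
begin

definition kernel_op :: "(tableau \<Rightarrow> real) \<Rightarrow> tableau \<Rightarrow> real" where
  "kernel_op f S = (\<Sum>T\<in>\<T>. q S T * f T)"

lemma kernel_op_cong: "(\<And>T. T \<in> \<T> \<Longrightarrow> f T = g T) \<Longrightarrow> kernel_op f S = kernel_op g S"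
  by (simp add: kernel_op_def)

lemma kernel_op_add: "kernel_op (\<lambda>T. f T + g T) S = kernel_op f S + kernel_op g S"
  by (simp add: kernel_op_def distrib_left sum.distrib)

lemma young_op_expand:
  "1 \<le> k \<Longrightarrow> k < n \<Longrightarrow> S \<in> \<T> \<Longrightarrow> young_op k f S = (\<Sum>U\<in>\<T>. young_coeff n (adj_transp k) S U * f U)"
  using young_action_expand[OF adj_transp_permutes, of k S f]
  by (simp add: young_action_adj_transp young_op_on_SYT family_SYT)

lemma kernel_op_young_op:
  assumes k: "1 \<le> k" "k < n" and S: "S \<in> \<T>"
  shows "kernel_op (young_op k f) S = young_op k (kernel_op f) S"
proof -
  have "kernel_op (young_op k f) S = (\<Sum>T\<in>\<T>. \<Sum>U\<in>\<T>. q S T * young_coeff n (adj_transp k) T U * f U)"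
    unfolding kernel_op_def
    by (intro sum.cong) (simp_all add: young_op_expand[OF k] sum_distrib_left mult.assoc)
  also have "\<dots> = (\<Sum>U\<in>\<T>. (\<Sum>T\<in>\<T>. q S T * young_coeff n (adj_transp k) T U) * f U)"
    by (subst sum.swap) (simp add: sum_distrib_right)
  also have "\<dots> = (\<Sum>U\<in>\<T>. (\<Sum>T\<in>\<T>. young_coeff n (adj_transp k) S T * q T U) * f U)"
    using commutes[OF k S] by simp
  also have "\<dots> = (\<Sum>T\<in>\<T>. \<Sum>U\<in>\<T>. young_coeff n (adj_transp k) S T * q T U * f U)"
    by (subst sum.swap) (simp add: sum_distrib_right)
  also have "\<dots> = young_op k (kernel_op f) S"
    unfolding young_op_expand[OF k S] kernel_op_def by (simp add: sum_distrib_left mult.assoc)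
  finally show ?thesis .
qed

lemma kernel_op_content:
  assumes "1 \<le> k" "k \<le> n" "S \<in> \<T>"
  shows "kernel_op (\<lambda>T. of_int (content T k) * f T) S = of_int (content S k) * kernel_op f S"
  using assms
proof (induction k arbitrary: f S rule: nat_induct_at_least)
  case base
  have "content T 1 = 0" if "T \<in> \<T>" for T using content_one[OF family_SYT[OF that] base(1)] .
  thus ?case using base(2) by (simp add: kernel_op_def)
next
  case (Suc k)
  have k: "1 \<le> k" "k < n" using Suc.hyps Suc.prems(1) by simp_all
  note S = \<open>S \<in> \<T>\<close>
  let ?X = "\<lambda>k f T. of_int (content T k) * f T"
  have "kernel_op (?X (Suc k) f) S = kernel_op (\<lambda>T. young_op k (?X k (young_op k f)) T + young_op k f T) S"
    by (intro kernel_op_cong) (simp add: young_op_content[OF family_SYT k])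
  also have "\<dots> = young_op k (kernel_op (?X k (young_op k f))) S + young_op k (kernel_op f) S"
    by (simp add: kernel_op_add kernel_op_young_op[OF k S])
  also have "young_op k (kernel_op (?X k (young_op k f))) S = young_op k (?X k (young_op k (kernel_op f))) S"
  proof (rule young_op_cong[OF family_SYT[OF S] k])
    fix U assume "U \<in> SYT_shape n (shape S)"
    hence "U \<in> \<T>" using family_shape_closed[OF S] by blast
    thus "kernel_op (?X k (young_op k f)) U = ?X k (young_op k (kernel_op f)) U"
      using Suc.IH k(2) by (simp add: kernel_op_young_op[OF k])
  qed
  also have "\<dots> + young_op k (kernel_op f) S = ?X (Suc k) (kernel_op f) S"
    by (rule young_op_content[OF family_SYT[OF S] k])
  finally show ?case .
qed

lemma kernel_diagonal:
  assumes "S \<in> \<T>" "T \<in> \<T>" "S \<noteq> T"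
  shows "q S T = 0"
proof -
  obtain k where k: "1 \<le> k" "k \<le> n" "content S k \<noteq> content T k"
    using SYT_content_inj[OF family_SYT[OF assms(1)] family_SYT[OF assms(2)]] assms(3) by blast
  have "kernel_op (\<lambda>U. g U * delta T U) S = q S T * g T" for g
    unfolding kernel_op_def delta_def using assms(2) finite_family by (simp add: if_distrib cong: if_cong)
  from this[of "\<lambda>U. of_int (content U k)"] this[of "\<lambda>_. 1"]
  have "q S T * of_int (content T k) = of_int (content S k) * q S T"
    using kernel_op_content[OF k(1,2) assms(1), of "delta T"] by auto
  thus ?thesis using k(3) by (simp add: mult.commute)
qed

lemma kernel_op_diagonal:
  assumes "S \<in> \<T>"
  shows "kernel_op f S = q S S * f S"
proof -
  have "kernel_op f S = (\<Sum>T\<in>\<T>. if T = S then q S S * f S else 0)"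
    unfolding kernel_op_def using kernel_diagonal[OF assms] by (intro sum.cong) auto
  thus ?thesis using assms finite_family by simp
qed

lemma kernel_constant_on_shape:
  assumes "S \<in> \<T>" "T \<in> SYT_shape n (shape S)"
  shows "q S S = q T T"
proof (rule SYT_shape_connected[OF _ SYT_shapeI[OF family_SYT[OF assms(1)]] assms(2)])
  fix U k
  assume U: "U \<in> SYT_shape n (shape S)" "adj_transp k \<circ> U \<in> SYT_shape n (shape S)"
    and k: "1 \<le> k" "k < n" and far: "2 \<le> \<bar>axial_step U k\<bar>"
  let ?V = "adj_transp k \<circ> U"
  have family: "U \<in> \<T>" "?V \<in> \<T>" using family_shape_closed[OF assms(1)] U by auto
  have "?V \<noteq> U" by (rule adj_transp_comp_neq[OF family_SYT[OF family(1)] k])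
  moreover have "q U U * young_op k (delta ?V) U = young_op k (kernel_op (delta ?V)) U"
    using kernel_op_young_op[OF k family(1)] kernel_op_diagonal[OF family(1)] by simp
  ultimately show "q ?V ?V = q U U"
    using kernel_op_diagonal[OF family(1)] kernel_op_diagonal[OF family(2)] swap_weight_nonzero[OF far]
    by (simp add: young_op_def delta_def)
qed

end

section \<open>Matrices\<close>

subsection \<open>Matrices indexed by finite sets\<close>

definition kernel_mat :: "'i set \<Rightarrow> 'j set \<Rightarrow> ('i \<Rightarrow> 'j \<Rightarrow> 'a) \<Rightarrow> 'a mat" where
  "kernel_mat A B K = mat (card A) (card B) (\<lambda>(i, j). K (from_nat_into A i) (from_nat_into B j))"

lemma mat_on_eq_kernel_mat: "mat_on A B K = kernel_mat A B K"
  by (simp add: mat_on_def kernel_mat_def)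

lemma kernel_mat_carrier [simp]: "kernel_mat A B K \<in> carrier_mat (card A) (card B)"
  by (simp add: kernel_mat_def)

lemma from_nat_into_card: "i < card A \<Longrightarrow> from_nat_into A i \<in> A"
  by (metis card.empty from_nat_into not_less_zero)

lemma kernel_mat_cong:
  "(\<And>a b. a \<in> A \<Longrightarrow> b \<in> B \<Longrightarrow> K a b = K' a b) \<Longrightarrow> kernel_mat A B K = kernel_mat A B K'"
  unfolding kernel_mat_def by (intro cong_mat) (auto simp: from_nat_into_card)

lemma to_nat_on_less_card: "finite A \<Longrightarrow> a \<in> A \<Longrightarrow> to_nat_on A a < card A"
  using to_nat_on_finite[of A] by (auto simp: bij_betw_def)

lemma kernel_mat_index:
  "finite A \<Longrightarrow> finite B \<Longrightarrow> a \<in> A \<Longrightarrow> b \<in> B \<Longrightarrow> kernel_mat A B K $$ (to_nat_on A a, to_nat_on B b) = K a b"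
  by (simp add: kernel_mat_def to_nat_on_less_card countable_finite)

lemma kernel_mat_eq_iff:
  assumes "finite A" "finite B"
  shows "kernel_mat A B K = kernel_mat A B K' \<longleftrightarrow> (\<forall>a\<in>A. \<forall>b\<in>B. K a b = K' a b)"
  using kernel_mat_index[OF assms] kernel_mat_cong by metis

lemma sum_from_nat_into: "finite A \<Longrightarrow> (\<Sum>i = 0..<card A. f (from_nat_into A i)) = sum f A"
  using sum.reindex_bij_betw[OF bij_betw_from_nat_into_finite, of A f] by (simp add: lessThan_atLeast0)

lemma kernel_mat_mult:
  fixes K :: "'i \<Rightarrow> 'j \<Rightarrow> 'a::comm_ring_1"
  assumes "finite B"
  shows "kernel_mat A B K * kernel_mat B C M = kernel_mat A C (\<lambda>a c. \<Sum>b\<in>B. K a b * M b c)"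
  by (rule eq_matI)
    (auto simp: kernel_mat_def scalar_prod_def sum_from_nat_into[OF assms, of "\<lambda>b. K _ b * M b _"])

lemma one_mat_eq_kernel_mat:
  assumes "finite A"
  shows "1\<^sub>m (card A) = kernel_mat A A (\<lambda>a b. if a = b then 1 else 0 :: 'a::comm_ring_1)"
proof (rule eq_matI)
  fix i j assume "i < dim_row (kernel_mat A A (\<lambda>a b. if a = b then 1 else 0 :: 'a))"
    "j < dim_col (kernel_mat A A (\<lambda>a b. if a = b then 1 else 0 :: 'a))"
  moreover have "inj_on (from_nat_into A) {..<card A}"
    using bij_betw_from_nat_into_finite[OF assms] by (simp add: bij_betw_def)
  ultimately show "1\<^sub>m (card A) $$ (i, j) = kernel_mat A A (\<lambda>a b. if a = b then 1 else 0) $$ (i, j)"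
    by (auto simp: kernel_mat_def inj_on_def)
qed (simp_all add: kernel_mat_def)

lemma smult_one_mat_eq_kernel_mat:
  "finite A \<Longrightarrow> c \<cdot>\<^sub>m 1\<^sub>m (card A) = kernel_mat A A (\<lambda>a b. if a = b then c else 0 :: 'a::comm_ring_1)"
  unfolding one_mat_eq_kernel_mat by (rule eq_matI) (auto simp: kernel_mat_def)

lemma map_mat_kernel_mat: "map_mat f (kernel_mat A B K) = kernel_mat A B (\<lambda>a b. f (K a b))"
  by (rule eq_matI) (auto simp: kernel_mat_def)

subsection \<open>Products and adjoints\<close>

text \<open>The dimension conditions make these rules usable by the simplifier, unlike the library versions
  with \<open>carrier_mat\<close> premises that mention the inner dimension.\<close>

lemma mult_mat_assoc: "dim_col A = dim_row B \<Longrightarrow> dim_col B = dim_row C \<Longrightarrow> A * B * C = A * (B * C)"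
  for A :: "'a::semiring_0 mat"
  by (rule assoc_mult_mat[of A "dim_row A" "dim_col A" B "dim_col B" C "dim_col C"]) auto

lemma mult_smult_mat:
  "dim_col A = dim_row B \<Longrightarrow> (c \<cdot>\<^sub>m A) * B = c \<cdot>\<^sub>m (A * B)"
  "dim_col A = dim_row B \<Longrightarrow> A * (c \<cdot>\<^sub>m B) = c \<cdot>\<^sub>m (A * B)"
  for A :: "'a::comm_semiring_0 mat"
  by (auto intro: mult_smult_assoc_mat mult_smult_distrib)

lemma mult_mat_cancel:
  "P * Q = 1\<^sub>m k \<Longrightarrow> dim_col P = dim_row Q \<Longrightarrow> dim_col Q = dim_row X \<Longrightarrow> dim_row X = k \<Longrightarrow> P * (Q * X) = X"
  for X :: "'a::semiring_1 mat"
  by (simp add: mult_mat_assoc[symmetric])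

lemma mat_eq_on_vecs:
  fixes A :: "'a::semiring_1 mat"
  assumes "A \<in> carrier_mat N r" "B \<in> carrier_mat N r"
    and eq: "\<And>v. v \<in> carrier_vec r \<Longrightarrow> A *\<^sub>v v = B *\<^sub>v v"
  shows "A = B"
proof (rule eq_matI)
  fix i j assume ij: "i < dim_row B" "j < dim_col B"
  have "X $$ (i, j) = (X *\<^sub>v unit_vec r j) $ i" if "X \<in> carrier_mat N r" for X :: "'a mat"
    using that ij assms(2) scalar_prod_right_unit[of j r "row X i"] by auto
  thus "A $$ (i, j) = B $$ (i, j)" using assms(1,2) eq[of "unit_vec r j"] by simp
qed (use assms in auto)

lemma mat_adjoint_eq_mat:
  "mat_adjoint M = mat (dim_col M) (dim_row M) (\<lambda>(i, j). conjugate (M $$ (j, i)))"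
  by (rule eq_matI) (auto simp: mat_adjoint_def mat_of_rows_def)

lemma adjoint_dim [simp]: "dim_row (mat_adjoint A) = dim_col A" "dim_col (mat_adjoint A) = dim_row A"
  by (auto simp: mat_adjoint_eq_mat)

lemma adjoint_carrier [simp]: "A \<in> carrier_mat a b \<Longrightarrow> mat_adjoint A \<in> carrier_mat b a"
  by (auto simp: mat_adjoint_eq_mat)

lemma adjoint_adjoint [simp]: "mat_adjoint (mat_adjoint A) = A"
  by (rule eq_matI) (auto simp: mat_adjoint_eq_mat)

lemma adjoint_mult:
  assumes "dim_col A = dim_row B"
  shows "mat_adjoint (A * B) = mat_adjoint B * mat_adjoint A"
proof (rule eq_matI)
  fix i j assume "i < dim_row (mat_adjoint B * mat_adjoint A)" "j < dim_col (mat_adjoint B * mat_adjoint A)"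
  hence ij: "i < dim_col B" "j < dim_row A" by auto
  have "mat_adjoint (A * B) $$ (i, j) = conjugate (\<Sum>k = 0..<dim_row B. A $$ (j, k) * B $$ (k, i))"
    using ij assms by (auto simp: mat_adjoint_eq_mat scalar_prod_def)
  also have "\<dots> = (\<Sum>k = 0..<dim_row B. conjugate (B $$ (k, i)) * conjugate (A $$ (j, k)))"
    by (simp add: sum_conjugate conjugate_dist_mul mult.commute)
  also have "\<dots> = (mat_adjoint B * mat_adjoint A) $$ (i, j)"
    using ij assms by (auto simp: mat_adjoint_eq_mat scalar_prod_def)
  finally show "mat_adjoint (A * B) $$ (i, j) = (mat_adjoint B * mat_adjoint A) $$ (i, j)" .
qed auto

lemma conjugate_one [simp]: "conjugate (1 :: 'a :: conjugatable_field) = 1"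
proof -
  have "conjugate (1 :: 'a) * conjugate 1 = conjugate 1" by (simp flip: conjugate_dist_mul)
  moreover have "conjugate (1 :: 'a) \<noteq> 0" by simp
  ultimately show ?thesis by simp
qed

lemma adjoint_one [simp]: "mat_adjoint (1\<^sub>m n :: 'a :: conjugatable_field mat) = 1\<^sub>m n"
  by (rule eq_matI) (auto simp: mat_adjoint_eq_mat)

lemma adjoint_kernel_mat: "mat_adjoint (kernel_mat A B K) = kernel_mat B A (\<lambda>b a. conjugate (K a b))"
  by (rule eq_matI) (auto simp: mat_adjoint_eq_mat kernel_mat_def)

subsection \<open>Sums of matrices\<close>

definition mat_sum :: "nat \<Rightarrow> 'k set \<Rightarrow> ('k \<Rightarrow> 'a::comm_ring_1 mat) \<Rightarrow> 'a mat" where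
  "mat_sum N K P = mat N N (\<lambda>(i, j). \<Sum>k\<in>K. P k $$ (i, j))"

lemma mat_sum_carrier [simp]: "mat_sum N K P \<in> carrier_mat N N"
  by (simp add: mat_sum_def)

lemma mat_sum_dim [simp]: "dim_row (mat_sum N K P) = N" "dim_col (mat_sum N K P) = N"
  by (simp_all add: mat_sum_def)

lemma mat_sum_cong: "(\<And>k. k \<in> K \<Longrightarrow> P k = P' k) \<Longrightarrow> mat_sum N K P = mat_sum N K P'"
  by (simp add: mat_sum_def cong: sum.cong)

lemma mat_sum_kernel_mat:
  "mat_sum (card A) K (\<lambda>k. kernel_mat A A (P k)) = kernel_mat A A (\<lambda>a b. \<Sum>k\<in>K. P k a b)"
  by (rule eq_matI) (auto simp: mat_sum_def kernel_mat_def)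

lemma mat_sum_sandwich:
  fixes P :: "'k \<Rightarrow> 'a::comm_ring_1 mat"
  assumes "A \<in> carrier_mat N' N" "B \<in> carrier_mat N N'" "\<And>k. k \<in> K \<Longrightarrow> P k \<in> carrier_mat N N"
  shows "A * mat_sum N K P * B = mat_sum N' K (\<lambda>k. A * P k * B)"
proof (rule eq_matI)
  fix i j assume "i < dim_row (mat_sum N' K (\<lambda>k. A * P k * B))" "j < dim_col (mat_sum N' K (\<lambda>k. A * P k * B))"
  hence ij: "i < N'" "j < N'" by simp_all
  have entry: "(A * X * B) $$ (i, j) = (\<Sum>b<N. \<Sum>a<N. A $$ (i, a) * X $$ (a, b) * B $$ (b, j))"
    if "X \<in> carrier_mat N N" for X
    unfolding lessThan_atLeast0 using assms(1,2) ij that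
    by (auto simp del: assoc_mult_mat simp: scalar_prod_def sum_distrib_right intro!: sum.cong)
  have "(A * mat_sum N K P * B) $$ (i, j) =
      (\<Sum>b<N. \<Sum>a<N. \<Sum>k\<in>K. A $$ (i, a) * P k $$ (a, b) * B $$ (b, j))"
    unfolding entry[OF mat_sum_carrier]
    by (intro sum.cong) (auto simp: mat_sum_def sum_distrib_left sum_distrib_right)
  also have "\<dots> = (\<Sum>b<N. \<Sum>k\<in>K. \<Sum>a<N. A $$ (i, a) * P k $$ (a, b) * B $$ (b, j))"
    by (intro sum.cong[OF refl] sum.swap)
  also have "\<dots> = (\<Sum>k\<in>K. \<Sum>b<N. \<Sum>a<N. A $$ (i, a) * P k $$ (a, b) * B $$ (b, j))"
    by (rule sum.swap)
  also have "\<dots> = mat_sum N' K (\<lambda>k. A * P k * B) $$ (i, j)"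
    using ij entry[OF assms(3)] by (simp add: mat_sum_def)
  finally show "(A * mat_sum N K P * B) $$ (i, j) = mat_sum N' K (\<lambda>k. A * P k * B) $$ (i, j)" .
qed (use assms in auto)

subsection \<open>Isometries and compressions\<close>

definition isometry_mat :: "nat \<Rightarrow> nat \<Rightarrow> 'a::conjugatable_field mat \<Rightarrow> bool" where
  "isometry_mat N r A \<longleftrightarrow> A \<in> carrier_mat N r \<and> mat_adjoint A * A = 1\<^sub>m r"

definition compress :: "'a::conjugatable_field mat \<Rightarrow> 'a mat \<Rightarrow> 'a mat \<Rightarrow> 'a mat" where
  "compress E F X = mat_adjoint E * X * F"

definition intertwines :: "'a::conjugatable_field mat \<Rightarrow> 'a mat \<Rightarrow> 'a mat \<Rightarrow> bool" where
  "intertwines E F X \<longleftrightarrow> E * mat_adjoint E * X = X * (F * mat_adjoint F)"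

lemma isometry_mat_dim: "isometry_mat N r A \<Longrightarrow> dim_row A = N" "isometry_mat N r A \<Longrightarrow> dim_col A = r"
  by (auto simp: isometry_mat_def)

lemma isometry_mat_cancel: "isometry_mat N r A \<Longrightarrow> dim_row X = r \<Longrightarrow> mat_adjoint A * (A * X) = X"
  by (auto simp: isometry_mat_def intro: mult_mat_cancel)

lemma isometry_mat_mult:
  assumes "isometry_mat N k A" "isometry_mat k r B"
  shows "isometry_mat N r (A * B)"
  using assms isometry_mat_cancel[OF assms(1), of B] isometry_mat_dim[OF assms(1)] isometry_mat_dim[OF assms(2)]
  by (auto simp: isometry_mat_def adjoint_mult mult_mat_assoc intro: mult_carrier_mat)

lemma unitary_mat_isometry: "unitary_mat r U \<Longrightarrow> isometry_mat r r U"
  "unitary_mat r U \<Longrightarrow> isometry_mat r r (mat_adjoint U)"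
  by (auto simp: unitary_mat_def isometry_mat_def)

lemma isometry_mat_square: "isometry_mat r r U \<Longrightarrow> unitary_mat r U"
  using mat_mult_left_right_inverse[of "mat_adjoint U" r U] by (auto simp: unitary_mat_def isometry_mat_def)

lemma mat_image_mult:
  assumes "A \<in> carrier_mat a b" "B \<in> carrier_mat b c"
  shows "mat_image (A * B) (carrier_vec c) = mat_image A (mat_image B (carrier_vec c))"
  unfolding mat_image_def image_image
  by (rule image_cong[OF refl]) (use assms in \<open>simp add: assoc_mult_mat_vec\<close>)

lemma mat_image_unitary:
  assumes "unitary_mat r U"
  shows "mat_image U (carrier_vec r) = carrier_vec r"
proof
  have U: "U \<in> carrier_mat r r" "U * mat_adjoint U = 1\<^sub>m r" using assms by (auto simp: unitary_mat_def)
  thus "mat_image U (carrier_vec r) \<subseteq> carrier_vec r" by (auto simp: mat_image_def)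
  show "carrier_vec r \<subseteq> mat_image U (carrier_vec r)"
  proof
    fix v :: "'a vec" assume v: "v \<in> carrier_vec r"
    hence "v = U *\<^sub>v (mat_adjoint U *\<^sub>v v)"
      using assoc_mult_mat_vec[OF U(1) adjoint_carrier[OF U(1)] v] U(2) by simp
    thus "v \<in> mat_image U (carrier_vec r)"
      unfolding mat_image_def by (rule image_eqI[OF _ mult_mat_vec_carrier[OF adjoint_carrier[OF U(1)] v]])
  qed
qed

lemma orthogonal_projection_isometry:
  assumes "isometry_mat N r A"
  shows "orthogonal_projection N (A * mat_adjoint A) (mat_image A (carrier_vec r))"
proof -
  have A: "A \<in> carrier_mat N r" "mat_adjoint A * A = 1\<^sub>m r" using assms by (auto simp: isometry_mat_def)
  note A' = adjoint_carrier[OF A(1)]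
  have "A *\<^sub>v v \<in> mat_image (A * mat_adjoint A) (carrier_vec N)" if v: "v \<in> carrier_vec r" for v
  proof -
    have "mat_adjoint A *\<^sub>v (A *\<^sub>v v) = v" using assoc_mult_mat_vec[OF A' A(1) v] A(2) v by simp
    hence "A *\<^sub>v v = A * mat_adjoint A *\<^sub>v (A *\<^sub>v v)"
      using assoc_mult_mat_vec[OF A(1) A', of "A *\<^sub>v v"] A(1) v by simp
    thus ?thesis unfolding mat_image_def using A(1) v by (intro image_eqI) auto
  qed
  hence "mat_image A (carrier_vec r) \<subseteq> mat_image (A * mat_adjoint A) (carrier_vec N)"
    by (auto simp: mat_image_def[of A])
  moreover have "mat_image (A * mat_adjoint A) (carrier_vec N) \<subseteq> mat_image A (carrier_vec r)"
    unfolding mat_image_mult[OF A(1) A'] using A' by (auto simp: mat_image_def)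
  moreover have "A * mat_adjoint A * (A * mat_adjoint A) = A * mat_adjoint A"
    using isometry_mat_dim[OF assms] by (simp add: mult_mat_assoc isometry_mat_cancel[OF assms])
  moreover have "mat_adjoint (A * mat_adjoint A) = A * mat_adjoint A" by (simp add: adjoint_mult)
  ultimately show ?thesis using A(1) A' by (auto simp: orthogonal_projection_def)
qed

lemma isometry_onto_iff: "isometry_onto N r A W \<longleftrightarrow> isometry_mat N r A \<and> mat_image A (carrier_vec r) = W"
  by (auto simp: isometry_onto_def isometry_mat_def)

lemma isometry_onto_unique:
  assumes A: "isometry_onto N r A W" and B: "isometry_onto N r B W"
  obtains U where "unitary_mat r U" "B = A * U"
proof -
  note isoA = A[unfolded isometry_onto_iff] and isoB = B[unfolded isometry_onto_iff]
  have carrier: "A \<in> carrier_mat N r" "B \<in> carrier_mat N r" using A B by (auto simp: isometry_onto_def)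
  define U where "U = mat_adjoint A * B"
  have U: "U \<in> carrier_mat r r" using carrier by (auto simp: U_def)
  have factor: "B = A * U"
  proof (rule mat_eq_on_vecs[OF carrier(2) mult_carrier_mat[OF carrier(1) U]])
    fix v :: "'a vec" assume v: "v \<in> carrier_vec r"
    hence "B *\<^sub>v v \<in> mat_image A (carrier_vec r)" using isoA isoB by (auto simp: mat_image_def)
    then obtain w where w: "w \<in> carrier_vec r" "B *\<^sub>v v = A *\<^sub>v w" by (auto simp: mat_image_def)
    have "U *\<^sub>v v = mat_adjoint A *\<^sub>v (A *\<^sub>v w)"
      unfolding U_def assoc_mult_mat_vec[OF adjoint_carrier[OF carrier(1)] carrier(2) v] w(2) ..
    also have "\<dots> = w"
      using assoc_mult_mat_vec[OF adjoint_carrier[OF carrier(1)] carrier(1) w(1)] isoA w(1)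
      by (simp add: isometry_mat_def)
    finally show "B *\<^sub>v v = A * U *\<^sub>v v"
      using assoc_mult_mat_vec[OF carrier(1) U v] w(2) by simp
  qed
  have "mat_adjoint U * U = mat_adjoint B * (A * U)"
    using carrier by (simp add: U_def adjoint_mult mult_mat_assoc)
  hence "mat_adjoint U * U = 1\<^sub>m r" using isoB by (simp add: isometry_mat_def flip: factor)
  hence "unitary_mat r U" using U by (intro isometry_mat_square) (simp add: isometry_mat_def)
  thus ?thesis using factor by (rule that)
qed

lemma gram_square_unitary:
  assumes U: "unitary_mat r U" and V: "unitary_mat r V" and B: "B \<in> carrier_mat r r"
  shows "mat_adjoint (U * B * V) * (U * B * V) = \<alpha> \<cdot>\<^sub>m 1\<^sub>m r \<longleftrightarrow> mat_adjoint B * B = \<alpha> \<cdot>\<^sub>m 1\<^sub>m r"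
proof -
  have scalar: "mat_adjoint (U * B * V) * (U * B * V) = \<alpha> \<cdot>\<^sub>m 1\<^sub>m r"
    if U: "unitary_mat r U" and V: "unitary_mat r V" and B: "B \<in> carrier_mat r r"
      and square: "mat_adjoint B * B = \<alpha> \<cdot>\<^sub>m 1\<^sub>m r" for U V B
  proof -
    note isoU = unitary_mat_isometry(1)[OF U] and isoV = unitary_mat_isometry(1)[OF V]
    note dims = isometry_mat_dim[OF isoU] isometry_mat_dim[OF isoV] carrier_matD[OF B]
    have "mat_adjoint (U * B * V) * (U * B * V) = mat_adjoint V * ((mat_adjoint B * B) * V)"
      using dims by (simp add: adjoint_mult mult_mat_assoc isometry_mat_cancel[OF isoU])
    thus ?thesis
      using isoV dims unfolding square by (simp add: mult_smult_mat isometry_mat_def)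
  qed
  have dims: "dim_row U = r" "dim_col U = r" "dim_row V = r" "dim_col V = r" "dim_row B = r" "dim_col B = r"
    using assms by (auto simp: unitary_mat_def)
  have "mat_adjoint U * (U * B * V) * mat_adjoint V = B"
    using U V dims
    by (simp add: mult_mat_assoc unitary_mat_def mult_mat_cancel[of _ _ r])
  thus ?thesis
    using scalar[OF U V B] scalar[of "mat_adjoint U" "mat_adjoint V" "U * B * V"] U V B
    by (auto simp: unitary_mat_def)
qed

lemma equi_isoclinic_iff:
  assumes M: "\<And>k. k \<in> {1..n} \<Longrightarrow> isometry_onto N r (M k) (W k)"
  shows "equi_isoclinic n r N W \<longleftrightarrow> (\<exists>\<alpha>. \<forall>k\<in>{1..n}. \<forall>l\<in>{1..n}. k \<noteq> l \<longrightarrow>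
    mat_adjoint (mat_adjoint (M k) * M l) * (mat_adjoint (M k) * M l) = \<alpha> \<cdot>\<^sub>m 1\<^sub>m r)"
    (is "_ \<longleftrightarrow> ?scalar M")
proof
  assume "equi_isoclinic n r N W"
  then obtain \<Phi> where "(\<forall>k\<in>{1..n}. isometry_onto N r (\<Phi> k) (W k)) \<and> ?scalar \<Phi>"
    unfolding equi_isoclinic_def ..
  hence \<Phi>: "\<forall>k\<in>{1..n}. isometry_onto N r (\<Phi> k) (W k)" and scalar: "?scalar \<Phi>" by blast+
  have "\<exists>U. unitary_mat r U \<and> M k = \<Phi> k * U" if "k \<in> {1..n}" for k
    using isometry_onto_unique[OF bspec[OF \<Phi> that] M[OF that]] by blast
  then obtain U where U: "\<And>k. k \<in> {1..n} \<Longrightarrow> unitary_mat r (U k) \<and> M k = \<Phi> k * U k" by metis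
  have "mat_adjoint (mat_adjoint (M k) * M l) * (mat_adjoint (M k) * M l) = \<alpha> \<cdot>\<^sub>m 1\<^sub>m r \<longleftrightarrow>
      mat_adjoint (mat_adjoint (\<Phi> k) * \<Phi> l) * (mat_adjoint (\<Phi> k) * \<Phi> l) = \<alpha> \<cdot>\<^sub>m 1\<^sub>m r"
    if k: "k \<in> {1..n}" and l: "l \<in> {1..n}" for k l \<alpha>
  proof -
    have carrier: "\<Phi> k \<in> carrier_mat N r" "\<Phi> l \<in> carrier_mat N r" "U k \<in> carrier_mat r r" "U l \<in> carrier_mat r r"
      using bspec[OF \<Phi> k] bspec[OF \<Phi> l] U[OF k] U[OF l] by (auto simp: isometry_onto_def unitary_mat_def)
    hence gram: "mat_adjoint (M k) * M l = mat_adjoint (U k) * (mat_adjoint (\<Phi> k) * \<Phi> l) * U l"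
      using U[OF k] U[OF l] by (simp add: adjoint_mult mult_mat_assoc)
    have "unitary_mat r (mat_adjoint (U k))" "unitary_mat r (U l)"
      using U[OF k] U[OF l] by (auto simp: unitary_mat_def)
    moreover have "mat_adjoint (\<Phi> k) * \<Phi> l \<in> carrier_mat r r" using carrier by auto
    ultimately show ?thesis unfolding gram by (rule gram_square_unitary)
  qed
  thus "?scalar M" using scalar by blast
next
  assume "?scalar M"
  thus "equi_isoclinic n r N W" unfolding equi_isoclinic_def using M by blast
qed

lemma compress_carrier:
  "isometry_mat N r E \<Longrightarrow> isometry_mat M s F \<Longrightarrow> X \<in> carrier_mat N M \<Longrightarrow> compress E F X \<in> carrier_mat r s"
  by (auto simp: compress_def isometry_mat_def)

lemma compress_adjoint:
  "dim_row X = dim_row E \<Longrightarrow> dim_col X = dim_row F \<Longrightarrow> mat_adjoint (compress E F X) = compress F E (mat_adjoint X)"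
  by (simp add: compress_def adjoint_mult mult_mat_assoc)

lemma compress_smult_one:
  assumes "isometry_mat N r E"
  shows "compress E E (c \<cdot>\<^sub>m 1\<^sub>m N) = c \<cdot>\<^sub>m 1\<^sub>m r"
  using assms isometry_mat_dim[OF assms]
  by (simp add: compress_def mult_smult_mat isometry_mat_def)

lemma compress_one: "isometry_mat N r E \<Longrightarrow> compress E E (1\<^sub>m N) = 1\<^sub>m r"
  by (auto simp: compress_def isometry_mat_def)

lemma compress_mult:
  assumes "isometry_mat L t K" "intertwines F K Y"
    and dims: "dim_row X = dim_row E" "dim_col X = dim_row F" "dim_row Y = dim_row F" "dim_col Y = L"
  shows "compress E F X * compress F K Y = compress E K (X * Y)"
proof -
  note K = isometry_mat_dim[OF assms(1)]
  have "compress E F X * compress F K Y = mat_adjoint E * (X * ((F * mat_adjoint F * Y) * K))"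
    using dims K by (simp add: compress_def mult_mat_assoc)
  also have "\<dots> = compress E K (X * Y)"
    using dims K assms isometry_mat_cancel[OF assms(1)]
    by (simp add: intertwines_def compress_def mult_mat_assoc isometry_mat_def)
  finally show ?thesis .
qed

lemma intertwines_mult:
  assumes "intertwines E F X" "intertwines F K Y"
    and dims: "dim_row X = dim_row E" "dim_col X = dim_row F" "dim_row Y = dim_row F" "dim_col Y = dim_row K"
  shows "intertwines E K (X * Y)"
proof -
  have "E * mat_adjoint E * (X * Y) = (E * mat_adjoint E * X) * Y"
    using dims by (simp add: mult_mat_assoc)
  also have "\<dots> = X * (F * mat_adjoint F * Y)"
    using assms(1) dims by (simp add: intertwines_def mult_mat_assoc)
  also have "\<dots> = X * Y * (K * mat_adjoint K)"
    using assms(2) dims by (simp add: intertwines_def mult_mat_assoc)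
  finally show ?thesis by (simp add: intertwines_def)
qed

lemma intertwines_adjoint:
  assumes "intertwines E F X" "dim_row X = dim_row E" "dim_col X = dim_row F"
  shows "intertwines F E (mat_adjoint X)"
  using arg_cong[OF assms(1)[unfolded intertwines_def], of mat_adjoint] assms(2,3)
  by (simp add: intertwines_def adjoint_mult)

lemma isometry_mat_compress:
  assumes E: "isometry_mat N N' E" and F: "isometry_mat M M' F" and A: "isometry_mat N M A"
    and "intertwines E F A"
  shows "isometry_mat N' M' (compress E F A)"
proof -
  have "mat_adjoint (compress E F A) * compress E F A = compress F F (mat_adjoint A * A)"
    using assms isometry_mat_dim[OF E] isometry_mat_dim[OF F] isometry_mat_dim[OF A]
    by (simp add: compress_adjoint compress_mult[OF F])
  also have "\<dots> = 1\<^sub>m M'" using A compress_one[OF F] by (simp add: isometry_mat_def)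
  finally show ?thesis using compress_carrier[OF E F] A by (simp add: isometry_mat_def)
qed

section \<open>Frames from representations\<close>

locale orbit_frame =
  fixes n N r :: nat and G :: "(nat \<Rightarrow> nat) set"
    and \<pi> :: "(nat \<Rightarrow> nat) \<Rightarrow> 'a::conjugatable_field mat" and \<Psi> :: "'a mat" and t :: "nat \<Rightarrow> nat \<Rightarrow> nat"
  assumes n_pos: "1 \<le> n"
    and G_subgroup: "subgroup G (sym_group n)"
    and t_in: "\<And>k. k \<in> {1..n} \<Longrightarrow> t k \<in> G"
    and t_top: "\<And>k. k \<in> {1..n} \<Longrightarrow> t k n = k"
    and \<pi>_carrier: "\<And>g. g \<in> G \<Longrightarrow> \<pi> g \<in> carrier_mat N N"
    and \<pi>_comp: "\<And>g h. g \<in> G \<Longrightarrow> h \<in> G \<Longrightarrow> \<pi> (g \<circ> h) = \<pi> g * \<pi> h"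
    and \<pi>_id: "\<pi> id = 1\<^sub>m N"
    and \<pi>_inv: "\<And>g. g \<in> G \<Longrightarrow> mat_adjoint (\<pi> g) = \<pi> (inv' g)"
    and \<Psi>_isometry: "isometry_mat N r \<Psi>"
    and stabilizer: "\<And>h. h \<in> G \<Longrightarrow> h n = n \<Longrightarrow> intertwines \<Psi> \<Psi> (\<pi> h)"
begin

definition frame_map :: "nat \<Rightarrow> 'a mat" where
  "frame_map k = \<pi> (t k) * \<Psi>"

definition subspace :: "nat \<Rightarrow> 'a vec set" where
  "subspace k = mat_image (frame_map k) (carrier_vec r)"

definition compressed :: "(nat \<Rightarrow> nat) \<Rightarrow> 'a mat" where
  "compressed g = compress \<Psi> \<Psi> (\<pi> g)"

definition frame_op :: "'a mat" where
  "frame_op = mat_sum N {1..n} (\<lambda>k. frame_map k * mat_adjoint (frame_map k))"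

lemma G_permutes: "g \<in> G \<Longrightarrow> g permutes {1..n}"
  using subgroup.subset[OF G_subgroup] sym_group_carrier by blast

lemma G_comp: "g \<in> G \<Longrightarrow> h \<in> G \<Longrightarrow> g \<circ> h \<in> G"
  using subgroup.m_closed[OF G_subgroup] by (simp only: sym_group_mult)

lemma G_inv: "g \<in> G \<Longrightarrow> inv' g \<in> G"
  using subgroup.m_inv_closed[OF G_subgroup] subgroup.subset[OF G_subgroup]
  by (metis subsetD sym_group_inv_equality)

lemma G_range: "g \<in> G \<Longrightarrow> k \<in> {1..n} \<Longrightarrow> g k \<in> {1..n}"
  by (simp only: permutes_in_image[OF G_permutes])

lemma \<pi>_unitary:
  assumes "g \<in> G"
  shows "unitary_mat N (\<pi> g)"
proof -
  have "mat_adjoint (\<pi> g) * \<pi> g = \<pi> (inv' g \<circ> g)" "\<pi> g * mat_adjoint (\<pi> g) = \<pi> (g \<circ> inv' g)"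
    using assms by (simp_all only: \<pi>_inv \<pi>_comp G_inv)
  thus ?thesis
    using \<pi>_carrier[OF assms] permutes_inv_o[OF G_permutes[OF assms]] by (simp add: unitary_mat_def \<pi>_id)
qed

lemma dims [simp]:
  "g \<in> G \<Longrightarrow> dim_row (\<pi> g) = N" "g \<in> G \<Longrightarrow> dim_col (\<pi> g) = N" "dim_row \<Psi> = N" "dim_col \<Psi> = r"
  by (rule carrier_matD[OF \<pi>_carrier] isometry_mat_dim[OF \<Psi>_isometry]; assumption?)+

lemma frame_map_isometry: "k \<in> {1..n} \<Longrightarrow> isometry_mat N r (frame_map k)"
  unfolding frame_map_def
  by (rule isometry_mat_mult[OF unitary_mat_isometry(1)[OF \<pi>_unitary[OF t_in]] \<Psi>_isometry])

lemma frame_map_dim [simp]: "k \<in> {1..n} \<Longrightarrow> dim_row (frame_map k) = N" "dim_col (frame_map k) = r"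
  using isometry_mat_dim(1)[OF frame_map_isometry, of k] by (simp_all only: frame_map_def index_mult_mat dims)

lemma frame_map_square_carrier:
  "k \<in> {1..n} \<Longrightarrow> frame_map k * mat_adjoint (frame_map k) \<in> carrier_mat N N"
  by (rule carrier_matI) simp_all

lemma isometry_onto_subspace: "k \<in> {1..n} \<Longrightarrow> isometry_onto N r (frame_map k) (subspace k)"
  by (simp only: isometry_onto_iff frame_map_isometry subspace_def simp_thms)

lemma frame_map_gram:
  assumes "k \<in> {1..n}" "l \<in> {1..n}"
  shows "mat_adjoint (frame_map k) * frame_map l = compressed (inv' (t k) \<circ> t l)"
proof -
  have "mat_adjoint (frame_map k) * frame_map l = compress \<Psi> \<Psi> (mat_adjoint (\<pi> (t k)) * \<pi> (t l))"
    using t_in[OF assms(1)] t_in[OF assms(2)]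
    by (simp add: frame_map_def compress_def adjoint_mult mult_mat_assoc)
  thus ?thesis
    by (simp only: compressed_def \<pi>_inv \<pi>_comp G_inv t_in assms)
qed

lemma compressed_dim [simp]: "dim_row (compressed g) = r" "dim_col (compressed g) = r"
  by (simp_all add: compressed_def compress_def)

lemma compressed_carrier: "compressed g \<in> carrier_mat r r"
  by (rule carrier_matI) simp_all

lemma compressed_id: "compressed id = 1\<^sub>m r"
  by (simp only: compressed_def \<pi>_id compress_one[OF \<Psi>_isometry])

lemma compressed_adjoint: "g \<in> G \<Longrightarrow> mat_adjoint (compressed g) = compressed (inv' g)"
  by (simp add: compressed_def compress_adjoint \<pi>_inv)

lemma compressed_comp_right:
  assumes "g \<in> G" "h \<in> G" "h n = n"
  shows "compressed (g \<circ> h) = compressed g * compressed h"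
  using assms compress_mult[OF \<Psi>_isometry stabilizer[OF assms(2,3)], of "\<pi> g" \<Psi>]
  by (simp add: compressed_def \<pi>_comp)

lemma stabilizer_inv: "h \<in> G \<Longrightarrow> h n = n \<Longrightarrow> inv' h n = n"
  using permutes_inverses(2)[OF G_permutes, of h n] by simp

lemma compressed_comp_left:
  assumes g: "g \<in> G" and h: "h \<in> G" "h n = n"
  shows "compressed (h \<circ> g) = compressed h * compressed g"
proof -
  have "inv' (inv' g \<circ> inv' h) = h \<circ> g"
    using o_inv_distrib[of "inv' g" "inv' h"] permutes_bij[OF G_permutes[OF G_inv]]
      permutes_inv_inv[OF G_permutes] g h by simp
  hence "compressed (h \<circ> g) = mat_adjoint (compressed (inv' g \<circ> inv' h))"
    using compressed_adjoint[OF G_comp[OF G_inv[OF g] G_inv[OF h(1)]]] by simp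
  also have "\<dots> = mat_adjoint (compressed (inv' h)) * mat_adjoint (compressed (inv' g))"
    unfolding compressed_comp_right[OF G_inv[OF g] G_inv[OF h(1)] stabilizer_inv[OF h]]
    by (simp add: adjoint_mult)
  also have "\<dots> = compressed h * compressed g"
    using g h by (simp add: compressed_adjoint G_inv permutes_inv_inv[OF G_permutes])
  finally show ?thesis .
qed

lemma compressed_unitary:
  assumes h: "h \<in> G" "h n = n"
  shows "unitary_mat r (compressed h)"
proof -
  have "mat_adjoint (compressed h) * compressed h = compressed (inv' h \<circ> h)"
    using h by (simp only: compressed_adjoint compressed_comp_right[OF G_inv])
  hence "mat_adjoint (compressed h) * compressed h = 1\<^sub>m r"
    by (simp only: permutes_inv_o(2)[OF G_permutes[OF h(1)]] compressed_id)
  thus ?thesis using compressed_carrier by (intro isometry_mat_square) (simp add: isometry_mat_def)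
qed

lemma \<pi>_\<Psi>_stabilizer:
  assumes h: "h \<in> G" "h n = n"
  shows "\<pi> h * \<Psi> = \<Psi> * compressed h"
proof -
  have "\<Psi> * compressed h = \<Psi> * mat_adjoint \<Psi> * \<pi> h * \<Psi>"
    using h(1) by (simp add: compressed_def compress_def mult_mat_assoc)
  also have "\<dots> = \<pi> h * \<Psi>"
    using stabilizer[OF h] isometry_mat_cancel[OF \<Psi>_isometry, of "1\<^sub>m r"] \<Psi>_isometry h(1)
    by (simp add: intertwines_def isometry_mat_def mult_mat_assoc)
  finally show ?thesis by simp
qed

lemma frame_map_move:
  assumes g: "g \<in> G" and k: "k \<in> {1..n}"
  obtains h where "h \<in> G" "h n = n" "\<pi> g * frame_map k = frame_map (g k) * compressed h"
proof -
  have gk: "g k \<in> {1..n}" by (rule G_range[OF g k])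
  have perm: "t (g k) permutes {1..n}" by (rule G_permutes[OF t_in[OF gk]])
  define h where "h = inv' (t (g k)) \<circ> (g \<circ> t k)"
  have h: "h \<in> G" unfolding h_def by (rule G_comp[OF G_inv[OF t_in[OF gk]] G_comp[OF g t_in[OF k]]])
  have top: "h n = n"
    using permutes_inverses(2)[OF perm, of n] t_top[OF gk] t_top[OF k] by (simp add: h_def)
  have "g \<circ> t k = t (g k) \<circ> h"
    unfolding h_def by (simp add: comp_assoc[symmetric] permutes_inv_o(1)[OF perm])
  hence "\<pi> g * \<pi> (t k) = \<pi> (t (g k)) * \<pi> h"
    using \<pi>_comp[OF g t_in[OF k]] \<pi>_comp[OF t_in[OF gk] h] by simp
  hence "\<pi> g * frame_map k = \<pi> (t (g k)) * (\<pi> h * \<Psi>)"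
    using g h t_in[OF k] t_in[OF gk] by (simp add: frame_map_def flip: mult_mat_assoc)
  also have "\<dots> = frame_map (g k) * compressed h"
    unfolding \<pi>_\<Psi>_stabilizer[OF h top] using t_in[OF gk] by (simp add: frame_map_def mult_mat_assoc)
  finally show ?thesis using that h top by blast
qed

lemma G_automorphisms: "G \<subseteq> fusion_aut n N subspace"
proof
  fix g assume g: "g \<in> G"
  have "mat_image (\<pi> g) (subspace k) = subspace (g k)" if k: "k \<in> {1..n}" for k
  proof -
    obtain h where h: "h \<in> G" "h n = n" and move: "\<pi> g * frame_map k = frame_map (g k) * compressed h"
      using frame_map_move[OF g k] .
    have carrier: "frame_map k \<in> carrier_mat N r" "frame_map (g k) \<in> carrier_mat N r"
      using frame_map_isometry[OF k] frame_map_isometry[OF G_range[OF g k]] by (simp_all add: isometry_mat_def)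
    have "mat_image (\<pi> g) (subspace k) = mat_image (\<pi> g * frame_map k) (carrier_vec r)"
      unfolding subspace_def by (rule mat_image_mult[symmetric, OF \<pi>_carrier[OF g] carrier(1)])
    also have "\<dots> = mat_image (frame_map (g k)) (mat_image (compressed h) (carrier_vec r))"
      unfolding move by (rule mat_image_mult[OF carrier(2) compressed_carrier])
    also have "\<dots> = subspace (g k)"
      by (simp only: mat_image_unitary[OF compressed_unitary[OF h]] subspace_def)
    finally show ?thesis .
  qed
  thus "g \<in> fusion_aut n N subspace"
    using G_permutes[OF g] \<pi>_unitary[OF g] unfolding fusion_aut_def sym_group_carrier by blast
qed

lemma tight_fusion_frame_subspace:
  assumes "frame_op = c \<cdot>\<^sub>m 1\<^sub>m N"
  shows "tight_fusion_frame n N subspace"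
  unfolding tight_fusion_frame_def
proof (intro exI conjI ballI)
  show "orthogonal_projection N (frame_map k * mat_adjoint (frame_map k)) (subspace k)" if "k \<in> {1..n}" for k
    unfolding subspace_def by (rule orthogonal_projection_isometry[OF frame_map_isometry[OF that]])
qed (use assms in \<open>simp only: frame_op_def mat_sum_def\<close>)

lemma frame_op_commutes:
  assumes g: "g \<in> G"
  shows "\<pi> g * frame_op = frame_op * \<pi> g"
proof -
  note unitary = \<pi>_unitary[OF g, unfolded unitary_mat_def]
  have "\<pi> g * frame_op * mat_adjoint (\<pi> g) =
      mat_sum N {1..n} (\<lambda>k. \<pi> g * (frame_map k * mat_adjoint (frame_map k)) * mat_adjoint (\<pi> g))"
    unfolding frame_op_def
    using unitary frame_map_square_carrier by (intro mat_sum_sandwich) auto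
  also have "\<dots> = mat_sum N {1..n} (\<lambda>k. frame_map (g k) * mat_adjoint (frame_map (g k)))"
  proof (rule mat_sum_cong)
    fix k assume k: "k \<in> {1..n}"
    obtain h where h: "h \<in> G" "h n = n" and move: "\<pi> g * frame_map k = frame_map (g k) * compressed h"
      using frame_map_move[OF g k] .
    have "\<pi> g * (frame_map k * mat_adjoint (frame_map k)) * mat_adjoint (\<pi> g) =
        (\<pi> g * frame_map k) * mat_adjoint (\<pi> g * frame_map k)"
      using g k by (simp add: mult_mat_assoc adjoint_mult del: atLeastAtMost_iff)
    also have "\<dots> = frame_map (g k) *
        (compressed h * (mat_adjoint (compressed h) * mat_adjoint (frame_map (g k))))"
      unfolding move using G_range[OF g k] by (simp add: mult_mat_assoc adjoint_mult del: atLeastAtMost_iff)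
    also have "\<dots> = frame_map (g k) * mat_adjoint (frame_map (g k))"
      using compressed_unitary[OF h] by (simp add: unitary_mat_def mult_mat_cancel[of _ _ r])
    finally show "\<pi> g * (frame_map k * mat_adjoint (frame_map k)) * mat_adjoint (\<pi> g) =
        frame_map (g k) * mat_adjoint (frame_map (g k))" .
  qed
  also have "\<dots> = frame_op"
    unfolding frame_op_def mat_sum_def
    using sum.reindex_bij_betw[OF permutes_imp_bij[OF G_permutes[OF g]],
        of "\<lambda>k. (frame_map k * mat_adjoint (frame_map k)) $$ _"]
    by simp
  finally have conj: "\<pi> g * frame_op * mat_adjoint (\<pi> g) = frame_op" .
  have "\<pi> g * frame_op * (mat_adjoint (\<pi> g) * \<pi> g) = \<pi> g * frame_op"
    using unitary g by (simp add: frame_op_def)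
  thus ?thesis using conj g by (simp add: frame_op_def flip: mult_mat_assoc)
qed

lemma gram_moves_top:
  assumes "k \<in> {1..n}" "l \<in> {1..n}" "k \<noteq> l"
  shows "inv' (t k) \<circ> t l \<in> G" "(inv' (t k) \<circ> t l) n \<noteq> n"
proof -
  show "inv' (t k) \<circ> t l \<in> G" by (rule G_comp[OF G_inv[OF t_in[OF assms(1)]] t_in[OF assms(2)]])
  have "t k (inv' (t k) l) = l" by (rule permutes_inverses(1)[OF G_permutes[OF t_in[OF assms(1)]]])
  thus "(inv' (t k) \<circ> t l) n \<noteq> n" using t_top[OF assms(1)] t_top[OF assms(2)] assms(3) by auto
qed

lemma top_moving_factorisation:
  assumes g: "g \<in> G" "g n \<noteq> n"
  obtains l h where "l \<in> {1..n}" "l \<noteq> n" "h \<in> G" "h n = n" "g = inv' (t n) \<circ> t l \<circ> h"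
proof -
  have n: "n \<in> {1..n}" using n_pos by simp
  define l where "l = t n (g n)"
  have l: "l \<in> {1..n}" unfolding l_def by (rule G_range[OF t_in[OF n] G_range[OF g(1) n]])
  have tn: "t n permutes {1..n}" and tl: "t l permutes {1..n}"
    using G_permutes[OF t_in] n l by blast+
  define h where "h = inv' (t l) \<circ> (t n \<circ> g)"
  have "h \<in> G" unfolding h_def by (rule G_comp[OF G_inv[OF t_in[OF l]] G_comp[OF t_in[OF n] g(1)]])
  moreover have "h n = n" using permutes_inverses(2)[OF tl, of n] t_top[OF l] by (simp add: h_def l_def)
  moreover have "l \<noteq> n"
  proof
    assume "l = n"
    hence "t n (g n) = t n n" using t_top[OF n] by (simp only: l_def)
    thus False using g(2) injD[OF permutes_inj[OF tn]] by blast
  qed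
  moreover have "g = inv' (t n) \<circ> t l \<circ> h"
    by (simp add: h_def fun_eq_iff permutes_inverses(1)[OF tl] permutes_inverses(2)[OF tn])
  ultimately show ?thesis using that l by blast
qed

lemma equi_isoclinic_subspace_iff:
  "equi_isoclinic n r N subspace \<longleftrightarrow>
    (\<exists>\<alpha>. \<forall>g\<in>G. g n \<noteq> n \<longrightarrow> mat_adjoint (compressed g) * compressed g = \<alpha> \<cdot>\<^sub>m 1\<^sub>m r)"
proof -
  let ?square = "\<lambda>g. mat_adjoint (compressed g) * compressed g"
  have n: "n \<in> {1..n}" using n_pos by simp
  have gram: "equi_isoclinic n r N subspace \<longleftrightarrow>
      (\<exists>\<alpha>. \<forall>k\<in>{1..n}. \<forall>l\<in>{1..n}. k \<noteq> l \<longrightarrow> ?square (inv' (t k) \<circ> t l) = \<alpha> \<cdot>\<^sub>m 1\<^sub>m r)"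
    by (subst equi_isoclinic_iff[OF isometry_onto_subspace], assumption)
      (intro ex_cong1 ball_cong imp_cong refl, simp only: frame_map_gram)
  have "(\<forall>k\<in>{1..n}. \<forall>l\<in>{1..n}. k \<noteq> l \<longrightarrow> ?square (inv' (t k) \<circ> t l) = \<alpha> \<cdot>\<^sub>m 1\<^sub>m r) \<longleftrightarrow>
      (\<forall>g\<in>G. g n \<noteq> n \<longrightarrow> ?square g = \<alpha> \<cdot>\<^sub>m 1\<^sub>m r)" (is "?gram \<longleftrightarrow> ?all") for \<alpha>
  proof
    assume scalar: ?gram
    show ?all
    proof (intro ballI impI)
      fix g assume "g \<in> G" "g n \<noteq> n"
      then obtain l h where l: "l \<in> {1..n}" "l \<noteq> n" and h: "h \<in> G" "h n = n"
        and g: "g = inv' (t n) \<circ> t l \<circ> h"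
        by (rule top_moving_factorisation)
      let ?B = "compressed (inv' (t n) \<circ> t l)"
      have "compressed g = 1\<^sub>m r * ?B * compressed h"
        using compressed_comp_right[OF gram_moves_top(1)[OF n l(1) l(2)[symmetric]] h]
        by (simp add: g del: o_apply)
      moreover have "mat_adjoint ?B * ?B = \<alpha> \<cdot>\<^sub>m 1\<^sub>m r" 
        by (rule scalar[rule_format, OF n l(1) l(2)[symmetric]])
      moreover have "unitary_mat r (1\<^sub>m r :: 'a mat)" by (simp add: unitary_mat_def)
      ultimately show "?square g = \<alpha> \<cdot>\<^sub>m 1\<^sub>m r"
        by (simp only: gram_square_unitary[OF _ compressed_unitary[OF h] compressed_carrier])
    qed
  next
    assume ?all
    thus ?gram by (intro ballI impI) (simp only: gram_moves_top simp_thms)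
  qed
  thus ?thesis by (simp only: gram)
qed

lemma equi_isoclinic_tff_subspace:
  assumes "\<And>g. g \<in> G \<Longrightarrow> g n \<noteq> n \<Longrightarrow> mat_adjoint (compressed g) * compressed g = \<alpha> \<cdot>\<^sub>m 1\<^sub>m r"
    and "frame_op = c \<cdot>\<^sub>m 1\<^sub>m N"
  shows "equi_isoclinic_tff n r N subspace"
  using equi_isoclinic_subspace_iff tight_fusion_frame_subspace[OF assms(2)] assms(1)
  unfolding equi_isoclinic_tff_def by blast

end

subsection \<open>Restriction to invariant subspaces\<close>

locale restricted_frame = orbit_frame n N r G \<pi> \<Psi> t
  for n N r G and \<pi> :: "(nat \<Rightarrow> nat) \<Rightarrow> 'a::conjugatable_field mat" and \<Psi> t +
  fixes N' r' :: nat and H :: "(nat \<Rightarrow> nat) set" and E F :: "'a mat"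
  assumes H_subgroup: "subgroup H (sym_group n)" and H_subset: "H \<subseteq> G"
    and t_in_H: "\<And>k. k \<in> {1..n} \<Longrightarrow> t k \<in> H"
    and E_isometry: "isometry_mat N N' E" and F_isometry: "isometry_mat r r' F"
    and \<pi>_intertwines: "\<And>g. g \<in> H \<Longrightarrow> intertwines E E (\<pi> g)"
    and \<Psi>_intertwines: "intertwines E F \<Psi>"
begin

lemma E_F_dim [simp]: "dim_row E = N" "dim_col E = N'" "dim_row F = r" "dim_col F = r'"
  using isometry_mat_dim[OF E_isometry] isometry_mat_dim[OF F_isometry] by auto

lemma H_in_G: "g \<in> H \<Longrightarrow> g \<in> G"
  using H_subset by (rule subsetD)

lemma \<Psi>_adjoint_intertwines: "intertwines F E (mat_adjoint \<Psi>)"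
  by (rule intertwines_adjoint[OF \<Psi>_intertwines]) simp_all

lemma compress_range_projection:
  "compress E F \<Psi> * mat_adjoint (compress E F \<Psi>) = compress E E (\<Psi> * mat_adjoint \<Psi>)"
  by (simp add: compress_adjoint compress_mult[OF E_isometry \<Psi>_adjoint_intertwines])

sublocale restricted: orbit_frame n N' r' H "\<lambda>g. compress E E (\<pi> g)" "compress E F \<Psi>" t
proof (rule orbit_frame.intro)
  show "1 \<le> n" by (rule n_pos)
  show "subgroup H (sym_group n)" by (rule H_subgroup)
  show "t k \<in> H" "t k n = k" if "k \<in> {1..n}" for k using that by (rule t_in_H t_top)+
  show "compress E E (\<pi> g) \<in> carrier_mat N' N'" if "g \<in> H" for g
    by (rule compress_carrier[OF E_isometry E_isometry \<pi>_carrier[OF H_in_G[OF that]]])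
  show "compress E E (\<pi> (g \<circ> h)) = compress E E (\<pi> g) * compress E E (\<pi> h)" if "g \<in> H" "h \<in> H" for g h
    using that H_in_G by (simp add: \<pi>_comp compress_mult[OF E_isometry \<pi>_intertwines])
  show "compress E E (\<pi> id) = 1\<^sub>m N'" by (simp only: \<pi>_id compress_one[OF E_isometry])
  show "mat_adjoint (compress E E (\<pi> g)) = compress E E (\<pi> (inv' g))" if "g \<in> H" for g
    using that H_in_G by (simp add: compress_adjoint \<pi>_inv)
  show "isometry_mat N' r' (compress E F \<Psi>)"
    by (rule isometry_mat_compress[OF E_isometry F_isometry \<Psi>_isometry \<Psi>_intertwines])
  show "intertwines (compress E F \<Psi>) (compress E F \<Psi>) (compress E E (\<pi> h))" if h: "h \<in> H" "h n = n" for h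
  proof -
    have "intertwines E E (\<Psi> * mat_adjoint \<Psi>)"
      by (rule intertwines_mult[OF \<Psi>_intertwines \<Psi>_adjoint_intertwines]) simp_all
    thus ?thesis
      using stabilizer[OF H_in_G[OF h(1)] h(2)] H_in_G[OF h(1)] \<pi>_intertwines[OF h(1)]
      by (simp add: intertwines_def[of "compress E F \<Psi>"] compress_range_projection
          compress_mult[OF E_isometry] intertwines_def[of \<Psi>])
  qed
qed

lemma restricted_compressed:
  assumes g: "g \<in> H"
  shows "restricted.compressed g = compress F F (compressed g)"
proof -
  have "restricted.compressed g = compress F E (mat_adjoint \<Psi>) * compress E E (\<pi> g) * compress E F \<Psi>"
    by (simp add: restricted.compressed_def compress_def[of "compress E F \<Psi>"] compress_adjoint)
  also have "\<dots> = compress F E (mat_adjoint \<Psi> * \<pi> g) * compress E F \<Psi>"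
    using H_in_G[OF g] by (simp add: compress_mult[OF E_isometry \<pi>_intertwines[OF g]])
  also have "\<dots> = compress F F (compressed g)"
    using H_in_G[OF g] by (simp add: compress_mult[OF F_isometry \<Psi>_intertwines] compressed_def compress_def[of \<Psi>])
  finally show ?thesis .
qed

lemma compressed_intertwines:
  assumes g: "g \<in> H"
  shows "intertwines F F (compressed g)"
  using H_in_G[OF g]
    intertwines_mult[OF intertwines_mult[OF \<Psi>_adjoint_intertwines \<pi>_intertwines[OF g]] \<Psi>_intertwines]
  by (simp add: compressed_def compress_def)

lemma restricted_frame_op: "restricted.frame_op = compress E E frame_op"
proof -
  have "restricted.frame_map k * mat_adjoint (restricted.frame_map k) =
      mat_adjoint E * (frame_map k * mat_adjoint (frame_map k)) * E" if k: "k \<in> {1..n}" for k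
  proof -
    note tk = t_in_H[OF k] H_in_G[OF t_in_H[OF k]]
    have map: "restricted.frame_map k = compress E F (frame_map k)"
      using tk by (simp add: restricted.frame_map_def frame_map_def compress_mult[OF F_isometry \<Psi>_intertwines])
    have "intertwines E F (frame_map k)"
      unfolding frame_map_def using tk by (intro intertwines_mult[OF \<pi>_intertwines \<Psi>_intertwines]) simp_all
    hence "intertwines F E (mat_adjoint (frame_map k))"
      using k by (intro intertwines_adjoint) (simp_all del: atLeastAtMost_iff)
    thus ?thesis
      using k unfolding map
      by (simp add: compress_adjoint compress_mult[OF E_isometry] compress_def[of E E] del: atLeastAtMost_iff)
  qed
  hence "restricted.frame_op =
      mat_sum N' {1..n} (\<lambda>k. mat_adjoint E * (frame_map k * mat_adjoint (frame_map k)) * E)"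
    unfolding restricted.frame_op_def by (rule mat_sum_cong)
  also have "\<dots> = compress E E frame_op"
    unfolding compress_def frame_op_def
    using E_isometry frame_map_square_carrier
    by (intro mat_sum_sandwich[symmetric]) (auto simp: isometry_mat_def)
  finally show ?thesis .
qed

lemma equi_isoclinic_tff_restricted:
  assumes scalar: "\<And>g. g \<in> G \<Longrightarrow> g n \<noteq> n \<Longrightarrow> mat_adjoint (compressed g) * compressed g = \<alpha> \<cdot>\<^sub>m 1\<^sub>m r"
    and tight: "frame_op = c \<cdot>\<^sub>m 1\<^sub>m N"
  shows "equi_isoclinic_tff n r' N' restricted.subspace"
proof (rule restricted.equi_isoclinic_tff_subspace)
  fix g assume g: "g \<in> H" "g n \<noteq> n"
  have "mat_adjoint (restricted.compressed g) * restricted.compressed g =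
      compress F F (mat_adjoint (compressed g) * compressed g)"
    by (simp add: restricted_compressed[OF g(1)] compress_adjoint
        compress_mult[OF F_isometry compressed_intertwines[OF g(1)]])
  thus "mat_adjoint (restricted.compressed g) * restricted.compressed g = \<alpha> \<cdot>\<^sub>m 1\<^sub>m r'"
    by (simp only: scalar[OF H_in_G[OF g(1)] g(2)] compress_smult_one[OF F_isometry])
next
  show "restricted.frame_op = c \<cdot>\<^sub>m 1\<^sub>m N'"
    by (simp only: restricted_frame_op tight compress_smult_one[OF E_isometry])
qed

end

subsection \<open>Extension of scalars\<close>

locale real_embedding = semiring_hom emb
  for emb :: "real \<Rightarrow> 'a::conjugatable_field" +
  assumes conjugate_emb: "conjugate (emb x) = emb x"
begin

lemma map_mat_mult: "dim_col A = dim_row B \<Longrightarrow> map_mat emb (A * B) = map_mat emb A * map_mat emb B"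
  by (rule mat_hom_mult[of A "dim_row A" "dim_col A" B "dim_col B"]) auto

lemma map_mat_adjoint: "map_mat emb (mat_adjoint A) = mat_adjoint (map_mat emb A)"
  by (rule eq_matI) (auto simp: mat_adjoint_eq_mat conjugate_emb)

lemma map_mat_smult_one: "map_mat emb (c \<cdot>\<^sub>m 1\<^sub>m k) = emb c \<cdot>\<^sub>m 1\<^sub>m k"
  by (rule eq_matI) auto

lemma map_mat_sum:
  "(\<And>k. k \<in> K \<Longrightarrow> P k \<in> carrier_mat N N) \<Longrightarrow>
    map_mat emb (mat_sum N K P) = mat_sum N K (\<lambda>k. map_mat emb (P k))"
  by (rule eq_matI) (fastforce simp: mat_sum_def hom_sum intro!: sum.cong)+

lemma map_mat_compress:
  "dim_row X = dim_row E \<Longrightarrow> dim_col X = dim_row F \<Longrightarrow>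
    map_mat emb (compress E F X) = compress (map_mat emb E) (map_mat emb F) (map_mat emb X)"
  by (simp add: compress_def map_mat_mult map_mat_adjoint)

lemma isometry_mat_map: "isometry_mat N r A \<Longrightarrow> isometry_mat N r (map_mat emb A)"
  using map_mat_mult[of "mat_adjoint A" A] by (auto simp: isometry_mat_def map_mat_adjoint mat_hom_one)

lemma intertwines_map:
  assumes "intertwines E F X" "dim_row X = dim_row E" "dim_col X = dim_row F"
  shows "intertwines (map_mat emb E) (map_mat emb F) (map_mat emb X)"
  using arg_cong[OF assms(1)[unfolded intertwines_def], of "map_mat emb"] assms(2,3)
  by (simp add: intertwines_def map_mat_mult map_mat_adjoint)

end

locale embedded_frame = orbit_frame n N r G \<pi> \<Psi> t + real_embedding emb
  for n N r G and \<pi> :: "(nat \<Rightarrow> nat) \<Rightarrow> real mat" and \<Psi> t and emb :: "real \<Rightarrow> 'a::conjugatable_field"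
begin

sublocale embedded: orbit_frame n N r G "\<lambda>g. map_mat emb (\<pi> g)" "map_mat emb \<Psi>" t
proof (rule orbit_frame.intro)
  show "map_mat emb (\<pi> (g \<circ> h)) = map_mat emb (\<pi> g) * map_mat emb (\<pi> h)" if "g \<in> G" "h \<in> G" for g h
    using that by (simp add: \<pi>_comp map_mat_mult)
  show "mat_adjoint (map_mat emb (\<pi> g)) = map_mat emb (\<pi> (inv' g))" if "g \<in> G" for g
    using that by (simp add: \<pi>_inv flip: map_mat_adjoint)
  show "intertwines (map_mat emb \<Psi>) (map_mat emb \<Psi>) (map_mat emb (\<pi> h))" if "h \<in> G" "h n = n" for h
    using that by (intro intertwines_map stabilizer) simp_all
qed (use n_pos G_subgroup t_in t_top \<pi>_carrier isometry_mat_map[OF \<Psi>_isometry] in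
    \<open>simp_all add: \<pi>_id mat_hom_one del: atLeastAtMost_iff\<close>)

lemma embedded_compressed: "g \<in> G \<Longrightarrow> embedded.compressed g = map_mat emb (compressed g)"
  by (simp add: embedded.compressed_def compressed_def map_mat_compress)

lemma embedded_frame_op: "embedded.frame_op = map_mat emb frame_op"
proof -
  have "embedded.frame_map k * mat_adjoint (embedded.frame_map k) =
      map_mat emb (frame_map k * mat_adjoint (frame_map k))"
    if "k \<in> {1..n}" for k
    using t_in[OF that] by (simp add: embedded.frame_map_def frame_map_def map_mat_mult map_mat_adjoint)
  hence "embedded.frame_op = mat_sum N {1..n} (\<lambda>k. map_mat emb (frame_map k * mat_adjoint (frame_map k)))"
    unfolding embedded.frame_op_def by (rule mat_sum_cong)
  thus ?thesis
    unfolding frame_op_def by (simp only: map_mat_sum[OF frame_map_square_carrier])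
qed

lemma embedded_compressed_square:
  assumes "g \<in> G" "mat_adjoint (compressed g) * compressed g = \<alpha> \<cdot>\<^sub>m 1\<^sub>m r"
  shows "mat_adjoint (embedded.compressed g) * embedded.compressed g = emb \<alpha> \<cdot>\<^sub>m 1\<^sub>m r"
  using arg_cong[OF assms(2), of "map_mat emb"]
  by (simp add: embedded_compressed[OF assms(1)] map_mat_mult map_mat_adjoint map_mat_smult_one)

end

section \<open>Young's representations and their induced sums\<close>

definition young_mat :: "nat \<Rightarrow> tableau set \<Rightarrow> (nat \<Rightarrow> nat) \<Rightarrow> real mat" where
  "young_mat n \<T> \<sigma> = kernel_mat \<T> \<T> (young_coeff n \<sigma>)"

lemma young_mat_carrier [simp]: "young_mat n \<T> \<sigma> \<in> carrier_mat (card \<T>) (card \<T>)"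
  by (simp add: young_mat_def)

lemma young_mat_dim [simp]: "dim_row (young_mat n \<T> \<sigma>) = card \<T>" "dim_col (young_mat n \<T> \<sigma>) = card \<T>"
  using carrier_matD[OF young_mat_carrier] by blast+

context tableau_family
begin

lemma young_mat_comp:
  assumes "\<sigma> permutes {1..n}" "\<tau> permutes {1..n}"
  shows "young_mat n \<T> (\<sigma> \<circ> \<tau>) = young_mat n \<T> \<sigma> * young_mat n \<T> \<tau>"
  unfolding young_mat_def kernel_mat_mult[OF finite_family]
  by (intro kernel_mat_cong) (simp only: young_coeff_comp[OF assms])

lemma young_mat_id: "young_mat n \<T> id = 1\<^sub>m (card \<T>)"
  unfolding young_mat_def one_mat_eq_kernel_mat[OF finite_family]
  by (intro kernel_mat_cong) (simp only: young_coeff_id)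

lemma young_mat_adjoint:
  assumes "\<sigma> permutes {1..n}"
  shows "mat_adjoint (young_mat n \<T> \<sigma>) = young_mat n \<T> (inv' \<sigma>)"
  unfolding young_mat_def adjoint_kernel_mat
  by (intro kernel_mat_cong) (simp add: young_coeff_inv[OF assms])

lemma young_coeff_unit_column:
  assumes "\<sigma> permutes {1..n}" "S \<in> \<T>"
  shows "(\<Sum>T\<in>\<T>. (young_coeff n \<sigma> T S)\<^sup>2) = 1"
proof -
  have "(\<Sum>T\<in>\<T>. (young_coeff n \<sigma> T S)\<^sup>2) = (\<Sum>T\<in>\<T>. young_coeff n (inv' \<sigma>) S T * young_coeff n \<sigma> T S)"
    by (intro sum.cong) (simp_all add: young_coeff_inv[OF assms] power2_eq_square)
  also have "\<dots> = young_coeff n (inv' \<sigma> \<circ> \<sigma>) S S"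
    by (rule young_coeff_comp[symmetric, OF permutes_inv[OF assms(1)] assms])
  finally show ?thesis by (simp only: permutes_inv_o(2)[OF assms(1)] young_coeff_id simp_thms if_True)
qed

end

lemma tableau_family_Tab: "is_partition n \<nu> \<Longrightarrow> tableau_family n (Tab \<nu>)"
  by (simp only: Tab_eq_SYT_shape tableau_family_SYT_shape)

lemma young_gen_eq:
  assumes "is_partition n \<nu>" "1 \<le> k" "k < n"
  shows "young_gen \<nu> k = young_mat n (Tab \<nu>) (adj_transp k)"
  unfolding young_gen_def mat_on_eq_kernel_mat young_mat_def
proof (rule kernel_mat_cong)
  fix S T assume "S \<in> Tab \<nu>" "T \<in> Tab \<nu>"
  hence ST: "S \<in> SYT n" "T \<in> SYT n"
    unfolding Tab_eq_SYT_shape[OF assms(1)] by (blast dest: SYT_shapeD(1))+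
  show "(if S = T then 1 / real_of_int (D_tab T (Suc k) k)
      else if S = adj_transp k \<circ> T then sqrt (1 - 1 / (real_of_int (D_tab T (Suc k) k))\<^sup>2) else 0) =
      young_coeff n (adj_transp k) S T"
    using adj_transp_comp_neq[OF ST(2) assms(2,3)]
    by (auto simp: young_coeff_adj_transp[OF assms(2,3) ST(1)] D_tab_Suc swap_weight_def)
qed

lemma sym_group_hom_eqI:
  assumes f: "f \<in> hom (sym_group n) M" and g: "g \<in> hom (sym_group n) M"
    and "f id = g id" "\<And>k. 1 \<le> k \<Longrightarrow> k < n \<Longrightarrow> f (adj_transp k) = g (adj_transp k)"
    and "\<sigma> permutes {1..n}"
  shows "f \<sigma> = g \<sigma>"
  using assms(5)
proof (induction rule: permutes_adj_transp_induct)
  case id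
  show ?case by (rule assms(3))
next
  case (step k \<sigma>)
  have mult: "h (adj_transp k \<circ> \<sigma>) = h (adj_transp k) \<otimes>\<^bsub>M\<^esub> h \<sigma>" if "h \<in> hom (sym_group n) M" for h
    using hom_mult[OF that, of "adj_transp k" \<sigma>] adj_transp_permutes[OF step(1,2)] step(3)
    by (simp only: sym_group_carrier sym_group_mult)
  show ?case by (simp only: mult[OF f] mult[OF g] assms(4)[OF step(1,2)] step.IH)
qed

lemma young_mat_hom:
  assumes "is_partition n \<nu>"
  shows "young_mat n (Tab \<nu>) \<in> hom (sym_group n) (ring_mat TYPE(real) (d_tab \<nu>) ())"
  by (rule homI) (simp_all only: sym_group_carrier sym_group_mult ring_mat_simps d_tab_def young_mat_carrier
      tableau_family.young_mat_comp[OF tableau_family_Tab[OF assms]])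

lemma young_rep_eq:
  assumes p: "is_partition n \<nu>" and \<sigma>: "\<sigma> permutes {1..n}"
  shows "young_rep \<nu> \<sigma> = young_mat n (Tab \<nu>) \<sigma>"
proof -
  have size: "sum_list \<nu> = n" using p by (simp add: is_partition_def)
  let ?C = "carrier (sym_group n)"
  let ?H = "hom (sym_group n) (ring_mat TYPE(real) (d_tab \<nu>) ())"
  let ?rep = "\<lambda>\<pi>. \<pi> \<in> ?H \<and> \<pi> \<in> extensional ?C \<and> \<pi> id = 1\<^sub>m (d_tab \<nu>) \<and>
    (\<forall>k\<in>{1..<n}. \<pi> (adj_transp k) = young_gen \<nu> k)"
  have in_C: "id \<in> ?C" "1 \<le> k \<Longrightarrow> k < n \<Longrightarrow> adj_transp k \<in> ?C" for k
    by (simp_all only: sym_group_carrier permutes_id adj_transp_permutes)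
  have "young_rep \<nu> = restrict (young_mat n (Tab \<nu>)) ?C"
    unfolding young_rep_def size
  proof (rule the_equality[where P = ?rep])
    have "restrict (young_mat n (Tab \<nu>)) ?C \<in> ?H"
      using young_mat_hom[OF p] by (auto simp: hom_def sym_group_carrier sym_group_mult permutes_compose)
    thus "?rep (restrict (young_mat n (Tab \<nu>)) ?C)"
      using in_C young_gen_eq[OF p] tableau_family.young_mat_id[OF tableau_family_Tab[OF p]]
      by (auto simp: d_tab_def simp del: One_nat_def)
  next
    fix \<pi> assume \<pi>: "?rep \<pi>"
    show "\<pi> = restrict (young_mat n (Tab \<nu>)) ?C"
    proof (rule extensionalityI[of _ ?C])
      fix \<sigma> assume \<sigma>: "\<sigma> \<in> ?C"
      have "\<pi> \<sigma> = young_mat n (Tab \<nu>) \<sigma>"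
      proof (rule sym_group_hom_eqI[OF _ young_mat_hom[OF p]])
        show "\<pi> \<in> ?H" "\<pi> id = young_mat n (Tab \<nu>) id"
          using \<pi> tableau_family.young_mat_id[OF tableau_family_Tab[OF p]] by (simp_all add: d_tab_def)
        show "\<pi> (adj_transp k) = young_mat n (Tab \<nu>) (adj_transp k)" if "1 \<le> k" "k < n" for k
          using \<pi> that young_gen_eq[OF p] by simp
        show "\<sigma> permutes {1..n}" using \<sigma> by (simp only: sym_group_carrier)
      qed
      thus "\<pi> \<sigma> = restrict (young_mat n (Tab \<nu>)) ?C \<sigma>" using \<sigma> by simp
    qed (use \<pi> in simp_all)
  qed
  thus ?thesis using \<sigma> by (simp add: sym_group_carrier)
qed

lemma entry_on_kernel_mat:
  "finite A \<Longrightarrow> finite B \<Longrightarrow> a \<in> A \<Longrightarrow> b \<in> B \<Longrightarrow> entry_on A B (kernel_mat A B K) a b = K a b"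
  by (simp add: entry_on_def kernel_mat_index)

locale induced_rep =
  fixes m :: nat and \<mu> :: "nat list" and L :: "nat list set"
  assumes partition: "is_partition m \<mu>" and L_subset: "L \<subseteq> up_set \<mu>" and L_nonempty: "L \<noteq> {}"
begin

abbreviation new_box :: "nat list \<Rightarrow> nat \<times> nat" where
  "new_box \<nu> \<equiv> added_box \<nu> \<mu>"

abbreviation extend :: "nat list \<Rightarrow> tableau \<Rightarrow> tableau" where
  "extend \<nu> R \<equiv> R(new_box \<nu> := Suc m)"

definition weight :: "nat list \<Rightarrow> real" where
  "weight \<nu> = real (d_tab \<nu>) / real (d_sum L)"

definition psi_coeff :: "tableau \<Rightarrow> tableau \<Rightarrow> real" where
  "psi_coeff T R = (\<Sum>\<nu>\<in>L. if T = extend \<nu> R then sqrt (weight \<nu>) else 0)"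

lemma finite_L: "finite L"
  by (rule finite_subset[OF L_subset finite_up_set[OF partition]])

lemma L_up_set: "\<nu> \<in> L \<Longrightarrow> \<nu> \<in> up_set \<mu>"
  using L_subset by blast

lemmas L_partition = up_setD(1)[OF partition L_up_set]
lemmas L_diagram = up_setD(3)[OF partition L_up_set]
lemmas new_box_addable = added_box_addable[OF partition L_up_set]
lemmas Tab_\<mu> = Tab_eq_SYT_shape[OF partition]
lemmas Tab_L = Tab_eq_SYT_shape[OF L_partition]

lemma finite_Tab_\<mu>: "finite (Tab \<mu>)"
  by (simp only: Tab_\<mu> finite_SYT_shape)

lemma Tab_L_disjoint: "T \<in> Tab \<nu> \<Longrightarrow> T \<in> Tab \<kappa> \<Longrightarrow> \<nu> \<in> L \<Longrightarrow> \<kappa> \<in> L \<Longrightarrow> \<nu> = \<kappa>"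
  using diagram_inj[OF L_partition L_partition] by (simp add: Tab_L SYT_shape_def)

sublocale tableau_family "Suc m" "Tabs L"
proof
  show "finite (Tabs L)" by (simp add: Tabs_def finite_L Tab_L finite_SYT_shape)
  show "T \<in> SYT (Suc m)" "SYT_shape (Suc m) (shape T) \<subseteq> Tabs L" if "T \<in> Tabs L" for T
    using that by (auto simp: Tabs_def Tab_L SYT_shape_def)
qed

lemma card_Tabs: "card (Tabs L) = d_sum L"
  unfolding Tabs_def d_sum_def d_tab_def
  by (rule card_UN_disjoint[OF finite_L]) (use Tab_L_disjoint in \<open>auto simp: Tab_L finite_SYT_shape\<close>)

lemma d_sum_pos: "0 < d_sum L"
  unfolding d_sum_def using finite_L L_nonempty d_tab_pos[OF L_partition] by (intro sum_pos)

lemma weight_nonneg: "0 \<le> weight \<nu>"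
  by (simp add: weight_def)

lemma sum_weight: "(\<Sum>\<nu>\<in>L. weight \<nu>) = 1"
  using d_sum_pos by (simp add: weight_def d_sum_def flip: sum_divide_distrib of_nat_sum)

lemma extend_Tab: "\<nu> \<in> L \<Longrightarrow> R \<in> Tab \<mu> \<Longrightarrow> extend \<nu> R \<in> Tab \<nu>"
  using SYT_shape_extend[OF _ new_box_addable, of R m] by (simp add: Tab_\<mu> Tab_L L_diagram)

lemma extend_Tabs: "\<nu> \<in> L \<Longrightarrow> R \<in> Tab \<mu> \<Longrightarrow> extend \<nu> R \<in> Tabs L"
  using extend_Tab by (auto simp: Tabs_def)

lemma extend_eq_iff:
  assumes "\<nu> \<in> L" "\<kappa> \<in> L" "R \<in> Tab \<mu>" "R' \<in> Tab \<mu>"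
  shows "extend \<nu> R = extend \<kappa> R' \<longleftrightarrow> \<nu> = \<kappa> \<and> R = R'"
proof
  assume eq: "extend \<nu> R = extend \<kappa> R'"
  hence same: "\<nu> = \<kappa>"
    using Tab_L_disjoint[OF extend_Tab[OF assms(1,3)] _ assms(1,2)] extend_Tab[OF assms(2,4)] by simp
  have restrict: "(extend \<kappa> Q)(new_box \<kappa> := 0) = Q" if "Q \<in> Tab \<mu>" for Q
    using that new_box_addable[OF assms(2)] unfolding Tab_\<mu> by (rule extend_restrict)
  show "\<nu> = \<kappa> \<and> R = R'"
    using arg_cong[OF eq, of "\<lambda>T. T(new_box \<kappa> := 0)"]
    by (simp only: same restrict[OF assms(3)] restrict[OF assms(4)] simp_thms)
qed simp

lemma young_coeff_distinct_summands:
  assumes "\<sigma> permutes {1..Suc m}" "\<nu> \<in> L" "\<kappa> \<in> L" "\<nu> \<noteq> \<kappa>" "S \<in> Tab \<nu>" "T \<in> Tab \<kappa>"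
  shows "young_coeff (Suc m) \<sigma> S T = 0"
proof (rule young_coeff_shape_neq[OF assms(1)])
  show "S \<in> SYT (Suc m)" "shape S \<noteq> shape T"
    using assms diagram_inj[OF L_partition[OF assms(2)] L_partition[OF assms(3)]]
    by (auto simp: Tab_L SYT_shape_def)
qed

lemma sum_one_summand: "\<nu> \<in> L \<Longrightarrow> (\<And>\<kappa>. \<kappa> \<in> L \<Longrightarrow> \<kappa> \<noteq> \<nu> \<Longrightarrow> f \<kappa> = 0) \<Longrightarrow> sum f L = f \<nu>"
  for f :: "nat list \<Rightarrow> real"
  using sum.remove[OF finite_L, of \<nu> f] by simp

lemma rep_sum_eq:
  assumes "\<sigma> permutes {1..Suc m}"
  shows "rep_sum L \<sigma> = young_mat (Suc m) (Tabs L) \<sigma>"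
  unfolding rep_sum_def mat_on_eq_kernel_mat young_mat_def
proof (rule kernel_mat_cong)
  fix S T assume "S \<in> Tabs L" "T \<in> Tabs L"
  then obtain \<nu> \<kappa> where \<nu>: "\<nu> \<in> L" "S \<in> Tab \<nu>" and \<kappa>: "\<kappa> \<in> L" "T \<in> Tab \<kappa>" by (auto simp: Tabs_def)
  let ?entry = "\<lambda>\<rho>. if S \<in> Tab \<rho> \<and> T \<in> Tab \<rho> then entry_on (Tab \<rho>) (Tab \<rho>) (young_rep \<rho> \<sigma>) S T else 0"
  have "?entry \<rho> = 0" if "\<rho> \<in> L" "\<rho> \<noteq> \<nu>" for \<rho>
    using Tab_L_disjoint[OF \<nu>(2) _ \<nu>(1) that(1)] that(2) by auto
  hence "(\<Sum>\<rho>\<in>L. ?entry \<rho>) = ?entry \<nu>" by (rule sum_one_summand[OF \<nu>(1)])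
  also have "\<dots> = young_coeff (Suc m) \<sigma> S T"
  proof (cases "T \<in> Tab \<nu>")
    case True
    have "finite (Tab \<nu>)" by (simp only: Tab_L[OF \<nu>(1)] finite_SYT_shape)
    thus ?thesis
      using True \<nu>(2) by (simp add: young_rep_eq[OF L_partition[OF \<nu>(1)] assms] young_mat_def entry_on_kernel_mat)
  next
    case False
    thus ?thesis using young_coeff_distinct_summands[OF assms \<nu>(1) \<kappa>(1) _ \<nu>(2) \<kappa>(2)] \<kappa>(2) by auto
  qed
  finally show "(\<Sum>\<rho>\<in>L. ?entry \<rho>) = young_coeff (Suc m) \<sigma> S T" .
qed

lemma Psi_sum_eq: "Psi_sum L \<mu> = kernel_mat (Tabs L) (Tab \<mu>) psi_coeff"
proof -
  have "sum_list \<nu> = Suc m" if "\<nu> \<in> L" for \<nu> using L_partition[OF that] by (simp add: is_partition_def)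
  thus ?thesis
    unfolding Psi_sum_def mat_on_eq_kernel_mat psi_coeff_def weight_def extend_tab_def
    by (intro kernel_mat_cong sum.cong) simp_all
qed

lemma sum_psi_coeff:
  assumes "R \<in> Tab \<mu>"
  shows "(\<Sum>T\<in>Tabs L. g T * psi_coeff T R) = (\<Sum>\<nu>\<in>L. sqrt (weight \<nu>) * g (extend \<nu> R))"
proof -
  have "(\<Sum>T\<in>Tabs L. g T * psi_coeff T R) =
      (\<Sum>T\<in>Tabs L. \<Sum>\<nu>\<in>L. if T = extend \<nu> R then sqrt (weight \<nu>) * g T else 0)"
    unfolding psi_coeff_def sum_distrib_left by (intro sum.cong) auto
  also have "\<dots> = (\<Sum>\<nu>\<in>L. \<Sum>T\<in>Tabs L. if T = extend \<nu> R then sqrt (weight \<nu>) * g T else 0)"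
    by (rule sum.swap)
  also have "\<dots> = (\<Sum>\<nu>\<in>L. sqrt (weight \<nu>) * g (extend \<nu> R))"
    using extend_Tabs[OF _ assms] by (intro sum.cong) (auto simp: finite_family)
  finally show ?thesis .
qed

lemma compress_rep_sum:
  assumes "\<sigma> permutes {1..Suc m}"
  shows "compress (Psi_sum L \<mu>) (Psi_sum L \<mu>) (rep_sum L \<sigma>) =
    kernel_mat (Tab \<mu>) (Tab \<mu>) (\<lambda>R R'. \<Sum>\<nu>\<in>L. weight \<nu> * young_coeff (Suc m) \<sigma> (extend \<nu> R) (extend \<nu> R'))"
  unfolding compress_def Psi_sum_eq rep_sum_eq[OF assms] young_mat_def adjoint_kernel_mat
    kernel_mat_mult[OF finite_family]
proof (rule kernel_mat_cong)
  fix R R' assume R: "R \<in> Tab \<mu>" "R' \<in> Tab \<mu>"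
  let ?K = "\<lambda>\<kappa> \<nu>. young_coeff (Suc m) \<sigma> (extend \<kappa> R) (extend \<nu> R')"
  have "(\<Sum>T\<in>Tabs L. (\<Sum>U\<in>Tabs L. conjugate (psi_coeff U R) * young_coeff (Suc m) \<sigma> U T) * psi_coeff T R') =
      (\<Sum>\<nu>\<in>L. sqrt (weight \<nu>) * (\<Sum>\<kappa>\<in>L. sqrt (weight \<kappa>) * ?K \<kappa> \<nu>))"
    by (simp add: sum_psi_coeff R mult.commute[of "psi_coeff _ R"])
  also have "\<dots> = (\<Sum>\<nu>\<in>L. weight \<nu> * ?K \<nu> \<nu>)"
  proof (rule sum.cong[OF refl])
    fix \<nu> assume \<nu>: "\<nu> \<in> L"
    have "?K \<kappa> \<nu> = 0" if "\<kappa> \<in> L" "\<kappa> \<noteq> \<nu>" for \<kappa>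
      by (rule young_coeff_distinct_summands[OF assms that(1) \<nu> that(2)
        extend_Tab[OF that(1) R(1)] extend_Tab[OF \<nu> R(2)]])
    hence "(\<Sum>\<kappa>\<in>L. sqrt (weight \<kappa>) * ?K \<kappa> \<nu>) = sqrt (weight \<nu>) * ?K \<nu> \<nu>"
      by (intro sum_one_summand[OF \<nu>]) simp
    thus "sqrt (weight \<nu>) * (\<Sum>\<kappa>\<in>L. sqrt (weight \<kappa>) * ?K \<kappa> \<nu>) = weight \<nu> * ?K \<nu> \<nu>"
      using weight_nonneg by (simp flip: mult.assoc)
  qed
  finally show "(\<Sum>T\<in>Tabs L. (\<Sum>U\<in>Tabs L. conjugate (psi_coeff U R) * young_coeff (Suc m) \<sigma> U T) * psi_coeff T R') =
      (\<Sum>\<nu>\<in>L. weight \<nu> * ?K \<nu> \<nu>)" .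
qed

lemma rep_sum_id: "rep_sum L id = 1\<^sub>m (d_sum L)"
  by (simp only: rep_sum_eq[OF permutes_id] young_mat_id card_Tabs)

lemma rep_sum_carrier: "\<sigma> permutes {1..Suc m} \<Longrightarrow> rep_sum L \<sigma> \<in> carrier_mat (d_sum L) (d_sum L)"
  using young_mat_carrier by (simp only: rep_sum_eq flip: card_Tabs)

lemma Psi_sum_carrier: "Psi_sum L \<mu> \<in> carrier_mat (d_sum L) (d_tab \<mu>)"
  unfolding Psi_sum_eq d_tab_def card_Tabs[symmetric] by (rule kernel_mat_carrier)

lemma Psi_sum_isometry: "isometry_mat (d_sum L) (d_tab \<mu>) (Psi_sum L \<mu>)"
proof -
  have "mat_adjoint (Psi_sum L \<mu>) * Psi_sum L \<mu> = compress (Psi_sum L \<mu>) (Psi_sum L \<mu>) (rep_sum L id)"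
    using Psi_sum_carrier by (auto simp: compress_def rep_sum_id)
  also have "\<dots> = kernel_mat (Tab \<mu>) (Tab \<mu>) (\<lambda>R R'. if R = R' then 1 else 0)"
    unfolding compress_rep_sum[OF permutes_id]
    by (rule kernel_mat_cong) (auto simp: young_coeff_id extend_eq_iff sum_weight simp del: fun_upd_apply)
  finally have "mat_adjoint (Psi_sum L \<mu>) * Psi_sum L \<mu> = 1\<^sub>m (d_tab \<mu>)"
    unfolding d_tab_def one_mat_eq_kernel_mat[OF finite_Tab_\<mu>] .
  thus ?thesis using Psi_sum_carrier by (simp add: isometry_mat_def)
qed

lemma Psi_sum_adjoint_equivariant:
  assumes h: "h permutes {1..m}"
  shows "mat_adjoint (Psi_sum L \<mu>) * rep_sum L h = young_mat m (Tab \<mu>) h * mat_adjoint (Psi_sum L \<mu>)"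
  unfolding Psi_sum_eq rep_sum_eq[OF permutes_Suc[OF h]] young_mat_def adjoint_kernel_mat
    kernel_mat_mult[OF finite_family] kernel_mat_mult[OF finite_Tab_\<mu>]
proof (rule kernel_mat_cong)
  fix R T assume R: "R \<in> Tab \<mu>"
  have "(\<Sum>U\<in>Tabs L. conjugate (psi_coeff U R) * young_coeff (Suc m) h U T) =
      (\<Sum>\<nu>\<in>L. sqrt (weight \<nu>) * young_coeff (Suc m) h (extend \<nu> R) T)"
    using sum_psi_coeff[OF R, of "\<lambda>U. young_coeff (Suc m) h U T"]
    by (simp add: mult.commute del: fun_upd_apply)
  also have "\<dots> = (\<Sum>\<nu>\<in>L. \<Sum>R'\<in>Tab \<mu>. young_coeff m h R R' * (if T = extend \<nu> R' then sqrt (weight \<nu>) else 0))"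
    using young_coeff_extend[OF h new_box_addable R[unfolded Tab_\<mu>], of _ T]
    by (intro sum.cong) (auto simp: Tab_\<mu> sum_distrib_left intro!: sum.cong)
  also have "\<dots> = (\<Sum>R'\<in>Tab \<mu>. young_coeff m h R R' * conjugate (psi_coeff T R'))"
    by (subst sum.swap) (simp add: psi_coeff_def sum_distrib_left)
  finally show "(\<Sum>U\<in>Tabs L. conjugate (psi_coeff U R) * young_coeff (Suc m) h U T) =
      (\<Sum>R'\<in>Tab \<mu>. young_coeff m h R R' * conjugate (psi_coeff T R'))" .
qed

lemma Psi_sum_intertwines:
  assumes h: "h permutes {1..m}"
  shows "intertwines (Psi_sum L \<mu>) (Psi_sum L \<mu>) (rep_sum L h)"
proof -
  let ?\<Psi> = "Psi_sum L \<mu>" and ?K = "young_mat m (Tab \<mu>)"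
  note inv = permutes_inv[OF h]
  note dims = carrier_matD[OF Psi_sum_carrier] carrier_matD[OF rep_sum_carrier[OF permutes_Suc[OF h]]]
    carrier_matD[OF rep_sum_carrier[OF permutes_Suc[OF inv]]]
  have adjoint: "mat_adjoint (rep_sum L (inv' h)) = rep_sum L h" "mat_adjoint (?K (inv' h)) = ?K h"
    using young_mat_adjoint[OF permutes_Suc[OF inv]]
      tableau_family.young_mat_adjoint[OF tableau_family_Tab[OF partition] inv]
    by (simp_all only: rep_sum_eq permutes_Suc h inv permutes_inv_inv[OF h])
  have "mat_adjoint (mat_adjoint ?\<Psi> * rep_sum L (inv' h)) = mat_adjoint (?K (inv' h) * mat_adjoint ?\<Psi>)"
    by (simp only: Psi_sum_adjoint_equivariant[OF inv])
  hence "rep_sum L h * ?\<Psi> = ?\<Psi> * ?K h"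
    by (simp add: adjoint_mult dims adjoint d_tab_def[symmetric])
  thus ?thesis
    using Psi_sum_adjoint_equivariant[OF h]
    by (simp add: intertwines_def dims mult_mat_assoc d_tab_def[symmetric] flip: mult_mat_assoc[of "rep_sum L h"])
qed

definition swap_eigenvalue :: "tableau \<Rightarrow> real" where
  "swap_eigenvalue R = (\<Sum>\<nu>\<in>L. weight \<nu> / of_int (superdiagonal (new_box \<nu>) - content R m))"

lemma compress_top_swap:
  assumes m: "1 \<le> m"
  shows "compress (Psi_sum L \<mu>) (Psi_sum L \<mu>) (rep_sum L (adj_transp m)) =
    kernel_mat (Tab \<mu>) (Tab \<mu>) (\<lambda>R R'. if R = R' then swap_eigenvalue R else 0)"
  unfolding compress_rep_sum[OF adj_transp_permutes[OF m lessI]]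
proof (rule kernel_mat_cong)
  fix R R' assume R: "R \<in> Tab \<mu>" "R' \<in> Tab \<mu>"
  have "young_coeff (Suc m) (adj_transp m) (extend \<nu> R) (extend \<nu> R') =
      (if R = R' then 1 / of_int (superdiagonal (new_box \<nu>) - content R m) else 0)" if \<nu>: "\<nu> \<in> L" for \<nu>
  proof -
    note RS = R[unfolded Tab_\<mu>] and addable = new_box_addable[OF \<nu>]
    note boxes = box_of_extend[OF RS(1) addable] box_of_extend[OF RS(2) addable]
    have "box_of (extend \<nu> R) (Suc m) \<noteq> box_of (adj_transp m \<circ> extend \<nu> R') (Suc m)"
      using boxes(1) boxes(4)[of m] m addable_young(2)[OF addable]
        box_of_SYT(2)[OF SYT_shapeD(1)[OF RS(2)], of m] SYT_shapeD(2)[OF RS(2)]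
      by (auto simp: box_of_adj_transp simp del: fun_upd_apply)
    hence "extend \<nu> R \<noteq> adj_transp m \<circ> extend \<nu> R'" by auto
    moreover have "axial_step (extend \<nu> R') m = superdiagonal (new_box \<nu>) - content R' m"
      using content_extend[OF RS(2) addable] m by (simp add: axial_step_def)
    moreover have "extend \<nu> R \<in> SYT (Suc m)" by (rule family_SYT[OF extend_Tabs[OF \<nu> R(1)]])
    ultimately show ?thesis
      using m by (simp add: young_coeff_adj_transp extend_eq_iff[OF \<nu> \<nu> R] del: fun_upd_apply)
  qed
  thus "(\<Sum>\<nu>\<in>L. weight \<nu> * young_coeff (Suc m) (adj_transp m) (extend \<nu> R) (extend \<nu> R')) =
      (if R = R' then swap_eigenvalue R else 0)"
    by (simp add: swap_eigenvalue_def)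
qed

end

section \<open>Tightness\<close>

locale young_frame = induced_rep +
  fixes t :: "nat \<Rightarrow> nat \<Rightarrow> nat"
  assumes transversal: "\<And>k. k \<in> {1..Suc m} \<Longrightarrow> t k permutes {1..Suc m}"
    "\<And>k. k \<in> {1..Suc m} \<Longrightarrow> t k (Suc m) = k"
begin

sublocale orbit_frame "Suc m" "d_sum L" "d_tab \<mu>" "carrier (sym_group (Suc m))" "rep_sum L" "Psi_sum L \<mu>" t
proof (rule orbit_frame.intro)
  show "subgroup (carrier (sym_group (Suc m))) (sym_group (Suc m))"
    by (rule group.subgroup_self[OF sym_group_is_group])
  show "rep_sum L (g \<circ> h) = rep_sum L g * rep_sum L h"
    if "g \<in> carrier (sym_group (Suc m))" "h \<in> carrier (sym_group (Suc m))" for g h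
    using that by (simp only: sym_group_carrier rep_sum_eq permutes_compose young_mat_comp)
  show "mat_adjoint (rep_sum L g) = rep_sum L (inv' g)" if "g \<in> carrier (sym_group (Suc m))" for g
    using that by (simp only: sym_group_carrier rep_sum_eq permutes_inv young_mat_adjoint)
  show "intertwines (Psi_sum L \<mu>) (Psi_sum L \<mu>) (rep_sum L h)"
    if "h \<in> carrier (sym_group (Suc m))" "h (Suc m) = Suc m" for h
    by (rule Psi_sum_intertwines[OF permutes_fixing_top[of h m, OF _ that(2)]])
      (use that(1) in \<open>simp only: sym_group_carrier\<close>)
qed (use transversal rep_sum_carrier rep_sum_id Psi_sum_isometry in
  \<open>simp_all add: sym_group_carrier del: atLeastAtMost_iff\<close>)

definition frame_coeff :: "nat \<Rightarrow> tableau \<Rightarrow> tableau \<Rightarrow> real" where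
  "frame_coeff k T R = (\<Sum>\<nu>\<in>L. sqrt (weight \<nu>) * young_coeff (Suc m) (t k) T (extend \<nu> R))"

definition frame_kernel :: "tableau \<Rightarrow> tableau \<Rightarrow> real" where
  "frame_kernel S T = (\<Sum>k\<in>{1..Suc m}. \<Sum>R\<in>Tab \<mu>. frame_coeff k S R * frame_coeff k T R)"

lemma frame_map_eq: "k \<in> {1..Suc m} \<Longrightarrow> frame_map k = kernel_mat (Tabs L) (Tab \<mu>) (frame_coeff k)"
  unfolding frame_map_def
  unfolding rep_sum_eq[OF transversal(1)] young_mat_def Psi_sum_eq kernel_mat_mult[OF finite_family]
    frame_coeff_def
  by (intro kernel_mat_cong sum_psi_coeff)

lemma frame_op_eq: "frame_op = kernel_mat (Tabs L) (Tabs L) frame_kernel"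
proof -
  have "frame_map k * mat_adjoint (frame_map k) =
      kernel_mat (Tabs L) (Tabs L) (\<lambda>S T. \<Sum>R\<in>Tab \<mu>. frame_coeff k S R * frame_coeff k T R)"
    if "k \<in> {1..Suc m}" for k
    by (simp add: frame_map_eq[OF that] adjoint_kernel_mat kernel_mat_mult[OF finite_Tab_\<mu>])
  thus ?thesis
    unfolding frame_op_def frame_kernel_def mat_sum_kernel_mat[symmetric] card_Tabs by (rule mat_sum_cong)
qed

sublocale commuting_kernel "Suc m" "Tabs L" frame_kernel
proof
  fix k S T assume k: "1 \<le> k" "k < Suc m" and ST: "S \<in> Tabs L" "T \<in> Tabs L"
  have perm: "adj_transp k permutes {1..Suc m}" by (rule adj_transp_permutes[OF k])
  hence "rep_sum L (adj_transp k) * frame_op = frame_op * rep_sum L (adj_transp k)"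
    using frame_op_commutes[of "adj_transp k"] by (simp only: sym_group_carrier)
  hence "\<forall>S\<in>Tabs L. \<forall>T\<in>Tabs L.
      (\<Sum>U\<in>Tabs L. young_coeff (Suc m) (adj_transp k) S U * frame_kernel U T) =
      (\<Sum>U\<in>Tabs L. frame_kernel S U * young_coeff (Suc m) (adj_transp k) U T)"
    unfolding rep_sum_eq[OF perm] young_mat_def frame_op_eq kernel_mat_mult[OF finite_family]
      kernel_mat_eq_iff[OF finite_family finite_family] .
  from bspec[OF bspec[OF this ST(1)] ST(2)]
  show "(\<Sum>U\<in>Tabs L. young_coeff (Suc m) (adj_transp k) S U * frame_kernel U T) =
      (\<Sum>U\<in>Tabs L. frame_kernel S U * young_coeff (Suc m) (adj_transp k) U T)" .
qed

lemma frame_coeff_summand: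
  assumes "k \<in> {1..Suc m}" "\<nu> \<in> L" "T \<in> Tab \<nu>" "R \<in> Tab \<mu>"
  shows "frame_coeff k T R = sqrt (weight \<nu>) * young_coeff (Suc m) (t k) T (extend \<nu> R)"
  unfolding frame_coeff_def
  using young_coeff_distinct_summands[OF transversal(1)[OF assms(1)] assms(2) _ _ assms(3)
    extend_Tab[OF _ assms(4)]]
  by (intro sum_one_summand[OF assms(2)]) simp

lemma frame_kernel_trace:
  assumes \<nu>: "\<nu> \<in> L"
  shows "(\<Sum>T\<in>Tab \<nu>. frame_kernel T T) = real (Suc m) * real (d_tab \<mu>) * weight \<nu>"
proof -
  interpret summand: tableau_family "Suc m" "Tab \<nu>" by (rule tableau_family_Tab[OF L_partition[OF \<nu>]])
  have column: "(\<Sum>T\<in>Tab \<nu>. frame_coeff k T R * frame_coeff k T R) = weight \<nu>"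
    if k: "k \<in> {1..Suc m}" and R: "R \<in> Tab \<mu>" for k R
  proof -
    have "frame_coeff k T R * frame_coeff k T R = weight \<nu> * (young_coeff (Suc m) (t k) T (extend \<nu> R))\<^sup>2"
      if "T \<in> Tab \<nu>" for T
      using weight_nonneg[of \<nu>]
      by (simp add: frame_coeff_summand[OF k \<nu> that R] power_mult_distrib
        flip: power2_eq_square del: fun_upd_apply)
    thus ?thesis
      by (simp add: summand.young_coeff_unit_column[OF transversal(1)[OF k] extend_Tab[OF \<nu> R]]
          flip: sum_distrib_left del: fun_upd_apply)
  qed
  have "(\<Sum>T\<in>Tab \<nu>. frame_kernel T T) =
      (\<Sum>k\<in>{1..Suc m}. \<Sum>R\<in>Tab \<mu>. \<Sum>T\<in>Tab \<nu>. frame_coeff k T R * frame_coeff k T R)"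
    unfolding frame_kernel_def by (rule trans[OF sum.swap sum.cong[OF refl sum.swap]])
  also have "\<dots> = (\<Sum>k\<in>{1..Suc m}. \<Sum>R\<in>Tab \<mu>. weight \<nu>)"
    by (intro sum.cong refl column)
  finally show ?thesis by (simp add: d_tab_def)
qed

lemma frame_kernel_value:
  assumes "S \<in> Tabs L"
  shows "frame_kernel S S = real (Suc m) * real (d_tab \<mu>) / real (d_sum L)"
proof -
  obtain \<nu> where \<nu>: "\<nu> \<in> L" "S \<in> Tab \<nu>" using assms by (auto simp: Tabs_def)
  have "frame_kernel T T = frame_kernel S S" if "T \<in> Tab \<nu>" for T
    using kernel_constant_on_shape[OF assms, of T] that \<nu> by (simp add: Tab_L SYT_shape_def)
  hence "real (d_tab \<nu>) * frame_kernel S S = (\<Sum>T\<in>Tab \<nu>. frame_kernel T T)"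
    by (simp add: d_tab_def)
  also have "\<dots> = real (d_tab \<nu>) * (real (Suc m) * real (d_tab \<mu>) / real (d_sum L))"
    by (simp add: frame_kernel_trace[OF \<nu>(1)] weight_def)
  finally show ?thesis
    using d_tab_pos[OF L_partition[OF \<nu>(1)]] by (simp only: mult_cancel_left of_nat_eq_0_iff) simp
qed

lemma frame_op_scalar: "frame_op = (real (Suc m) * real (d_tab \<mu>) / real (d_sum L)) \<cdot>\<^sub>m 1\<^sub>m (d_sum L)"
  unfolding frame_op_eq
  unfolding card_Tabs[symmetric] smult_one_mat_eq_kernel_mat[OF finite_family]
  by (rule kernel_mat_cong) (simp add: card_Tabs frame_kernel_value kernel_diagonal del: of_nat_Suc)

end

section \<open>Isoclinic partitions\<close>

lemma permutes_double_coset: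
  assumes \<sigma>: "\<sigma> permutes {1..Suc m}" "\<sigma> (Suc m) \<noteq> Suc m" and m: "1 \<le> m"
  obtains h h' where "h permutes {1..m}" "h' permutes {1..m}" "\<sigma> = h \<circ> adj_transp m \<circ> h'"
proof -
  define k where "k = \<sigma> (Suc m)"
  have k: "k \<in> {1..m}" using permutes_in_image[OF \<sigma>(1), of "Suc m"] \<sigma>(2) by (auto simp: k_def)
  define h where "h = Transposition.transpose k m"
  have h: "h permutes {1..m}" unfolding h_def using k m by (intro permutes_swap_id) auto
  have moved: "h \<circ> adj_transp m permutes {1..Suc m}"
    by (rule permutes_compose[OF adj_transp_permutes[OF m lessI] permutes_Suc[OF h]])
  define h' where "h' = inv' (h \<circ> adj_transp m) \<circ> \<sigma>"
  have "(h \<circ> adj_transp m) (Suc m) = k" by (simp add: h_def)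
  hence "h' (Suc m) = Suc m"
    using permutes_inverses(2)[OF moved, of "Suc m"] by (simp add: h'_def k_def)
  hence "h' permutes {1..m}"
    unfolding h'_def by (intro permutes_fixing_top[OF permutes_compose[OF \<sigma>(1) permutes_inv[OF moved]]])
  moreover have "\<sigma> = h \<circ> adj_transp m \<circ> h'"
    unfolding h'_def by (simp add: comp_assoc[symmetric] permutes_inv_o(1)[OF moved])
  ultimately show ?thesis using h that by blast
qed

context young_frame
begin

lemma compressed_top_swap:
  assumes "1 \<le> m"
  shows "compressed (adj_transp m) = kernel_mat (Tab \<mu>) (Tab \<mu>) (\<lambda>R R'. if R = R' then swap_eigenvalue R else 0)"
  unfolding compressed_def by (rule compress_top_swap[OF assms])

lemma compressed_top_swap_square:
  assumes m: "1 \<le> m"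
  shows "mat_adjoint (compressed (adj_transp m)) * compressed (adj_transp m) = \<alpha> \<cdot>\<^sub>m 1\<^sub>m (d_tab \<mu>) \<longleftrightarrow>
    (\<forall>R\<in>Tab \<mu>. (swap_eigenvalue R)\<^sup>2 = \<alpha>)"
proof -
  have diagonal: "(\<Sum>U\<in>Tab \<mu>.
        (if U = R then swap_eigenvalue U else 0) * (if U = R' then swap_eigenvalue U else 0)) =
      (if R = R' then (swap_eigenvalue R)\<^sup>2 else 0)" if "R \<in> Tab \<mu>" for R R'
  proof -
    have "(\<Sum>U\<in>Tab \<mu>. (if U = R then swap_eigenvalue U else 0) * (if U = R' then swap_eigenvalue U else 0)) =
        (\<Sum>U\<in>Tab \<mu>. if U = R then (if R = R' then (swap_eigenvalue R)\<^sup>2 else 0) else 0)"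
      by (intro sum.cong refl) (auto simp: power2_eq_square)
    thus ?thesis using that finite_Tab_\<mu> by simp
  qed
  have "mat_adjoint (compressed (adj_transp m)) * compressed (adj_transp m) =
      kernel_mat (Tab \<mu>) (Tab \<mu>) (\<lambda>R R'. if R = R' then (swap_eigenvalue R)\<^sup>2 else 0)"
    unfolding compressed_top_swap[OF m] adjoint_kernel_mat kernel_mat_mult[OF finite_Tab_\<mu>]
    by (rule kernel_mat_cong) (simp add: diagonal)
  thus ?thesis
    unfolding d_tab_def smult_one_mat_eq_kernel_mat[OF finite_Tab_\<mu>]
    by (auto simp: kernel_mat_eq_iff[OF finite_Tab_\<mu> finite_Tab_\<mu>])
qed

lemma compressed_square_iff:
  assumes m: "1 \<le> m" and g: "g permutes {1..Suc m}" "g (Suc m) \<noteq> Suc m"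
  shows "mat_adjoint (compressed g) * compressed g = \<alpha> \<cdot>\<^sub>m 1\<^sub>m (d_tab \<mu>) \<longleftrightarrow>
    (\<forall>R\<in>Tab \<mu>. (swap_eigenvalue R)\<^sup>2 = \<alpha>)"
proof -
  obtain h h' where h: "h permutes {1..m}" "h' permutes {1..m}" and factors: "g = h \<circ> adj_transp m \<circ> h'"
    using permutes_double_coset[OF g m] by blast
  have fixes_top: "h (Suc m) = Suc m" "h' (Suc m) = Suc m"
    using h by (auto intro: permutes_not_in)
  have group: "h \<in> carrier (sym_group (Suc m))" "h' \<in> carrier (sym_group (Suc m))"
    "adj_transp m \<in> carrier (sym_group (Suc m))"
    unfolding sym_group_carrier
    by (rule permutes_Suc[OF h(1)] permutes_Suc[OF h(2)] adj_transp_permutes[OF m lessI])+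
  have "compressed g = compressed h * compressed (adj_transp m) * compressed h'"
    unfolding factors compressed_comp_right[OF G_comp[OF group(1,3)] group(2) fixes_top(2)]
      compressed_comp_left[OF group(3,1) fixes_top(1)] ..
  thus ?thesis
    by (simp only: gram_square_unitary[OF compressed_unitary[OF group(1) fixes_top(1)]
          compressed_unitary[OF group(2) fixes_top(2)] compressed_carrier] compressed_top_swap_square[OF m])
qed

lemma equi_isoclinic_iff_swap_eigenvalue:
  assumes m: "1 \<le> m"
  shows "equi_isoclinic (Suc m) (d_tab \<mu>) (d_sum L) subspace \<longleftrightarrow>
    (\<exists>\<alpha>. \<forall>R\<in>Tab \<mu>. (swap_eigenvalue R)\<^sup>2 = \<alpha>)"
proof -
  have "(\<forall>g\<in>carrier (sym_group (Suc m)). g (Suc m) \<noteq> Suc m \<longrightarrow>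
        mat_adjoint (compressed g) * compressed g = \<alpha> \<cdot>\<^sub>m 1\<^sub>m (d_tab \<mu>)) \<longleftrightarrow>
      (\<forall>R\<in>Tab \<mu>. (swap_eigenvalue R)\<^sup>2 = \<alpha>)" (is "?squares \<longleftrightarrow> ?eigenvalues") for \<alpha>
  proof
    assume ?squares
    hence "mat_adjoint (compressed (adj_transp m)) * compressed (adj_transp m) = \<alpha> \<cdot>\<^sub>m 1\<^sub>m (d_tab \<mu>)"
      using adj_transp_permutes[OF m lessI] by (simp add: sym_group_carrier)
    thus ?eigenvalues by (simp only: compressed_top_swap_square[OF m])
  next
    assume ?eigenvalues
    thus ?squares
      by (intro ballI impI) (simp only: sym_group_carrier compressed_square_iff[OF m] not_False_eq_True)
  qed
  thus ?thesis by (simp only: equi_isoclinic_subspace_iff)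
qed

lemma subspace_eq: "k \<in> {1..Suc m} \<Longrightarrow> subspace k = mat_image (rep_sum L (t k)) (W_sub L \<mu>)"
  unfolding subspace_def frame_map_def W_sub_def
  by (rule mat_image_mult[OF rep_sum_carrier[OF transversal(1)] Psi_sum_carrier])

end

lemma parseval_unitary_term:
  fixes B :: "'k \<Rightarrow> real mat"
  assumes finite: "finite K" and B: "\<And>k. k \<in> K \<Longrightarrow> B k \<in> carrier_mat r s"
    and parseval: "mat_sum r K (\<lambda>k. B k * mat_adjoint (B k)) = 1\<^sub>m r"
    and l: "l \<in> K" "B l * mat_adjoint (B l) = 1\<^sub>m r" and k: "k \<in> K" "k \<noteq> l"
  shows "B k = 0\<^sub>m r s"
proof (rule eq_matI)
  fix i j assume "i < dim_row (0\<^sub>m r s :: real mat)" "j < dim_col (0\<^sub>m r s :: real mat)"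
  hence ij: "i < r" "j < s" by simp_all
  let ?row = "\<lambda>k. (B k * mat_adjoint (B k)) $$ (i, i)"
  have row: "?row k = (\<Sum>j<s. (B k $$ (i, j))\<^sup>2)" if "k \<in> K" for k
    using B[OF that] ij by (simp add: mat_adjoint_eq_mat scalar_prod_def lessThan_atLeast0 power2_eq_square)
  have "(\<Sum>k\<in>K. ?row k) = mat_sum r K (\<lambda>k. B k * mat_adjoint (B k)) $$ (i, i)"
    using ij by (simp add: mat_sum_def)
  also have "\<dots> = ?row l" unfolding parseval l(2) ..
  finally have "(\<Sum>k\<in>K - {l}. ?row k) = 0"
    using sum.remove[OF finite l(1), of ?row] by simp
  hence "?row k = 0"
    using sum_nonneg_eq_0_iff[of "K - {l}" ?row] finite k row by (simp add: sum_nonneg)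
  hence "(B k $$ (i, j))\<^sup>2 = 0"
    using row[OF k(1)] sum_nonneg_eq_0_iff[of "{..<s}" "\<lambda>j. (B k $$ (i, j))\<^sup>2"] ij by simp
  thus "B k $$ (i, j) = 0\<^sub>m r s $$ (i, j)" using ij by simp
qed (use B[OF k(1)] in auto)

text \<open>For \<open>L = \<mu>\<^sup>\<up>\<close> the dimensions add up to \<open>n d\<^sub>\<mu>\<close>, so the \<open>n\<close> projections sum to the identity
  and the subspaces are orthogonal.\<close>

lemma (in young_frame) compressed_transversal_zero:
  assumes full: "L = up_set \<mu>" and k: "k \<in> {1..m}"
  shows "compressed (t k) = 0\<^sub>m (d_tab \<mu>) (d_tab \<mu>)"
proof (rule parseval_unitary_term[where K = "{1..Suc m}" and l = "Suc m" and B = "\<lambda>k. compressed (t k)"])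
  let ?\<Psi> = "Psi_sum L \<mu>" and ?r = "d_tab \<mu>"
  have in_G: "t k \<in> carrier (sym_group (Suc m))" if "k \<in> {1..Suc m}" for k
    by (rule t_in[OF that])
  have "compressed (t k) * mat_adjoint (compressed (t k)) =
      mat_adjoint ?\<Psi> * (frame_map k * mat_adjoint (frame_map k)) * ?\<Psi>" if "k \<in> {1..Suc m}" for k
    using in_G[OF that]
    by (simp add: compressed_def compress_def frame_map_def adjoint_mult mult_mat_assoc)
  hence "mat_sum ?r {1..Suc m} (\<lambda>k. compressed (t k) * mat_adjoint (compressed (t k))) =
      mat_sum ?r {1..Suc m} (\<lambda>k. mat_adjoint ?\<Psi> * (frame_map k * mat_adjoint (frame_map k)) * ?\<Psi>)"
    by (rule mat_sum_cong)
  also have "\<dots> = mat_adjoint ?\<Psi> * frame_op * ?\<Psi>"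
    unfolding frame_op_def
    by (rule mat_sum_sandwich[symmetric, OF adjoint_carrier[OF Psi_sum_carrier] Psi_sum_carrier
      frame_map_square_carrier])
  also have "frame_op = 1 \<cdot>\<^sub>m 1\<^sub>m (d_sum L)"
  proof -
    have "real (Suc m) * real ?r = real (d_sum L)" by (simp only: full d_sum_up_set[OF partition] of_nat_mult)
    thus ?thesis using d_sum_pos by (simp add: frame_op_scalar del: of_nat_Suc)
  qed
  also have "mat_adjoint ?\<Psi> * (1 \<cdot>\<^sub>m 1\<^sub>m (d_sum L)) * ?\<Psi> = 1 \<cdot>\<^sub>m 1\<^sub>m ?r"
    using compress_smult_one[OF Psi_sum_isometry, of 1] by (simp only: compress_def)
  also have "\<dots> = 1\<^sub>m ?r" by (rule eq_matI) simp_all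
  finally show "mat_sum ?r {1..Suc m} (\<lambda>k. compressed (t k) * mat_adjoint (compressed (t k))) = 1\<^sub>m ?r" .
  have top: "Suc m \<in> {1..Suc m}" by simp
  show "compressed (t (Suc m)) * mat_adjoint (compressed (t (Suc m))) = 1\<^sub>m ?r"
    using compressed_unitary[OF in_G[OF top] transversal(2)[OF top]] by (simp add: unitary_mat_def)
qed (use k compressed_carrier in auto)

lemma (in induced_rep) swap_eigenvalue_full:
  assumes full: "L = up_set \<mu>" and m: "1 \<le> m" and R: "R \<in> Tab \<mu>"
  shows "swap_eigenvalue R = 0"
proof -
  let ?t = "\<lambda>k. Transposition.transpose k (Suc m)"
  interpret young_frame m \<mu> L ?t
    by unfold_locales (auto intro: permutes_swap_id)
  have "kernel_mat (Tab \<mu>) (Tab \<mu>) (\<lambda>R R'. if R = R' then swap_eigenvalue R else 0) =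
      0\<^sub>m (d_tab \<mu>) (d_tab \<mu>)"
    using compressed_transversal_zero[OF full, of m] compressed_top_swap[OF m] m by (simp add: adj_transp_def)
  also have "\<dots> = 0 \<cdot>\<^sub>m 1\<^sub>m (card (Tab \<mu>))" by (rule eq_matI) (simp_all add: d_tab_def)
  finally have "kernel_mat (Tab \<mu>) (Tab \<mu>) (\<lambda>R R'. if R = R' then swap_eigenvalue R else 0) =
      0 \<cdot>\<^sub>m 1\<^sub>m (card (Tab \<mu>))" .
  hence "\<forall>R\<in>Tab \<mu>. \<forall>R'\<in>Tab \<mu>. (if R = R' then swap_eigenvalue R else 0) = (if R = R' then 0 else 0)"
    unfolding smult_one_mat_eq_kernel_mat[OF finite_Tab_\<mu>] kernel_mat_eq_iff[OF finite_Tab_\<mu> finite_Tab_\<mu>] .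
  from bspec[OF bspec[OF this R] R] show ?thesis by simp
qed

subsection \<open>Sums over interlaced poles\<close>

locale interlaced_poles =
  fixes M :: nat and c w x :: "nat \<Rightarrow> real"
  assumes poles_decreasing: "\<And>i j. i < j \<Longrightarrow> j < M \<Longrightarrow> c j < c i"
    and weights_positive: "\<And>i. i < M \<Longrightarrow> 0 < w i"
    and interlaced: "\<And>i. Suc i < M \<Longrightarrow> c (Suc i) < x i" "\<And>i. Suc i < M \<Longrightarrow> x i < c i"
    and balanced: "\<And>i. Suc i < M \<Longrightarrow> (\<Sum>j<M. w j / (c j - x i)) = 0"
begin

definition pole_sum :: "nat set \<Rightarrow> nat \<Rightarrow> real" where
  "pole_sum J i = (\<Sum>j\<in>J. w j / (c j - x i))"

lemma poles_antimono: "i \<le> j \<Longrightarrow> j < M \<Longrightarrow> c j \<le> c i"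
  using poles_decreasing[of i j] by (cases "i = j") auto

lemma pole_sum_increasing:
  assumes J: "J \<subseteq> {..<M}" "J \<noteq> {}" "Suc i \<notin> J" and i: "Suc (Suc i) < M"
  shows "pole_sum J (Suc i) < pole_sum J i"
  unfolding pole_sum_def
proof (rule sum_strict_mono)
  show "finite J" using J(1) finite_subset by blast
  show "J \<noteq> {}" by (rule J(2))
  fix j assume "j \<in> J"
  hence j: "j < M" "j \<noteq> Suc i" using J by auto
  have order: "c (Suc (Suc i)) < x (Suc i)" "x (Suc i) < c (Suc i)" "c (Suc i) < x i" "x i < c i"
    using interlaced i by simp_all
  show "w j / (c j - x (Suc i)) < w j / (c j - x i)"
  proof (cases "j \<le> i")
    case True
    hence "c i \<le> c j" using i by (intro poles_antimono) simp_all
    thus ?thesis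
      using order weights_positive[OF j(1)] by (intro divide_strict_left_mono mult_pos_pos) simp_all
  next
    case False
    hence "c j \<le> c (Suc (Suc i))" using j by (intro poles_antimono) simp_all
    hence "c j - x i < c j - x (Suc i)" "c j - x (Suc i) < 0" using order by simp_all
    thus ?thesis
      using weights_positive[OF j(1)] by (intro divide_strict_left_mono mult_neg_neg) simp_all
  qed
qed

lemma pole_sum_below_first:
  assumes J: "J \<subseteq> {..<M}" "J \<noteq> {}" "0 \<notin> J" and M: "2 \<le> M"
  shows "pole_sum J 0 < 0"
proof -
  have "0 < - (w j / (c j - x 0))" if "j \<in> J" for j
  proof -
    have j: "j < M" "Suc 0 \<le> j" using that J by (auto intro: gr0I simp: Suc_le_eq)
    have "c j - x 0 < 0" using poles_antimono[OF j(2,1)] interlaced(1)[of 0] M by simp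
    thus ?thesis using weights_positive[OF j(1)] by (simp add: divide_pos_neg)
  qed
  hence "0 < (\<Sum>j\<in>J. - (w j / (c j - x 0)))"
    using J finite_subset[OF J(1)] by (intro sum_pos) simp_all
  thus ?thesis by (simp add: pole_sum_def sum_negf)
qed

lemma pole_sum_above_last:
  assumes J: "J \<subseteq> {..<M}" "J \<noteq> {}" "Suc i \<notin> J" and i: "Suc (Suc i) = M"
  shows "0 < pole_sum J i"
  unfolding pole_sum_def
proof (rule sum_pos)
  fix j assume "j \<in> J"
  hence j: "j < M" "j \<noteq> Suc i" using J by auto
  hence "c i \<le> c j" using i by (intro poles_antimono) simp_all
  thus "0 < w j / (c j - x i)"
    using interlaced(2)[of i] i weights_positive[OF j(1)] by (intro divide_pos_pos) simp_all
qed (use J finite_subset in auto)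

text \<open>A sum omitting a pole increases across it, and vanishes at infinity; so if its absolute value is
  the same in all gaps, then it is negative just below and positive just above the omitted pole.\<close>

lemma pole_sum_sign_at_omitted:
  assumes J: "J \<subseteq> {..<M}" "J \<noteq> {}"
    and square: "\<And>i. Suc i < M \<Longrightarrow> (pole_sum J i)\<^sup>2 = \<beta>" and i: "Suc i < M"
  shows "i \<notin> J \<Longrightarrow> pole_sum J i < 0" and "Suc i \<notin> J \<Longrightarrow> 0 < pole_sum J i"
proof -
  have flip: "pole_sum J (Suc i) = - pole_sum J i"
    if "Suc i \<notin> J" "Suc (Suc i) < M" for i
  proof -
    have "(pole_sum J (Suc i))\<^sup>2 = (pole_sum J i)\<^sup>2" using square that(2) by simp
    thus ?thesis using pole_sum_increasing[OF J that] by (simp add: power2_eq_iff)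
  qed
  show "pole_sum J i < 0" if "i \<notin> J"
  proof (cases i)
    case 0
    thus ?thesis using pole_sum_below_first[OF J] that i by simp
  next
    case (Suc k)
    thus ?thesis using flip[of k] pole_sum_increasing[OF J, of k] that i by simp
  qed
  show "0 < pole_sum J i" if "Suc i \<notin> J"
  proof (cases "Suc (Suc i) < M")
    case True
    thus ?thesis using flip[OF that] pole_sum_increasing[OF J that] by simp
  next
    case False
    thus ?thesis using pole_sum_above_last[OF J that] i by simp
  qed
qed

theorem pole_sum_alternation:
  assumes I: "I \<subseteq> {..<M}" "I \<noteq> {}" "I \<noteq> {..<M}"
    and square: "\<And>i. Suc i < M \<Longrightarrow> (pole_sum I i)\<^sup>2 = \<beta>" and i: "Suc i < M"
  shows "i \<in> I \<longleftrightarrow> Suc i \<notin> I"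
proof -
  let ?I' = "{..<M} - I"
  have square': "(pole_sum ?I' k)\<^sup>2 = \<beta>" if "Suc k < M" for k
  proof -
    have "pole_sum ?I' k = - pole_sum I k"
      using balanced[OF that] sum.subset_diff[OF I(1), of "\<lambda>j. w j / (c j - x k)"] by (simp add: pole_sum_def)
    thus ?thesis using square[OF that] by simp
  qed
  show ?thesis
    using pole_sum_sign_at_omitted[OF I(1,2) square i] pole_sum_sign_at_omitted[OF _ _ square' i] I by fastforce
qed

end

subsection \<open>The enumeration of \<open>\<mu>\<^sup>\<up>\<close>\<close>

lemma ex1_strictly_decreasing_list:
  fixes f :: "'b \<Rightarrow> 'c::linorder"
  assumes "finite A" "inj_on f A"
  shows "\<exists>!xs. set xs = A \<and> sorted_wrt (\<lambda>x y. f x > f y) xs"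
proof -
  let ?sorted = "sorted_wrt (\<lambda>x y. f x > f y)"
  obtain ys where ys: "set ys = A" "distinct ys" using finite_distinct_list[OF assms(1)] by blast
  have "distinct (map f (sort_key f ys))" using ys assms(2) by (simp add: distinct_map)
  hence "sorted_wrt (<) (map f (sort_key f ys))" by (simp add: strict_sorted_iff)
  hence "?sorted (rev (sort_key f ys))" by (simp add: sorted_wrt_rev sorted_wrt_map)
  moreover have "set (rev (sort_key f ys)) = A" using ys by simp
  moreover have "xs = zs" if xs: "set xs = A" "?sorted xs" and zs: "set zs = A" "?sorted zs" for xs zs
  proof -
    have increasing: "sorted_wrt (<) (rev (map f us))" if "?sorted us" for us
      using that by (simp add: sorted_wrt_rev sorted_wrt_map)
    have "rev (map f xs) = rev (map f zs)"
      by (rule strict_sorted_equal[OF increasing[OF zs(2)] increasing[OF xs(2)]]) (simp add: xs(1) zs(1))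
    thus ?thesis using inj_on_map_eq_map[of f xs zs] assms(2) xs(1) zs(1) by simp
  qed
  ultimately show ?thesis by blast
qed

lemma added_superdiagonal_inj:
  "is_partition m \<mu> \<Longrightarrow> inj_on (\<lambda>\<nu>. superdiagonal (added_box \<nu> \<mu>)) (up_set \<mu>)"
  using comp_inj_on[of "\<lambda>\<nu>. added_box \<nu> \<mu>" "up_set \<mu>" superdiagonal] addable_superdiagonal_inj added_box_bij
  by (fastforce simp: bij_betw_def comp_def)

context
  fixes m \<mu> assumes p: "is_partition m \<mu>"
begin

lemma up_enum_characterization:
  "set (up_enum \<mu>) = up_set \<mu> \<and>
    sorted_wrt (\<lambda>\<kappa> \<nu>. superdiagonal (added_box \<kappa> \<mu>) > superdiagonal (added_box \<nu> \<mu>)) (up_enum \<mu>)"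
  unfolding up_enum_def
  by (rule theI'[OF ex1_strictly_decreasing_list[OF finite_up_set[OF p] added_superdiagonal_inj[OF p]]])

lemma set_up_enum: "set (up_enum \<mu>) = up_set \<mu>"
  using up_enum_characterization by blast

lemma up_enum_decreasing:
  "i < j \<Longrightarrow> j < length (up_enum \<mu>) \<Longrightarrow>
    superdiagonal (added_box (up_enum \<mu> ! j) \<mu>) < superdiagonal (added_box (up_enum \<mu> ! i) \<mu>)"
  using sorted_wrt_nth_less[OF conjunct2[OF up_enum_characterization]] by simp

lemma distinct_up_enum: "distinct (up_enum \<mu>)"
  unfolding distinct_conv_nth using up_enum_decreasing by (metis less_irrefl linorder_neqE_nat)

lemma up_enum_nth: "i < length (up_enum \<mu>) \<Longrightarrow> up_enum \<mu> ! i \<in> up_set \<mu>"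
  using nth_mem set_up_enum by blast

lemma length_up_enum: "length (up_enum \<mu>) = card (up_set \<mu>)"
  using distinct_card[OF distinct_up_enum] set_up_enum by simp

lemma up_set_eqI:
  assumes "A \<subseteq> up_set \<mu>" "B \<subseteq> up_set \<mu>"
    and "\<And>i. i < length (up_enum \<mu>) \<Longrightarrow> up_enum \<mu> ! i \<in> A \<longleftrightarrow> up_enum \<mu> ! i \<in> B"
  shows "A = B"
proof (rule Set.set_eqI)
  fix \<nu>
  have "\<nu> \<in> A \<longleftrightarrow> \<nu> \<in> B" if "\<nu> \<in> up_set \<mu>"
    using that assms(3) unfolding set_up_enum[symmetric] in_set_conv_nth by blast
  thus "\<nu> \<in> A \<longleftrightarrow> \<nu> \<in> B" using assms(1,2) by blast
qed

lemma up_enum_image: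
  assumes "L \<subseteq> up_set \<mu>"
  shows "(!) (up_enum \<mu>) ` {i. i < length (up_enum \<mu>) \<and> up_enum \<mu> ! i \<in> L} = L"
proof
  show "L \<subseteq> (!) (up_enum \<mu>) ` {i. i < length (up_enum \<mu>) \<and> up_enum \<mu> ! i \<in> L}"
  proof
    fix \<nu> assume "\<nu> \<in> L"
    moreover from this have "\<nu> \<in> set (up_enum \<mu>)" using assms set_up_enum by blast
    then obtain i where "i < length (up_enum \<mu>)" "\<nu> = up_enum \<mu> ! i" by (auto simp: in_set_conv_nth)
    ultimately show "\<nu> \<in> (!) (up_enum \<mu>) ` {i. i < length (up_enum \<mu>) \<and> up_enum \<mu> ! i \<in> L}" by simp
  qed
qed auto

lemma L_parity_subset: "L_parity \<delta> \<mu> \<subseteq> up_set \<mu>"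
proof
  fix \<nu> assume "\<nu> \<in> L_parity \<delta> \<mu>"
  then obtain i where "\<nu> = up_enum \<mu> ! (i - 1)" "i \<in> {1..length (up_enum \<mu>)}" by (auto simp: L_parity_def)
  thus "\<nu> \<in> up_set \<mu>" using up_enum_nth[of "i - 1"] by (auto simp: Suc_le_eq)
qed

lemma up_enum_in_L_parity:
  assumes i: "i < length (up_enum \<mu>)"
  shows "up_enum \<mu> ! i \<in> L_parity \<delta> \<mu> \<longleftrightarrow> Suc i mod 2 = \<delta>"
proof
  assume "up_enum \<mu> ! i \<in> L_parity \<delta> \<mu>"
  then obtain k where k: "up_enum \<mu> ! i = up_enum \<mu> ! (k - 1)" "1 \<le> k" "k \<le> length (up_enum \<mu>)" "k mod 2 = \<delta>"
    by (auto simp: L_parity_def)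
  hence "i = k - 1" using nth_eq_iff_index_eq[OF distinct_up_enum i, of "k - 1"] by auto
  thus "Suc i mod 2 = \<delta>" using k by simp
next
  assume "Suc i mod 2 = \<delta>"
  thus "up_enum \<mu> ! i \<in> L_parity \<delta> \<mu>"
    unfolding L_parity_def using i by (intro CollectI exI[of _ "Suc i"]) simp
qed

lemma L_parity_complement:
  assumes "\<delta> \<in> {0, 1}"
  shows "L_parity (1 - \<delta>) \<mu> = up_set \<mu> - L_parity \<delta> \<mu>"
proof (rule up_set_eqI)
  fix i assume i: "i < length (up_enum \<mu>)"
  show "up_enum \<mu> ! i \<in> L_parity (1 - \<delta>) \<mu> \<longleftrightarrow> up_enum \<mu> ! i \<in> up_set \<mu> - L_parity \<delta> \<mu>"
    using assms up_enum_nth[OF i] by (auto simp: up_enum_in_L_parity[OF i] mod2_eq_if)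
qed (use L_parity_subset in auto)

lemma alternating_eq_L_parity:
  assumes L: "L \<subseteq> up_set \<mu>"
    and alternating: "\<And>i. Suc i < length (up_enum \<mu>) \<Longrightarrow> up_enum \<mu> ! i \<in> L \<longleftrightarrow> up_enum \<mu> ! Suc i \<notin> L"
  shows "L = L_parity 0 \<mu> \<or> L = L_parity 1 \<mu>"
proof -
  define \<delta> :: nat where "\<delta> = (if up_enum \<mu> ! 0 \<in> L then 1 else 0)"
  have parity: "up_enum \<mu> ! i \<in> L \<longleftrightarrow> Suc i mod 2 = \<delta>" if "i < length (up_enum \<mu>)" for i
    using that
  proof (induction i)
    case (Suc i)
    thus ?case using alternating[of i] by (auto simp: \<delta>_def mod_Suc split: if_splits)
  qed (simp add: \<delta>_def)
  have "L = L_parity \<delta> \<mu>"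
    by (rule up_set_eqI[OF L L_parity_subset]) (simp only: parity up_enum_in_L_parity)
  thus ?thesis by (cases "up_enum \<mu> ! 0 \<in> L") (simp_all add: \<delta>_def)
qed

end

subsection \<open>Isoclinic partitions come from \<open>L\<^sub>0\<close> and \<open>L\<^sub>1\<close>\<close>

definition dim_pole_sum :: "nat list \<Rightarrow> nat list set \<Rightarrow> real \<Rightarrow> real" where
  "dim_pole_sum \<mu> K y = (\<Sum>\<nu>\<in>K. real (d_tab \<nu>) / (of_int (superdiagonal (added_box \<nu> \<mu>)) - y))"

lemma (in induced_rep) swap_eigenvalue_eq:
  "swap_eigenvalue R = dim_pole_sum \<mu> L (of_int (content R m)) / real (d_sum L)"
  by (simp add: swap_eigenvalue_def dim_pole_sum_def weight_def sum_divide_distrib mult.commute)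

context
  fixes m \<mu> assumes p: "is_partition m \<mu>" and m: "1 \<le> m"
begin

lemma up_set_nonempty: "up_set \<mu> \<noteq> {}"
  using card_up_set[OF p] by fastforce

lemma dim_pole_sum_up_set:
  assumes "R \<in> Tab \<mu>"
  shows "dim_pole_sum \<mu> (up_set \<mu>) (of_int (content R m)) = 0"
proof -
  interpret induced_rep m \<mu> "up_set \<mu>" by unfold_locales (use p up_set_nonempty in auto)
  show ?thesis using swap_eigenvalue_full[OF refl m assms] d_sum_pos by (simp add: swap_eigenvalue_eq)
qed

lemma dim_pole_sum_complement:
  assumes "R \<in> Tab \<mu>" "K \<subseteq> up_set \<mu>"
  shows "dim_pole_sum \<mu> (up_set \<mu> - K) (of_int (content R m)) = - dim_pole_sum \<mu> K (of_int (content R m))"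
  using dim_pole_sum_up_set[OF assms(1)]
  by (simp add: dim_pole_sum_def sum_diff[OF finite_up_set[OF p] assms(2)])

lemma removable_content_attained:
  assumes x: "x \<in> removable (diagram \<mu>)"
  obtains R where "R \<in> Tab \<mu>" "content R m = superdiagonal x"
proof -
  let ?Y = "diagram \<mu> - {x}"
  note addable = removable_addable[OF young_diagram[OF p] x]
  have Y: "young ?Y" "insert x ?Y = diagram \<mu>" using x by (auto simp: removable_def)
  have "x \<in> diagram \<mu>" using Y(2) by blast
  hence size: "Suc (card ?Y) = m"
    using card_Suc_Diff1[OF finite_diagram, of x \<mu>] p by (simp add: card_diagram is_partition_def)
  obtain R where R: "R \<in> SYT_shape (card ?Y) ?Y" using SYT_shape_nonempty[OF Y(1)] by blast
  have "R(x := m) \<in> Tab \<mu>"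
    using SYT_shape_extend[OF R addable] unfolding size Y(2) Tab_eq_SYT_shape[OF p] .
  moreover have "content (R(x := m)) m = superdiagonal x"
    using content_extend(1)[OF R addable] unfolding size .
  ultimately show ?thesis by (rule that)
qed

lemma dim_pole_sum_positions:
  assumes "J \<subseteq> {..<length (up_enum \<mu>)}"
  shows "dim_pole_sum \<mu> ((!) (up_enum \<mu>) ` J) y =
    (\<Sum>i\<in>J. real (d_tab (up_enum \<mu> ! i)) / (of_int (superdiagonal (added_box (up_enum \<mu> ! i) \<mu>)) - y))"
proof -
  have "inj_on ((!) (up_enum \<mu>)) J"
    using assms by (intro inj_on_nth[OF distinct_up_enum[OF p]]) auto
  thus ?thesis by (simp add: dim_pole_sum_def sum.reindex)
qed

lemma up_enum_gap_content:
  assumes i: "Suc i < length (up_enum \<mu>)"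
  obtains R where "R \<in> Tab \<mu>" "superdiagonal (added_box (up_enum \<mu> ! Suc i) \<mu>) < content R m"
    "content R m < superdiagonal (added_box (up_enum \<mu> ! i) \<mu>)"
proof -
  obtain x where x: "x \<in> removable (diagram \<mu>)"
    "superdiagonal (added_box (up_enum \<mu> ! Suc i) \<mu>) < superdiagonal x"
    "superdiagonal x < superdiagonal (added_box (up_enum \<mu> ! i) \<mu>)"
    using removable_between_addable[OF p added_box_addable[OF p up_enum_nth[OF p]]
        added_box_addable[OF p up_enum_nth[OF p]] up_enum_decreasing[OF p lessI i]] i by auto
  obtain R where "R \<in> Tab \<mu>" "content R m = superdiagonal x"
    by (rule removable_content_attained[OF x(1)])
  thus ?thesis using that x by simp
qed

lemma constant_square_alternates:
  assumes L: "L \<subset> up_set \<mu>" "L \<noteq> {}"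
    and square: "\<And>R. R \<in> Tab \<mu> \<Longrightarrow> (dim_pole_sum \<mu> L (of_int (content R m)))\<^sup>2 = \<beta>"
    and i: "Suc i < length (up_enum \<mu>)"
  shows "up_enum \<mu> ! i \<in> L \<longleftrightarrow> up_enum \<mu> ! Suc i \<notin> L"
proof -
  let ?M = "length (up_enum \<mu>)" and ?box = "\<lambda>i. added_box (up_enum \<mu> ! i) \<mu>"
  have "\<exists>R. R \<in> Tab \<mu> \<and> superdiagonal (?box (Suc i)) < content R m \<and> content R m < superdiagonal (?box i)"
    if "Suc i < ?M" for i
    by (rule up_enum_gap_content[OF that]) blast
  then obtain R where R: "\<And>i. Suc i < ?M \<Longrightarrow> R i \<in> Tab \<mu>"
    and between: "\<And>i. Suc i < ?M \<Longrightarrow> superdiagonal (?box (Suc i)) < content (R i) m"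
      "\<And>i. Suc i < ?M \<Longrightarrow> content (R i) m < superdiagonal (?box i)"
    by metis
  define I where "I = {i. i < ?M \<and> up_enum \<mu> ! i \<in> L}"
  have images: "(!) (up_enum \<mu>) ` {..<?M} = up_set \<mu>" "(!) (up_enum \<mu>) ` I = L"
    using up_enum_image[OF p, of "up_set \<mu>"] up_enum_image[OF p, of L] L(1) up_enum_nth[OF p]
    by (auto simp: I_def lessThan_def cong: conj_cong)
  interpret interlaced_poles ?M "\<lambda>i. of_int (superdiagonal (?box i))" "\<lambda>i. real (d_tab (up_enum \<mu> ! i))"
    "\<lambda>i. of_int (content (R i) m)"
  proof
    show "0 < real (d_tab (up_enum \<mu> ! i))" if "i < ?M" for i
      using d_tab_pos[OF up_setD(1)[OF p up_enum_nth[OF p that]]] by simp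
    show "(\<Sum>j<?M. real (d_tab (up_enum \<mu> ! j)) /
        (real_of_int (superdiagonal (?box j)) - of_int (content (R i) m))) = 0"
      if "Suc i < ?M" for i
      using dim_pole_sum_up_set[OF R[OF that]] dim_pole_sum_positions[OF order_refl] by (simp add: images)
  qed (use up_enum_decreasing[OF p] between in simp_all)
  have I: "I \<subseteq> {..<?M}" by (auto simp: I_def)
  have "(pole_sum I i)\<^sup>2 = \<beta>" if "Suc i < ?M" for i
    using square[OF R[OF that]] dim_pole_sum_positions[OF I] by (simp add: pole_sum_def images)
  moreover have "I \<noteq> {}" "I \<noteq> {..<?M}" using images L by auto
  ultimately have "i \<in> I \<longleftrightarrow> Suc i \<notin> I" using pole_sum_alternation[OF I] i by blast
  thus ?thesis using i by (simp add: I_def)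
qed

lemma constant_square_L_parity:
  assumes L: "L \<subset> up_set \<mu>" "L \<noteq> {}" and "\<delta> \<in> {0, 1}"
    and square: "\<And>R. R \<in> Tab \<mu> \<Longrightarrow> (dim_pole_sum \<mu> L (of_int (content R m)))\<^sup>2 = \<beta>"
    and R: "R \<in> Tab \<mu>"
  shows "(dim_pole_sum \<mu> (L_parity \<delta> \<mu>) (of_int (content R m)))\<^sup>2 = \<beta>"
proof -
  have "L = L_parity 0 \<mu> \<or> L = L_parity 1 \<mu>"
    using L(1) by (intro alternating_eq_L_parity[OF p] constant_square_alternates[OF L square]) auto
  then consider "L_parity \<delta> \<mu> = L" | "L_parity \<delta> \<mu> = up_set \<mu> - L"
    using assms(3) L_parity_complement[OF p, of 0] L_parity_complement[OF p, of 1] by force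
  thus ?thesis
  proof cases
    case 2
    thus ?thesis using square[OF R] dim_pole_sum_complement[OF R, of L] L(1) by simp
  qed (simp add: square[OF R])
qed

end

lemma isoclinic_L_parity:
  assumes p: "is_partition m \<mu>" and "isoclinic \<mu>" and \<delta>: "\<delta> \<in> {0, 1}"
  shows "1 \<le> m" "induced_rep m \<mu> (L_parity \<delta> \<mu>)"
    "\<exists>\<alpha>. \<forall>R\<in>Tab \<mu>. (induced_rep.swap_eigenvalue m \<mu> (L_parity \<delta> \<mu>) R)\<^sup>2 = \<alpha>"
proof -
  have size: "sum_list \<mu> = m" using p by (simp add: is_partition_def)
  obtain L t where L: "L \<subset> up_set \<mu>" "L \<noteq> {}"
    and t: "\<forall>k\<in>{1..Suc m}. t k \<in> carrier (sym_group (Suc m)) \<and> t k (Suc m) = k"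
    and equi: "equi_isoclinic (Suc m) (d_tab \<mu>) (d_sum L) (\<lambda>k. mat_image (rep_sum L (t k)) (W_sub L \<mu>))"
    using assms(2) unfolding isoclinic_def size Let_def by blast
  interpret young_frame m \<mu> L t
    by unfold_locales (use p L t in \<open>auto simp: sym_group_carrier\<close>)
  have "card L < card (up_set \<mu>)" by (rule psubset_card_mono[OF finite_up_set[OF p] L(1)])
  moreover have "0 < card L" using L(2) finite_L by (simp add: card_gt_0_iff)
  ultimately have two: "2 \<le> length (up_enum \<mu>)" "set \<mu> \<noteq> {}"
    using card_up_set[OF p] by (auto simp: length_up_enum[OF p])
  show m: "1 \<le> m" using two(2) p size by (cases \<mu>) (auto simp: is_partition_def)
  have "up_enum \<mu> ! (1 - \<delta>) \<in> L_parity \<delta> \<mu>"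
    using two(1) \<delta> by (subst up_enum_in_L_parity[OF p]) auto
  thus parity: "induced_rep m \<mu> (L_parity \<delta> \<mu>)"
    using p L_parity_subset[OF p] by unfold_locales auto
  interpret parity: induced_rep m \<mu> "L_parity \<delta> \<mu>" by (rule parity)
  have "equi_isoclinic (Suc m) (d_tab \<mu>) (d_sum L) subspace"
    using equi unfolding equi_isoclinic_def by (simp add: subspace_eq del: atLeastAtMost_iff)
  then obtain \<alpha> where "\<forall>R\<in>Tab \<mu>. (swap_eigenvalue R)\<^sup>2 = \<alpha>"
    unfolding equi_isoclinic_iff_swap_eigenvalue[OF m] ..
  hence "(dim_pole_sum \<mu> L (of_int (content R m)))\<^sup>2 = \<alpha> * (real (d_sum L))\<^sup>2" if "R \<in> Tab \<mu>" for R
    using that d_sum_pos by (auto simp: swap_eigenvalue_eq power_divide field_simps)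
  hence "(dim_pole_sum \<mu> (L_parity \<delta> \<mu>) (of_int (content R m)))\<^sup>2 = \<alpha> * (real (d_sum L))\<^sup>2" if "R \<in> Tab \<mu>" for R
    using constant_square_L_parity[OF p m L \<delta> _ that] by blast
  thus "\<exists>\<alpha>. \<forall>R\<in>Tab \<mu>. (parity.swap_eigenvalue R)\<^sup>2 = \<alpha>"
    by (auto simp: parity.swap_eigenvalue_eq power_divide)
qed

section \<open>Self-conjugate partitions\<close>

lemma transpose_partition_is_partition:
  assumes p: "is_partition n \<nu>"
  shows "is_partition n (transpose_partition \<nu>)"
proof -
  let ?column = "\<lambda>i. {j. 1 \<le> j \<and> i \<le> part \<nu> j}"
  have finite: "finite (?column i)" if "1 \<le> i" for i
    by (rule finite_subset[of _ "{1..length \<nu>}"]) (use that in \<open>auto simp: part_def split: if_splits\<close>)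
  have "sorted_wrt (\<ge>) (transpose_partition \<nu>)"
    unfolding transpose_partition_def sorted_wrt_iff_nth_less
    by (auto intro!: card_mono finite[simplified] simp del: upt_Suc)
  moreover have "0 < x" if x: "x \<in> set (transpose_partition \<nu>)" for x
  proof -
    obtain i where i: "1 \<le> i" "i \<le> part \<nu> 1" "x = card (?column i)"
      using x by (auto simp: transpose_partition_def)
    have "1 \<in> ?column i" using i(2) by simp
    thus ?thesis unfolding i(3) card_gt_0_iff using finite[OF i(1)] by blast
  qed
  moreover have "sum_list (transpose_partition \<nu>) = n"
    using p by (simp add: card_diagram[symmetric] diagram_transpose[OF p] card_image is_partition_def)
  ultimately show ?thesis by (simp add: is_partition_def)
qed

lemma transpose_partition_involutive:
  assumes p: "is_partition n \<nu>"
  shows "transpose_partition (transpose_partition \<nu>) = \<nu>"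
proof (rule diagram_inj[OF _ p])
  note p' = transpose_partition_is_partition[OF p]
  show "is_partition n (transpose_partition (transpose_partition \<nu>))"
    by (rule transpose_partition_is_partition[OF p'])
  show "diagram (transpose_partition (transpose_partition \<nu>)) = diagram \<nu>"
    by (simp add: diagram_transpose[OF p'] diagram_transpose[OF p])
qed

context
  fixes m \<mu> assumes p: "is_partition m \<mu>" and selfconjugate: "transpose_partition \<mu> = \<mu>"
begin

lemma diagram_selfconjugate: "prod.swap ` diagram \<mu> = diagram \<mu>"
  using diagram_transpose[OF p] selfconjugate by simp

lemma swap_in_diagram: "prod.swap b \<in> diagram \<mu> \<longleftrightarrow> b \<in> diagram \<mu>"
  using mem_swap_image[of b "diagram \<mu>"] by (simp add: diagram_selfconjugate)

lemma
  assumes \<nu>: "\<nu> \<in> up_set \<mu>"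
  shows transpose_partition_up_set: "transpose_partition \<nu> \<in> up_set \<mu>"
    and added_box_transpose: "added_box (transpose_partition \<nu>) \<mu> = prod.swap (added_box \<nu> \<mu>)"
proof -
  let ?b = "prod.swap (added_box \<nu> \<mu>)"
  note \<nu>D = up_setD[OF p \<nu>]
  have diagram: "diagram (transpose_partition \<nu>) = insert ?b (diagram \<mu>)"
    by (simp add: diagram_transpose[OF \<nu>D(1)] \<nu>D(3) diagram_selfconjugate)
  have new: "?b \<notin> diagram \<mu>" using \<nu>D(2) by (simp add: swap_in_diagram)
  have "sum_list \<mu> = m" using p by (simp add: is_partition_def)
  thus up: "transpose_partition \<nu> \<in> up_set \<mu>"
    unfolding up_set_def using transpose_partition_is_partition[OF \<nu>D(1)] new diagram by blast
  show "added_box (transpose_partition \<nu>) \<mu> = ?b"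
    using up_setD(2,3)[OF p up] new diagram by auto
qed

lemma up_enum_transpose: "rev (map transpose_partition (up_enum \<mu>)) = up_enum \<mu>"
proof -
  let ?f = "\<lambda>\<nu>. superdiagonal (added_box \<nu> \<mu>)"
  let ?enum = "\<lambda>xs. set xs = up_set \<mu> \<and> sorted_wrt (\<lambda>\<kappa> \<nu>. ?f \<kappa> > ?f \<nu>) xs"
  have "transpose_partition ` up_set \<mu> = up_set \<mu>"
  proof
    show "transpose_partition ` up_set \<mu> \<subseteq> up_set \<mu>" using transpose_partition_up_set by blast
    show "up_set \<mu> \<subseteq> transpose_partition ` up_set \<mu>"
      using transpose_partition_involutive[OF up_setD(1)[OF p]] transpose_partition_up_set
      by (metis image_eqI subsetI)
  qed
  moreover have "?f (transpose_partition \<nu>) = - ?f \<nu>" if "\<nu> \<in> up_set \<mu>" for \<nu>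
    by (simp add: added_box_transpose[OF that] superdiagonal_def)
  hence "sorted_wrt (\<lambda>\<kappa> \<nu>. ?f \<kappa> > ?f \<nu>) (rev (map transpose_partition (up_enum \<mu>)))"
    using conjunct2[OF up_enum_characterization[OF p]] set_up_enum[OF p]
    by (auto simp: sorted_wrt_rev sorted_wrt_map elim!: sorted_wrt_mono_rel[rotated])
  ultimately have "?enum (rev (map transpose_partition (up_enum \<mu>)))"
    by (simp add: set_up_enum[OF p])
  thus ?thesis
    using up_enum_characterization[OF p]
      ex1_strictly_decreasing_list[OF finite_up_set[OF p] added_superdiagonal_inj[OF p]] by blast
qed

lemma L_parity_transpose:
  assumes even: "even (card (set \<mu>))" and \<nu>: "\<nu> \<in> L_parity \<delta> \<mu>"
  shows "transpose_partition \<nu> \<in> L_parity \<delta> \<mu>"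
proof -
  let ?M = "length (up_enum \<mu>)"
  have "\<nu> \<in> set (up_enum \<mu>)" using \<nu> L_parity_subset[OF p] set_up_enum[OF p] by blast
  then obtain i where i: "i < ?M" "up_enum \<mu> ! i = \<nu>" by (auto simp: in_set_conv_nth)
  define j where "j = ?M - Suc i"
  have j: "j < ?M" "?M = Suc (i + j)" using i(1) by (simp_all add: j_def)
  have "up_enum \<mu> ! j = rev (map transpose_partition (up_enum \<mu>)) ! j" by (simp only: up_enum_transpose)
  also have "\<dots> = transpose_partition \<nu>" using i j by (simp add: rev_nth)
  finally have mirrored: "up_enum \<mu> ! j = transpose_partition \<nu>" .
  have "?M = Suc (card (set \<mu>))" using length_up_enum[OF p] card_up_set[OF p] by simp
  hence "Suc j mod 2 = Suc i mod 2" using even j(2) by (simp add: mod2_eq_if) presburger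
  thus ?thesis
    using \<nu> up_enum_in_L_parity[OF p i(1)] up_enum_in_L_parity[OF p j(1)] by (simp add: i(2) mirrored)
qed

lemma durfee_eq:
  assumes m: "1 \<le> m"
  shows "m = durfee \<mu> + 2 * card {b \<in> diagram \<mu>. fst b < snd b}"
proof -
  let ?Y = "diagram \<mu>"
  let ?D = "{b \<in> ?Y. fst b = snd b}" and ?U = "{b \<in> ?Y. fst b < snd b}" and ?L = "{b \<in> ?Y. snd b < fst b}"
  have "?L = prod.swap ` ?U" by (intro Set.set_eqI) (simp add: mem_swap_image swap_in_diagram)
  hence mirror: "card ?L = card ?U" by (simp add: card_image)
  have "?Y = ?D \<union> (?U \<union> ?L)" by auto
  hence "card ?Y = card (?D \<union> (?U \<union> ?L))" by simp
  also have "\<dots> = card ?D + card (?U \<union> ?L)"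
    by (rule card_Un_disjoint) (auto simp: finite_diagram)
  also have "card (?U \<union> ?L) = card ?U + card ?L"
    by (rule card_Un_disjoint) (auto simp: finite_diagram)
  finally have size: "m = card ?D + 2 * card ?U"
    using mirror p by (simp add: card_diagram is_partition_def)
  define S where "S = {i \<in> {1..length \<mu>}. i \<le> part \<mu> i}"
  have "?D = (\<lambda>i. (i, i)) ` S" by (auto simp: S_def mem_diagram part_def split: if_splits)
  hence diagonal: "card ?D = card S" by (simp add: card_image inj_on_def)
  have S: "S = {1..card S}"
  proof (rule initial_segment)
    show "y \<in> S" if "x \<in> S" "1 \<le> y" "y \<le> x" for x y
      using that part_antimono[OF p, of y x] by (auto simp: S_def)
  qed (auto simp: S_def)
  have "\<mu> \<noteq> []" using p m by (auto simp: is_partition_def)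
  hence "1 \<in> S" using part_pos[OF p, of 1] by (cases \<mu>) (auto simp: S_def)
  hence "1 \<le> card S" using S by auto
  hence "Max S = card S" by (subst S) (simp add: Max_eq_iff)
  thus ?thesis using size diagonal by (simp add: durfee_def S_def)
qed

end

section \<open>Splitting over the alternating group\<close>

subsection \<open>Signed transposition of tableaux\<close>

locale symmetric_family = tableau_family +
  fixes Y :: "(nat \<times> nat) set"
  assumes transpose_closed: "\<And>T. T \<in> \<T> \<Longrightarrow> transpose_tab T \<in> \<T>"
    and Y_finite: "finite Y" and Y_symmetric: "prod.swap ` Y = Y"
    and Y_shape: "\<And>T. T \<in> \<T> \<Longrightarrow> Y \<subseteq> shape T" "\<And>T. T \<in> \<T> \<Longrightarrow> \<exists>b. shape T - Y \<subseteq> {b}"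
begin

definition mirror_sign :: real where
  "mirror_sign = (- 1) ^ card {b \<in> Y. fst b < snd b}"

lemma tab_sign_mirror:
  assumes "T \<in> \<T>"
  shows "tab_sign Y (transpose_tab T) = mirror_sign * tab_sign Y T"
proof -
  have "mirror_sign * tab_sign Y T = (tab_sign Y T * tab_sign Y T) * tab_sign Y (transpose_tab T)"
    using tab_sign_transpose_tab[OF Y_finite Y_symmetric family_SYT[OF assms] Y_shape(1)[OF assms]]
    by (simp add: mirror_sign_def ac_simps)
  thus ?thesis by (simp add: tab_sign_square)
qed

lemma tab_sign_swap:
  assumes "T \<in> \<T>" "1 \<le> k" "k < n"
  shows "tab_sign Y (adj_transp k \<circ> T) = - tab_sign Y T"
  using Y_shape(2)[OF assms(1)]
    tab_sign_adj_transp[OF family_SYT[OF assms(1)] Y_shape(1)[OF assms(1)] _ assms(2,3)] by blast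

text \<open>The signed transposition \<open>v\<^sub>T \<mapsto> \<plusminus> v\<^bsub>T'\<^esub>\<close> intertwines the representation with its sign twist.\<close>

lemma young_coeff_transpose_tab:
  assumes \<sigma>: "\<sigma> permutes {1..n}" and T: "T \<in> \<T>" and "S \<in> \<T>"
  shows "young_coeff n \<sigma> S (transpose_tab T) * tab_sign Y T =
    of_int (sign \<sigma>) * (tab_sign Y (transpose_tab S) * young_coeff n \<sigma> (transpose_tab S) T)"
  using \<sigma> assms(3)
proof (induction arbitrary: S rule: permutes_adj_transp_induct)
  case id
  show ?case unfolding sign_id young_coeff_id using transpose_tab_eq_iff[of S T] by auto
next
  case (step k \<sigma>)
  note S = \<open>S \<in> \<T>\<close>
  let ?a = "\<lambda>S. young_coeff n \<sigma> S (transpose_tab T)" and ?b = "\<lambda>S. young_coeff n \<sigma> S T"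
  let ?\<epsilon> = "of_int (sign \<sigma>) :: real" and ?s = "tab_sign Y (transpose_tab S)"
  let ?d = "axial_step S k" and ?S' = "adj_transp k \<circ> S"
  have "permutation \<sigma>" using step(3) permutation_permutes by blast
  hence sign: "of_int (sign (adj_transp k \<circ> \<sigma>)) = - ?\<epsilon>" by (simp add: sign_adj_transp_comp)
  have swapped: "swap_weight ?d * (?a ?S' * tab_sign Y T) =
      - (swap_weight ?d * (?\<epsilon> * (?s * ?b (transpose_tab ?S'))))"
  proof (cases "swap_weight ?d = 0")
    case False
    hence "?S' \<in> \<T>"
      using swap_SYT_or_weight_0[OF family_SYT[OF S] step(1,2)] family_swap[OF S step(1)] by blast
    from step.IH[OF this] have "?a ?S' * tab_sign Y T =
        ?\<epsilon> * (tab_sign Y (transpose_tab ?S') * ?b (transpose_tab ?S'))" .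
    moreover have "tab_sign Y (transpose_tab ?S') = - ?s"
      using tab_sign_swap[OF transpose_closed[OF S] step(1,2)] by (simp only: adj_transp_transpose_tab)
    ultimately show ?thesis by (simp only: mult_minus_left mult_minus_right)
  qed simp
  have "young_coeff n (adj_transp k \<circ> \<sigma>) S (transpose_tab T) * tab_sign Y T = young_op k ?a S * tab_sign Y T"
    by (simp only: young_coeff_step[OF step(3,1,2) family_SYT[OF S]])
  also have "\<dots> = ?a S * tab_sign Y T / of_int ?d + swap_weight ?d * (?a ?S' * tab_sign Y T)"
    by (simp add: young_op_def distrib_right mult.assoc)
  also have "\<dots> = - ?\<epsilon> * (?s * (- ?b (transpose_tab S) / of_int ?d + swap_weight ?d * ?b (transpose_tab ?S')))"
    unfolding swapped step.IH[OF S] by (simp add: algebra_simps)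
  also have "- ?b (transpose_tab S) / of_int ?d + swap_weight ?d * ?b (transpose_tab ?S') =
      young_op k ?b (transpose_tab S)"
    by (rule young_op_transpose_tab[OF family_SYT[OF S] step(1,2), symmetric])
  also have "\<dots> = young_coeff n (adj_transp k \<circ> \<sigma>) (transpose_tab S) T"
    by (simp only: young_coeff_step[OF step(3,1,2) transpose_tab_SYT[OF family_SYT[OF S]]])
  finally show ?case unfolding sign .
qed

end

subsection \<open>The eigenspace of a twisted involution\<close>

text \<open>The operator \<open>v\<^sub>a \<mapsto> \<phi>(a) v\<^bsub>\<tau>(a)\<^esub>\<close> is a self-adjoint involution. For \<open>x\<close> in a set \<open>H\<close> of
  representatives of the \<open>\<tau>\<close>-orbits, the vectors \<open>(v\<^sub>x + \<phi>(x) v\<^bsub>\<tau>(x)\<^esub>) / \<surd>2\<close> form an orthonormal basis of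
  its eigenspace for the eigenvalue 1.\<close>

locale twisted_involution = real_embedding emb
  for emb :: "real \<Rightarrow> 'a::conjugatable_field" +
  fixes D H :: "'i set" and \<tau> :: "'i \<Rightarrow> 'i" and \<phi> :: "'i \<Rightarrow> 'a"
  assumes \<tau>_involutive: "\<And>a. a \<in> D \<Longrightarrow> \<tau> (\<tau> a) = a"
    and half: "\<And>a. a \<in> D \<Longrightarrow> \<tau> a \<in> H \<longleftrightarrow> a \<notin> H"
    and phase_unit: "\<And>a. a \<in> D \<Longrightarrow> \<phi> a * conjugate (\<phi> a) = 1"
    and phase_mirror: "\<And>a. a \<in> D \<Longrightarrow> \<phi> (\<tau> a) = conjugate (\<phi> a)"
begin

definition invariant :: "'i set \<Rightarrow> bool" where
  "invariant A \<longleftrightarrow> finite A \<and> A \<subseteq> D \<and> \<tau> ` A \<subseteq> A"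

definition eigen_coeff :: "'i \<Rightarrow> 'i \<Rightarrow> 'a" where
  "eigen_coeff a x = emb (1 / sqrt 2) * (if a = x then 1 else if a = \<tau> x then \<phi> x else 0)"

definition eigen_mat :: "'i set \<Rightarrow> 'a mat" where
  "eigen_mat A = kernel_mat A (A \<inter> H) eigen_coeff"

definition projection_coeff :: "'i \<Rightarrow> 'i \<Rightarrow> 'a" where
  "projection_coeff a b = emb (1 / 2) * (if a = b then 1 else if a = \<tau> b then \<phi> b else 0)"

lemma \<tau>_neq: "a \<in> D \<Longrightarrow> \<tau> a \<noteq> a"
  using half by metis

lemma \<tau>_eq_iff: "a \<in> D \<Longrightarrow> b \<in> D \<Longrightarrow> \<tau> a = b \<longleftrightarrow> a = \<tau> b"
  using \<tau>_involutive by metis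

lemma invariantD:
  assumes "invariant A"
  shows "finite A" "a \<in> A \<Longrightarrow> a \<in> D" "a \<in> A \<Longrightarrow> \<tau> a \<in> A"
  using assms by (auto simp: invariant_def)

lemma card_invariant:
  assumes A: "invariant A"
  shows "card A = 2 * card (A \<inter> H)"
proof -
  have "bij_betw \<tau> (A \<inter> H) (A - H)"
    by (rule bij_betwI[where g = \<tau>]) (use invariantD[OF A] half \<tau>_involutive in auto)
  hence "card (A - H) = card (A \<inter> H)" by (simp add: bij_betw_same_card)
  thus ?thesis using card_Int_Diff[OF invariantD(1)[OF A], of H] by simp
qed

lemma sum_mirror_pair:
  fixes f :: "'i \<Rightarrow> 'a"
  assumes A: "invariant A" and a: "a \<in> A" and rest: "\<And>b. b \<in> A \<Longrightarrow> b \<noteq> a \<Longrightarrow> b \<noteq> \<tau> a \<Longrightarrow> f b = 0"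
  shows "sum f A = f a + f (\<tau> a)"
proof -
  have "sum f A = sum f {a, \<tau> a}"
    using invariantD[OF A] a rest by (intro sum.mono_neutral_right) auto
  thus ?thesis using \<tau>_neq[OF invariantD(2)[OF A a]] by simp
qed

lemma emb_half: "emb (1 / sqrt 2) * emb (1 / sqrt 2) = emb (1 / 2)" "emb (1 / 2) + emb (1 / 2) = 1"
  by (simp_all flip: hom_mult hom_add)

lemma eigen_mat_isometry:
  assumes A: "invariant A"
  shows "isometry_mat (card A) (card (A \<inter> H)) (eigen_mat A)"
proof -
  have "(\<Sum>a\<in>A. conjugate (eigen_coeff a x) * eigen_coeff a y) = (if x = y then 1 else 0)"
    if x: "x \<in> A \<inter> H" and y: "y \<in> A \<inter> H" for x y
  proof -
    have D: "x \<in> D" "y \<in> D" using x y invariantD(2)[OF A] by auto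
    have distinct: "y \<noteq> \<tau> x" "\<tau> y \<noteq> x" "\<tau> y \<noteq> y" "\<tau> y = \<tau> x \<longleftrightarrow> y = x"
      using half[OF D(1)] half[OF D(2)] x y \<tau>_involutive[OF D(1)] \<tau>_involutive[OF D(2)] by auto
    have "(\<Sum>a\<in>A. conjugate (eigen_coeff a x) * eigen_coeff a y) =
        conjugate (eigen_coeff y x) * eigen_coeff y y + conjugate (eigen_coeff (\<tau> y) x) * eigen_coeff (\<tau> y) y"
      by (rule sum_mirror_pair[OF A]) (use y in \<open>auto simp: eigen_coeff_def\<close>)
    also have "\<dots> = (if x = y then emb (1 / sqrt 2) * emb (1 / sqrt 2) * (1 + \<phi> y * conjugate (\<phi> y)) else 0)"
      using distinct by (auto simp: eigen_coeff_def conjugate_dist_mul conjugate_emb algebra_simps)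
    also have "\<dots> = (if x = y then 1 else 0)"
      using phase_unit[OF D(2)] by (simp only: emb_half distrib_left mult_1_right)
    finally show ?thesis .
  qed
  thus ?thesis
    using invariantD(1)[OF A] unfolding isometry_mat_def eigen_mat_def
    by (auto simp: adjoint_kernel_mat kernel_mat_mult one_mat_eq_kernel_mat intro!: kernel_mat_cong)
qed

lemma eigen_projection:
  assumes A: "invariant A"
  shows "eigen_mat A * mat_adjoint (eigen_mat A) = kernel_mat A A projection_coeff"
  unfolding eigen_mat_def adjoint_kernel_mat kernel_mat_mult[OF finite_Int[OF disjI1[OF invariantD(1)[OF A]]]]
proof (rule kernel_mat_cong)
  fix a b assume ab: "a \<in> A" "b \<in> A"
  define representative where "representative c = (if c \<in> H then c else \<tau> c)" for c
  define factor where "factor c = (if c \<in> H then 1 else conjugate (\<phi> c))" for c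
  have coeff: "eigen_coeff c x = (if x = representative c then emb (1 / sqrt 2) * factor c else 0)"
    if "c \<in> A" "x \<in> A \<inter> H" for c x
    using that invariantD(2)[OF A] half[of x] half[of c] \<tau>_eq_iff[of c x] phase_mirror[of c]
    by (auto simp: eigen_coeff_def representative_def factor_def)
  have D: "a \<in> D" "b \<in> D" using ab invariantD(2)[OF A] by auto
  have rep: "representative a \<in> A \<inter> H"
    using ab half[OF D(1)] invariantD(3)[OF A] by (simp add: representative_def)
  have "(\<Sum>x\<in>A \<inter> H. eigen_coeff a x * conjugate (eigen_coeff b x)) =
      (\<Sum>x\<in>A \<inter> H. if x = representative a then eigen_coeff a x * conjugate (eigen_coeff b x) else 0)"
    by (intro sum.cong refl) (use coeff[OF ab(1)] in auto)
  also have "\<dots> = eigen_coeff a (representative a) * conjugate (eigen_coeff b (representative a))"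
    using rep invariantD(1)[OF A] by simp
  also have "\<dots> = emb (1 / sqrt 2) * emb (1 / sqrt 2) *
      (if representative a = representative b then factor a * conjugate (factor b) else 0)"
    using coeff[OF ab(1) rep] coeff[OF ab(2) rep] by (simp add: conjugate_dist_mul conjugate_emb)
  also have "\<dots> = projection_coeff a b"
    using half[OF D(1)] half[OF D(2)] \<tau>_eq_iff[OF D] \<tau>_involutive[OF D(1)] \<tau>_involutive[OF D(2)]
      phase_unit[OF D(2)] phase_mirror[OF D(2)]
    by (auto simp: projection_coeff_def representative_def factor_def emb_half mult.commute)
  finally show "(\<Sum>x\<in>A \<inter> H. eigen_coeff a x * conjugate (eigen_coeff b x)) = projection_coeff a b" .
qed

lemma eigen_mat_intertwines:
  assumes A: "invariant A" and B: "invariant B"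
    and commutes: "\<And>a b. a \<in> A \<Longrightarrow> b \<in> B \<Longrightarrow> \<phi> (\<tau> a) * K (\<tau> a) b = K a (\<tau> b) * \<phi> b"
  shows "intertwines (eigen_mat A) (eigen_mat B) (kernel_mat A B K)"
  unfolding intertwines_def eigen_projection[OF A] eigen_projection[OF B]
    kernel_mat_mult[OF invariantD(1)[OF A]] kernel_mat_mult[OF invariantD(1)[OF B]]
proof (rule kernel_mat_cong)
  fix a b assume ab: "a \<in> A" "b \<in> B"
  hence D: "a \<in> D" "b \<in> D" using invariantD(2) A B by auto
  have "(\<Sum>c\<in>A. projection_coeff a c * K c b) =
      projection_coeff a a * K a b + projection_coeff a (\<tau> a) * K (\<tau> a) b"
    using \<tau>_involutive invariantD(2)[OF A]
    by (intro sum_mirror_pair[OF A ab(1)]) (auto simp: projection_coeff_def)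
  also have "\<dots> = emb (1 / 2) * (K a b + \<phi> (\<tau> a) * K (\<tau> a) b)"
    using \<tau>_neq[OF D(1)] \<tau>_involutive[OF D(1)] by (simp add: projection_coeff_def distrib_left mult.assoc)
  also have "\<dots> = K a b * projection_coeff b b + K a (\<tau> b) * projection_coeff (\<tau> b) b"
    using \<tau>_neq[OF D(2)] commutes[OF ab] by (simp add: projection_coeff_def algebra_simps)
  also have "\<dots> = (\<Sum>c\<in>B. K a c * projection_coeff c b)"
    by (rule sum_mirror_pair[OF B ab(2), symmetric]) (auto simp: projection_coeff_def)
  finally show "(\<Sum>c\<in>A. projection_coeff a c * K c b) = (\<Sum>c\<in>B. K a c * projection_coeff c b)" .
qed

end

subsection \<open>Frames with alternating symmetry\<close>

locale split_frame = young_frame m \<mu> L t + real_embedding emb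
  for m \<mu> L t and emb :: "real \<Rightarrow> 'a::conjugatable_field" +
  fixes \<theta> :: 'a
  assumes two_boxes: "2 \<le> m" and selfconjugate: "transpose_partition \<mu> = \<mu>"
    and L_transpose: "\<And>\<nu>. \<nu> \<in> L \<Longrightarrow> transpose_partition \<nu> \<in> L"
    and t_even: "\<And>k. k \<in> {1..Suc m} \<Longrightarrow> evenperm (t k)"
    and \<theta>_unit: "\<theta> * conjugate \<theta> = 1"
    and \<theta>_square: "\<theta> * \<theta> = emb ((- 1) ^ card {b \<in> diagram \<mu>. fst b < snd b})"
begin

abbreviation half_tabs :: "tableau set" where
  "half_tabs \<equiv> {T. T (1, 2) = 2}"

abbreviation sign_\<mu> :: "tableau \<Rightarrow> real" where
  "sign_\<mu> \<equiv> tab_sign (diagram \<mu>)"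

definition phase :: "tableau \<Rightarrow> 'a" where
  "phase T = \<theta> * emb (sign_\<mu> T)"

lemma transpose_tab_Tab_L:
  assumes "\<nu> \<in> L" "T \<in> Tab \<nu>"
  shows "transpose_tab T \<in> Tab (transpose_partition \<nu>)"
  using transpose_tab_SYT_shape assms(2)
  by (simp add: Tab_L[OF assms(1)] Tab_L[OF L_transpose[OF assms(1)]]
    diagram_transpose[OF L_partition[OF assms(1)]])

sublocale symmetric_family "Suc m" "Tabs L" "diagram \<mu>"
proof
  show "transpose_tab T \<in> Tabs L" if "T \<in> Tabs L" for T
    using that transpose_tab_Tab_L L_transpose unfolding Tabs_def by blast
  fix T assume "T \<in> Tabs L"
  then obtain \<nu> where "shape T = insert (new_box \<nu>) (diagram \<mu>)"
    by (auto simp: Tabs_def Tab_L SYT_shape_def L_diagram)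
  thus "diagram \<mu> \<subseteq> shape T" "\<exists>b. shape T - diagram \<mu> \<subseteq> {b}" by blast+
qed (simp_all add: finite_diagram diagram_selfconjugate[OF partition selfconjugate])

sublocale base: symmetric_family m "Tab \<mu>" "diagram \<mu>"
proof (rule symmetric_family.intro[OF tableau_family_Tab[OF partition]], unfold_locales)
  show "transpose_tab T \<in> Tab \<mu>" if "T \<in> Tab \<mu>" for T
    using transpose_tab_SYT_shape[of T m "diagram \<mu>"] that
    by (simp add: Tab_\<mu> diagram_selfconjugate[OF partition selfconjugate])
qed (auto simp: Tab_\<mu> SYT_shape_def finite_diagram diagram_selfconjugate[OF partition selfconjugate])

lemma conjugate_\<theta>: "conjugate \<theta> = \<theta> * emb mirror_sign"
proof -
  have "mirror_sign * mirror_sign = 1" by (simp add: mirror_sign_def flip: power_mult_distrib)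
  hence "emb mirror_sign * emb mirror_sign = 1" by (simp flip: hom_mult)
  hence "conjugate \<theta> = conjugate \<theta> * (\<theta> * \<theta>) * emb mirror_sign"
    by (simp add: \<theta>_square mirror_sign_def mult.assoc)
  also have "\<dots> = (\<theta> * conjugate \<theta>) * \<theta> * emb mirror_sign" by (simp add: ac_simps)
  finally show ?thesis by (simp add: \<theta>_unit)
qed

sublocale twisted: twisted_involution emb "Tabs L \<union> Tab \<mu>" half_tabs transpose_tab phase
proof
  fix T assume T: "T \<in> Tabs L \<union> Tab \<mu>"
  obtain k where "T \<in> SYT k" "2 \<le> k"
    using T family_SYT base.family_SYT two_boxes by (metis Un_iff le_Suc_eq)
  from SYT_second_entry[OF this]
  show "transpose_tab T \<in> half_tabs \<longleftrightarrow> T \<notin> half_tabs" by (simp add: transpose_tab_apply)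
  have "emb (sign_\<mu> T) * emb (sign_\<mu> T) = 1" using tab_sign_square by (simp flip: hom_mult)
  hence "phase T * conjugate (phase T) = \<theta> * conjugate \<theta>"
    by (simp add: phase_def conjugate_dist_mul conjugate_emb ac_simps)
  thus "phase T * conjugate (phase T) = 1" by (simp only: \<theta>_unit)
  have "sign_\<mu> (transpose_tab T) = mirror_sign * sign_\<mu> T"
    using T tab_sign_mirror base.tab_sign_mirror by (auto simp: mirror_sign_def base.mirror_sign_def)
  thus "phase (transpose_tab T) = conjugate (phase T)"
    by (simp add: phase_def conjugate_dist_mul conjugate_emb conjugate_\<theta> hom_mult mult.assoc)
qed simp

lemma invariant_Tabs: "twisted.invariant (Tabs L)" "twisted.invariant (Tab \<mu>)"
  using finite_family finite_Tab_\<mu> transpose_closed base.transpose_closed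
  by (auto simp: twisted.invariant_def)

lemma transpose_tab_extend:
  "\<nu> \<in> L \<Longrightarrow> transpose_tab (extend \<nu> R) = extend (transpose_partition \<nu>) (transpose_tab R)"
  by (rule ext) (simp add: transpose_tab_apply added_box_transpose[OF partition selfconjugate L_up_set],
    metis swap_swap)

lemma transpose_bij_L: "bij_betw transpose_partition L L"
  by (rule bij_betwI[where g = transpose_partition])
    (use L_transpose transpose_partition_involutive[OF L_partition] in auto)

lemma weight_transpose: "\<nu> \<in> L \<Longrightarrow> weight (transpose_partition \<nu>) = weight \<nu>"
  using d_tab_num_SYT[OF L_partition] L_transpose
  by (simp add: weight_def diagram_transpose[OF L_partition] num_SYT_swap)

lemma psi_coeff_transpose: "psi_coeff (transpose_tab T) R = psi_coeff T (transpose_tab R)"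
proof -
  have "psi_coeff T (transpose_tab R) =
      (\<Sum>\<nu>\<in>L. if T = extend (transpose_partition \<nu>) (transpose_tab R)
        then sqrt (weight (transpose_partition \<nu>)) else 0)"
    unfolding psi_coeff_def by (rule sum.reindex_bij_betw[OF transpose_bij_L, symmetric])
  also have "\<dots> = psi_coeff (transpose_tab T) R"
    unfolding psi_coeff_def
    by (intro sum.cong refl) (simp add: weight_transpose transpose_tab_eq_iff
      flip: transpose_tab_extend del: fun_upd_apply)
  finally show ?thesis by simp
qed

lemma psi_coeff_sign:
  assumes "R \<in> Tab \<mu>"
  shows "sign_\<mu> T * psi_coeff T R = psi_coeff T R * sign_\<mu> R"
proof (cases "\<exists>\<nu>\<in>L. T = extend \<nu> R")
  case True
  then obtain \<nu> where \<nu>: "\<nu> \<in> L" "T = extend \<nu> R" by blast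
  have "sign_\<mu> T = sign_\<mu> R"
    unfolding \<nu>(2) using assms new_box_addable[OF \<nu>(1)] unfolding Tab_\<mu> by (rule tab_sign_extend)
  thus ?thesis by simp
next
  case False
  hence "psi_coeff T R = 0" unfolding psi_coeff_def by (intro sum.neutral) auto
  thus ?thesis by simp
qed

sublocale embedded_frame "Suc m" "d_sum L" "d_tab \<mu>" "carrier (sym_group (Suc m))"
  "rep_sum L" "Psi_sum L \<mu>" t emb ..

lemma rep_sum_splits:
  assumes "g \<in> carrier (alt_group (Suc m))"
  shows "intertwines (twisted.eigen_mat (Tabs L)) (twisted.eigen_mat (Tabs L)) (map_mat emb (rep_sum L g))"
proof -
  have g: "g permutes {1..Suc m}" "sign g = 1" using assms by (simp_all add: alt_group_carrier sign_def)
  show ?thesis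
    unfolding rep_sum_eq[OF g(1)] young_mat_def map_mat_kernel_mat
  proof (rule twisted.eigen_mat_intertwines[OF invariant_Tabs(1) invariant_Tabs(1)])
    fix S T assume "S \<in> Tabs L" "T \<in> Tabs L"
    with young_coeff_transpose_tab[OF g(1)]
    have "emb (sign_\<mu> (transpose_tab S) * young_coeff (Suc m) g (transpose_tab S) T) =
        emb (young_coeff (Suc m) g S (transpose_tab T) * sign_\<mu> T)" by (simp add: g(2))
    thus "phase (transpose_tab S) * emb (young_coeff (Suc m) g (transpose_tab S) T) =
        emb (young_coeff (Suc m) g S (transpose_tab T)) * phase T"
      by (simp add: phase_def hom_mult ac_simps)
  qed
qed

lemma Psi_sum_splits:
  "intertwines (twisted.eigen_mat (Tabs L)) (twisted.eigen_mat (Tab \<mu>)) (map_mat emb (Psi_sum L \<mu>))"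
  unfolding Psi_sum_eq map_mat_kernel_mat
proof (rule twisted.eigen_mat_intertwines[OF invariant_Tabs])
  fix T R assume "T \<in> Tabs L" "R \<in> Tab \<mu>"
  hence "emb (sign_\<mu> (transpose_tab T) * psi_coeff (transpose_tab T) R) =
      emb (psi_coeff T (transpose_tab R) * sign_\<mu> R)"
    using psi_coeff_sign[of R "transpose_tab T"] by (simp only: psi_coeff_transpose)
  thus "phase (transpose_tab T) * emb (psi_coeff (transpose_tab T) R) =
      emb (psi_coeff T (transpose_tab R)) * phase R"
    by (simp add: phase_def hom_mult ac_simps)
qed

lemma card_halves: "card (Tabs L) = 2 * card (Tabs L \<inter> half_tabs)" "card (Tab \<mu>) = 2 * card (Tab \<mu> \<inter> half_tabs)"
  by (rule twisted.card_invariant[OF invariant_Tabs(1)] twisted.card_invariant[OF invariant_Tabs(2)])+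

lemma even_dimensions: "even (d_tab \<mu>)" "even (d_sum L)"
  using card_halves by (simp_all add: d_tab_def flip: card_Tabs)

sublocale split: restricted_frame "Suc m" "d_sum L" "d_tab \<mu>" "carrier (sym_group (Suc m))"
  "\<lambda>g. map_mat emb (rep_sum L g)" "map_mat emb (Psi_sum L \<mu>)" t "d_sum L div 2" "d_tab \<mu> div 2"
  "carrier (alt_group (Suc m))" "twisted.eigen_mat (Tabs L)" "twisted.eigen_mat (Tab \<mu>)"
proof (rule restricted_frame.intro[OF embedded.orbit_frame_axioms], rule restricted_frame_axioms.intro)
  show "carrier (alt_group (Suc m)) \<subseteq> carrier (sym_group (Suc m))"
    by (auto simp: alt_group_carrier sym_group_carrier)
  show "t k \<in> carrier (alt_group (Suc m))" if "k \<in> {1..Suc m}" for k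
    using transversal(1)[OF that] t_even[OF that] by (simp add: alt_group_carrier)
  show "isometry_mat (d_sum L) (d_sum L div 2) (twisted.eigen_mat (Tabs L))"
    "isometry_mat (d_tab \<mu>) (d_tab \<mu> div 2) (twisted.eigen_mat (Tab \<mu>))"
    using twisted.eigen_mat_isometry[OF invariant_Tabs(1)] twisted.eigen_mat_isometry[OF invariant_Tabs(2)]
      card_halves
    by (simp_all add: card_Tabs d_tab_def)
qed (rule alt_group_is_subgroup rep_sum_splits Psi_sum_splits; assumption)+

lemma equi_isoclinic_tff_split:
  assumes "\<forall>R\<in>Tab \<mu>. (swap_eigenvalue R)\<^sup>2 = \<alpha>"
  shows "equi_isoclinic_tff (Suc m) (d_tab \<mu> div 2) (d_sum L div 2) split.restricted.subspace"
proof (rule split.equi_isoclinic_tff_restricted)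
  fix g assume g: "g \<in> carrier (sym_group (Suc m))" "g (Suc m) \<noteq> Suc m"
  have "mat_adjoint (compressed g) * compressed g = \<alpha> \<cdot>\<^sub>m 1\<^sub>m (d_tab \<mu>)"
    using compressed_square_iff[of g] g two_boxes assms by (simp add: sym_group_carrier)
  thus "mat_adjoint (embedded.compressed g) * embedded.compressed g = emb \<alpha> \<cdot>\<^sub>m 1\<^sub>m (d_tab \<mu>)"
    by (rule embedded_compressed_square[OF g(1)])
next
  show "embedded.frame_op = emb (real (Suc m) * real (d_tab \<mu>) / real (d_sum L)) \<cdot>\<^sub>m 1\<^sub>m (d_sum L)"
    by (simp only: embedded_frame_op frame_op_scalar map_mat_smult_one)
qed

end

lemma even_transversal:
  assumes "2 \<le> m"
  obtains t where
    "\<forall>k\<in>{1..Suc m}. t k permutes {1..Suc m} \<and> t k (Suc m) = k \<and> evenperm (t k)"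
proof
  let ?t = "\<lambda>k. if k = Suc m then id else Transposition.transpose k (Suc m) \<circ> Transposition.transpose 1 2"
  show "\<forall>k\<in>{1..Suc m}. ?t k permutes {1..Suc m} \<and> ?t k (Suc m) = k \<and> evenperm (?t k)"
  proof (intro ballI conjI)
    fix k assume k: "k \<in> {1..Suc m}"
    have "Transposition.transpose k (Suc m) permutes {1..Suc m}" "Transposition.transpose 1 2 permutes {1..Suc m}"
      using k assms by (auto intro!: permutes_swap_id)
    thus "?t k permutes {1..Suc m}" by (simp add: permutes_id permutes_compose)
    show "?t k (Suc m) = k" using assms by (simp add: transpose_apply_other)
    show "evenperm (?t k)"
      using evenperm_comp[OF permutation_swap_id[of k "Suc m"] permutation_swap_id[of 1 2]]
      by (simp add: evenperm_swap evenperm_id)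
  qed
qed

lemma even_parts_two_boxes:
  assumes p: "is_partition m \<mu>" and "1 \<le> m" and even: "even (card (set \<mu>))"
  shows "2 \<le> m"
proof -
  have "\<mu> \<noteq> []" using assms(1,2) by (auto simp: is_partition_def)
  hence "card (set \<mu>) \<noteq> 0" by simp
  moreover have "card (set \<mu>) \<le> m"
    using card_mono[OF finite_diagram removable_subset, of \<mu>] p
    by (simp add: card_removable[OF p, symmetric] card_diagram is_partition_def)
  ultimately show ?thesis using even by presburger
qed

lemma alternating_frame:
  fixes emb :: "real \<Rightarrow> 'a::conjugatable_field"
  assumes p: "is_partition m \<mu>" and selfconjugate: "transpose_partition \<mu> = \<mu>" and iso: "isoclinic \<mu>"
    and even: "even (card (set \<mu>))" and \<delta>: "\<delta> \<in> {0, 1}" and emb: "real_embedding emb"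
    and \<theta>: "\<theta> * conjugate \<theta> = 1" "\<theta> * \<theta> = emb ((- 1) ^ card {b \<in> diagram \<mu>. fst b < snd b})"
  shows "even (d_tab \<mu>) \<and> even (d_sum (L_parity \<delta> \<mu>)) \<and> (\<exists>W :: nat \<Rightarrow> 'a vec set.
    equi_isoclinic_tff (Suc m) (d_tab \<mu> div 2) (d_sum (L_parity \<delta> \<mu>) div 2) W \<and>
    carrier (alt_group (Suc m)) \<subseteq> fusion_aut (Suc m) (d_sum (L_parity \<delta> \<mu>) div 2) W)"
proof -
  note isoclinic = isoclinic_L_parity[OF p iso \<delta>]
  have two: "2 \<le> m" by (rule even_parts_two_boxes[OF p isoclinic(1) even])
  obtain t where t: "\<forall>k\<in>{1..Suc m}. t k permutes {1..Suc m} \<and> t k (Suc m) = k \<and> evenperm (t k)"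
    using even_transversal[OF two] .
  interpret split_frame m \<mu> "L_parity \<delta> \<mu>" t emb \<theta>
    by (intro split_frame.intro split_frame_axioms.intro young_frame.intro young_frame_axioms.intro
        isoclinic(2) emb two selfconjugate L_parity_transpose[OF p selfconjugate even] \<theta>)
      (use t in blast)+
  obtain \<alpha> where "\<forall>R\<in>Tab \<mu>. (swap_eigenvalue R)\<^sup>2 = \<alpha>" using isoclinic(3) ..
  thus ?thesis
    using even_dimensions equi_isoclinic_tff_split split.restricted.G_automorphisms by blast
qed

theorem theorem7p2:
  fixes n \<delta> :: nat and \<mu> :: "nat list"
  assumes "n \<ge> 1" and "is_partition (n - 1) \<mu>"
    and "isoclinic \<mu>"
    and "transpose_partition \<mu> = \<mu>"
    and "even (card (set \<mu>))"
    and "\<delta> \<in> {0, 1}"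
  shows "even (d_tab \<mu>) \<and> even (d_sum (L_parity \<delta> \<mu>)) \<and>
    (if \<exists>q::int. even q \<and> (real n - 1 - real (durfee \<mu>)) / 2 = of_int q
     then \<exists>W :: nat \<Rightarrow> real vec set.
            equi_isoclinic_tff n (d_tab \<mu> div 2) (d_sum (L_parity \<delta> \<mu>) div 2) W \<and>
            carrier (alt_group n) \<subseteq> fusion_aut n (d_sum (L_parity \<delta> \<mu>) div 2) W
     else \<exists>W :: nat \<Rightarrow> complex vec set.
            equi_isoclinic_tff n (d_tab \<mu> div 2) (d_sum (L_parity \<delta> \<mu>) div 2) W \<and>
            carrier (alt_group n) \<subseteq> fusion_aut n (d_sum (L_parity \<delta> \<mu>) div 2) W)"
proof -
  obtain m where n: "n = Suc m" using assms(1) by (cases n) auto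
  have p: "is_partition m \<mu>" using assms(2) by (simp add: n)
  define e where "e = card {b \<in> diagram \<mu>. fst b < snd b}"
  have "m = durfee \<mu> + 2 * e"
    unfolding e_def by (rule durfee_eq[OF p assms(4) isoclinic_L_parity(1)[OF p assms(3,6)]])
  hence "(real n - 1 - real (durfee \<mu>)) / 2 = of_int (int e)" by (simp add: n)
  hence parity: "(\<exists>q::int. even q \<and> (real n - 1 - real (durfee \<mu>)) / 2 = of_int q) \<longleftrightarrow> even e"
    by (simp only: of_int_eq_iff) simp
  show ?thesis
  proof (cases "even e")
    case True
    have "real_embedding (\<lambda>x::real. x)" by unfold_locales auto
    from alternating_frame[OF p assms(4,3,5,6) this, of 1] show ?thesis
      using True unfolding parity by (simp add: n flip: e_def)
  next
    case False
    have "real_embedding complex_of_real" by unfold_locales auto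
    from alternating_frame[OF p assms(4,3,5,6) this, of \<i>] show ?thesis
      using False unfolding parity by (simp add: n flip: e_def)
  qed
qed

end
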